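(* Let $(S,s)$ be a smooth complex analytic surface germ, let $L$ be a smooth branch on $S$, and let $\mathcal{F}$ be a finite set of branches on $S$, each of which is transversal to $L$. Then the function $u_L : \mathcal{F}\times\mathcal{F}\to[0,\infty)$ defined by $$u_L(A,B) := \frac{(L\cdot A)\,(L\cdot B)}{A\cdot B}\ \text{ if } A\neq B,\qquad u_L(A,A):=0,$$ is an ultrametric on $\mathcal{F}$.
   Context: A smooth surface singularity $(S,s)$ is a germ of smooth complex analytic surface (isomorphic to $(\mathbb{C}^2,0)$), with local ring $\mathcal{O}_{S,s}\simeq\mathbb{C}\{x,y\}$ and maximal ideal $\mathfrak{m}_{S,s}$. A branch on $S$ is an irreducible (reduced) germ at $s$ of complex analytic curve contained in $S$; it is the zero locus $Z(f)$ of an irreducible $f\in\mathfrak{m}_{S,s}$, called a defining function. A branch is smooth if it has a defining function $f \in \mathfrak{m}_{S,s}\setminus\mathfrak{m}_{S,s}^2$. The intersection number of two curve germs $C=Z(f)$, $D=Z(g)$ with $f,g\in\mathfrak{m}_{S,s}$ is $C\cdot D:=\dim_{\mathbb{C}}\mathcal{O}_{S,s}/(f,g)\in\mathbb{N}\cup\{\infty\}$; it is finite if and only if $C$ and $D$ have no common branch. Given local coordinates $(x,y)$ on $(S,s)$, the lowest degree homogeneous part of a defining function of a branch is a power of a complex linear form; the line in $T_sS$ defined by this linear form is the tangent line of the branch (it is independent of choices). Two branches are transversal if their tangent lines are distinct. An ultrametric on a set $M$ is a distance $d$ on $M$ such that $d(A,B)\le\max\{d(A,C),d(B,C)\}$ for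 all $A,B,C\in M$. *)

theory Defs
  imports
    "HOL-Analysis.Analysis"
    "HOL-Algebra.Embedded_Algebras"
    "HOL-Algebra.Ideal_Product"
    "HOL-Algebra.QuotRing"
    "HOL-Algebra.Ring_Divisibility"
begin

section \<open>Smooth surface germs and their local rings\<close>

text \<open>
  A smooth surface germ is a point \<open>s\<close> of a topological space together with a homeomorphism
  \<open>\<phi>\<close> from a neighbourhood of \<open>s\<close> onto an open neighbourhood of \<open>(0, 0)\<close> in \<open>\<complex>\<^sup>2\<close>: the two
  components of \<open>\<phi>\<close> are local coordinates \<open>(x, y)\<close> at \<open>s\<close>, and the complex structure of the
  germ is the one transported by \<open>\<phi>\<close>.
\<close>

definition smooth_surface_germ ::
    "'a::topological_space \<Rightarrow> ('a \<Rightarrow> complex \<times> complex) \<Rightarrow> bool" where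
  "smooth_surface_germ s \<phi> \<longleftrightarrow>
     (\<exists>U V \<psi>. open U \<and> s \<in> U \<and> open V \<and> homeomorphism U V \<phi> \<psi> \<and> \<phi> s = (0, 0))"

definition has_expansion ::
    "'a::topological_space \<Rightarrow> ('a \<Rightarrow> complex \<times> complex) \<Rightarrow> ('a \<Rightarrow> complex) \<Rightarrow>
      (nat \<Rightarrow> nat \<Rightarrow> complex) \<Rightarrow> bool" where
  "has_expansion s \<phi> f a \<longleftrightarrow>
     (\<forall>\<^sub>F p in nhds s.
        ((\<lambda>(i, j). a i j * fst (\<phi> p) ^ i * snd (\<phi> p) ^ j) has_sum f p) UNIV)"

definition analytic_near ::
    "'a::topological_space \<Rightarrow> ('a \<Rightarrow> complex \<times> complex) \<Rightarrow> ('a \<Rightarrow> complex) \<Rightarrow> bool" where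
  "analytic_near s \<phi> f \<longleftrightarrow> (\<exists>a. has_expansion s \<phi> f a)"

definition analytic_ring ::
    "'a::topological_space \<Rightarrow> ('a \<Rightarrow> complex \<times> complex) \<Rightarrow> ('a \<Rightarrow> complex) ring" where
  "analytic_ring s \<phi> =
     \<lparr>carrier = {f. analytic_near s \<phi> f}, mult = (\<lambda>f g p. f p * g p), one = (\<lambda>_. 1),
      zero = (\<lambda>_. 0), add = (\<lambda>f g p. f p + g p)\<rparr>"

definition null_ideal ::
    "'a::topological_space \<Rightarrow> ('a \<Rightarrow> complex \<times> complex) \<Rightarrow> ('a \<Rightarrow> complex) set" where
  "null_ideal s \<phi> = {f. analytic_near s \<phi> f \<and> (\<forall>\<^sub>F p in nhds s. f p = 0)}"

text \<open>
  The elements of the local ring \<open>\<O>\<close> are function germs, that is, classes of functions analytic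
  near \<open>s\<close> that agree on a neighbourhood of \<open>s\<close>.
\<close>

definition local_ring ::
    "'a::topological_space \<Rightarrow> ('a \<Rightarrow> complex \<times> complex) \<Rightarrow> ('a \<Rightarrow> complex) set ring" where
  "local_ring s \<phi> = analytic_ring s \<phi> Quot null_ideal s \<phi>"

definition germ_of ::
    "'a::topological_space \<Rightarrow> ('a \<Rightarrow> complex \<times> complex) \<Rightarrow> ('a \<Rightarrow> complex) \<Rightarrow>
      ('a \<Rightarrow> complex) set" where
  "germ_of s \<phi> f = null_ideal s \<phi> +>\<^bsub>analytic_ring s \<phi>\<^esub> f"

definition max_ideal ::
    "'a::topological_space \<Rightarrow> ('a \<Rightarrow> complex \<times> complex) \<Rightarrow> ('a \<Rightarrow> complex) set set" where
  "max_ideal s \<phi> = {germ_of s \<phi> f | f. analytic_near s \<phi> f \<and> f s = 0}"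

section \<open>Branches\<close>

text \<open>
  The zero locus of a function germ is a germ of sets, i.e. a class of subsets of the space that
  agree on a neighbourhood of \<open>s\<close>.
\<close>

definition zero_locus ::
    "'a::topological_space \<Rightarrow> ('a \<Rightarrow> complex) set \<Rightarrow> 'a set set" where
  "zero_locus s F = {X. \<exists>f\<in>F. \<forall>\<^sub>F p in nhds s. p \<in> X \<longleftrightarrow> f p = 0}"

definition defining_function ::
    "'a::topological_space \<Rightarrow> ('a \<Rightarrow> complex \<times> complex) \<Rightarrow> 'a set set \<Rightarrow>
      ('a \<Rightarrow> complex) set \<Rightarrow> bool" where
  "defining_function s \<phi> A F \<longleftrightarrow>
     F \<in> max_ideal s \<phi> \<and> ring_irreducible\<^bsub>local_ring s \<phi>\<^esub> F \<and> A = zero_locus s F"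

definition branch ::
    "'a::topological_space \<Rightarrow> ('a \<Rightarrow> complex \<times> complex) \<Rightarrow> 'a set set \<Rightarrow> bool" where
  "branch s \<phi> A \<longleftrightarrow> (\<exists>F. defining_function s \<phi> A F)"

definition smooth_branch ::
    "'a::topological_space \<Rightarrow> ('a \<Rightarrow> complex \<times> complex) \<Rightarrow> 'a set set \<Rightarrow> bool" where
  "smooth_branch s \<phi> A \<longleftrightarrow>
     (\<exists>F. defining_function s \<phi> A F \<and>
        F \<notin> ideal_prod (local_ring s \<phi>) (max_ideal s \<phi>) (max_ideal s \<phi>))"

text \<open>
  A fixed defining function of a branch. Two defining functions of the same branch differ by a
  unit of the local ring, so intersection numbers and tangent lines do not depend on this choice.
\<close>

definition equation_of ::
    "'a::topological_space \<Rightarrow> ('a \<Rightarrow> complex \<times> complex) \<Rightarrow> 'a set set \<Rightarrow>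
      ('a \<Rightarrow> complex) set" where
  "equation_of s \<phi> A = (SOME F. defining_function s \<phi> A F)"

section \<open>Intersection numbers\<close>

text \<open>
  The dimension is taken over the copy of \<open>\<complex>\<close> in \<open>\<O>/(F, G)\<close> formed by the classes of constants.
\<close>

definition intersection_number ::
    "'a::topological_space \<Rightarrow> ('a \<Rightarrow> complex \<times> complex) \<Rightarrow> ('a \<Rightarrow> complex) set \<Rightarrow>
      ('a \<Rightarrow> complex) set \<Rightarrow> enat" where
  "intersection_number s \<phi> F G =
     (let R = local_ring s \<phi>;
          I = Idl\<^bsub>R\<^esub> {F, G};
          Q = R Quot I;
          K = (\<lambda>c. I +>\<^bsub>R\<^esub> germ_of s \<phi> (\<lambda>_. c)) ` UNIV
      in if ring.finite_dimension Q K (carrier Q) then enat (ring.dim Q K (carrier Q)) else \<infinity>)"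

definition branch_intersection ::
    "'a::topological_space \<Rightarrow> ('a \<Rightarrow> complex \<times> complex) \<Rightarrow> 'a set set \<Rightarrow> 'a set set \<Rightarrow>
      enat" where
  "branch_intersection s \<phi> A B = intersection_number s \<phi> (equation_of s \<phi> A) (equation_of s \<phi> B)"

section \<open>Tangent lines\<close>

definition expansion_order :: "(nat \<Rightarrow> nat \<Rightarrow> complex) \<Rightarrow> nat" where
  "expansion_order a = (LEAST d. \<exists>i j. i + j = d \<and> a i j \<noteq> 0)"

definition initial_form :: "(nat \<Rightarrow> nat \<Rightarrow> complex) \<Rightarrow> complex \<Rightarrow> complex \<Rightarrow> complex" where
  "initial_form a u v =
     (\<Sum>i\<le>expansion_order a. a i (expansion_order a - i) * u ^ i * v ^ (expansion_order a - i))"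

text \<open>
  The tangent plane at \<open>s\<close> is identified with \<open>\<complex>\<^sup>2\<close> by means of the coordinates \<open>\<phi>\<close>. A scalar
  factor in front of the power of the linear form can be absorbed into the form. Every branch has
  exactly one tangent line in the sense of the following relation.
\<close>

definition is_tangent_line ::
    "'a::topological_space \<Rightarrow> ('a \<Rightarrow> complex \<times> complex) \<Rightarrow> 'a set set \<Rightarrow>
      (complex \<times> complex) set \<Rightarrow> bool" where
  "is_tangent_line s \<phi> A T \<longleftrightarrow>
     (\<exists>f a \<alpha> \<beta>. f \<in> equation_of s \<phi> A \<and> has_expansion s \<phi> f a \<and> (\<alpha>, \<beta>) \<noteq> (0, 0) \<and>
        (\<forall>u v. initial_form a u v = (\<alpha> * u + \<beta> * v) ^ expansion_order a) \<and>
        T = {(u, v). \<alpha> * u + \<beta> * v = 0})"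

definition transversal ::
    "'a::topological_space \<Rightarrow> ('a \<Rightarrow> complex \<times> complex) \<Rightarrow> 'a set set \<Rightarrow> 'a set set \<Rightarrow>
      bool" where
  "transversal s \<phi> A B \<longleftrightarrow>
     (\<exists>T T'. is_tangent_line s \<phi> A T \<and> is_tangent_line s \<phi> B T' \<and> T \<noteq> T')"

section \<open>Ultrametrics\<close>

definition ultrametric_on :: "'b set \<Rightarrow> ('b \<Rightarrow> 'b \<Rightarrow> real) \<Rightarrow> bool" where
  "ultrametric_on M d \<longleftrightarrow>
     Metric_space M d \<and> (\<forall>A\<in>M. \<forall>B\<in>M. \<forall>C\<in>M. d A B \<le> max (d A C) (d B C))"

text \<open>
  An infinite intersection number is sent to \<open>0\<close> by \<^const>\<open>real_of_ereal\<close>. So if one of the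
  numbers entering \<open>u\<^sub>L(A, B)\<close> with \<open>A \<noteq> B\<close> were infinite or \<open>0\<close>, then \<open>u\<^sub>L(A, B)\<close> would be \<open>0\<close>
  and \<open>u\<^sub>L\<close> would not be a distance.
\<close>

definition enat_to_real :: "enat \<Rightarrow> real" where
  "enat_to_real n = real_of_ereal (ereal_of_enat n)"

definition u_dist ::
    "'a::topological_space \<Rightarrow> ('a \<Rightarrow> complex \<times> complex) \<Rightarrow> 'a set set \<Rightarrow> 'a set set \<Rightarrow>
      'a set set \<Rightarrow> real" where
  "u_dist s \<phi> L A B =
     (if A = B then 0
      else enat_to_real (branch_intersection s \<phi> L A) * enat_to_real (branch_intersection s \<phi> L B)
           / enat_to_real (branch_intersection s \<phi> A B))"

end

theory Submission
  imports Defs "HOL-Computational_Algebra.Computational_Algebra"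
begin

unbundle no vec_syntax
unbundle fps_syntax

text \<open>
  Choose coordinates \<open>(x, y)\<close> in which \<open>L\<close> is the line \<open>x = 0\<close>, and let \<open>A\<close>, \<open>B\<close> be branches other
  than \<open>L\<close>. By the Newton--Puiseux theorem and irreducibility, for a suitable \<open>N\<close> the equation of
  \<open>A\<close> becomes, after the substitution \<open>x = t\<^sup>N\<close>, a unit times the product of \<open>y - a(t)\<close>, where \<open>a\<close>
  ranges over one orbit of the group \<open>\<mu>\<^sub>N\<close> acting by \<open>t \<mapsto> z t\<close>. The substitution multiplies
  codimensions of ideals by \<open>N\<close>, and codimensions are additive in the factors, so that
  \<open>N (A \<cdot> B)\<close> is the sum of the orders of all differences \<open>a - b\<close> of roots of \<open>A\<close> and \<open>B\<close>, while
  \<open>L \<cdot> A\<close> is the number of roots of \<open>A\<close>. As the orbits are transitive, \<open>N\<^sup>2 / u\<^sub>L(A, B)\<close> is the sum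
  \<open>T(a, b)\<close> of the orders of \<open>a - z b\<close> over \<open>z \<in> \<mu>\<^sub>N\<close>, for any two roots \<open>a\<close>, \<open>b\<close>. Given a third
  branch \<open>C\<close>, take a root \<open>c\<close> closest to \<open>a\<close>, and assume that \<open>C\<close> has a root at least as close to
  some root of \<open>B\<close>. Choosing \<open>b\<close> accordingly, one has \<open>T(a, c) \<le> T(a, b)\<close> term by term.
\<close>

section \<open>Convergent power series\<close>

text \<open>The local ring consists of convergent series, so every construction has to stay
  convergent. The substantial estimates sit in the Weierstrass division, in the dictionary between
  germs and series, and in the change of coordinates. The Newton-Puiseux theorem then needs none of
  its own: preparation turns the equation into a polynomial in y, each step along the Newton polygon
  strictly lowers its order on the axis x = 0, and after finitely many steps inside the convergent
  series a root is reached. Codimension is a relation, \<open>has_codim\<close>, that asserts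
  finiteness together with the value. Finiteness is visible only over t, where the equation splits
  into linear factors; it descends because the ring over t is free of rank N over the ring over x.
  Contact is summed over the group of N-th roots of unity instead of an orbit, with one N for all
  three branches. Orbits of different sizes thus get the same index set, which makes a comparison
  term by term possible. Equations and zero loci are mostly compared in the easy direction:
  associated equations have the same locus. The one converse that is used, for \<open>L\<close>, is
  that a series vanishing on the axis is divisible by x.\<close>

definition conv1 :: "complex fps \<Rightarrow> bool" where
  "conv1 f \<longleftrightarrow> (\<exists>C R. C > 0 \<and> R \<ge> 1 \<and> (\<forall>i. norm (f $ i) \<le> C * R ^ i))"

text \<open>Positive radius of convergence, stated as a Cauchy estimate with a single
  \<open>R\<close> for both variables. Requiring \<open>R \<ge> 1\<close> makes the bound grow with
  the exponents; the substitution of x^N needs this, since it carries the coefficient of index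
  \<open>i div N\<close> to index \<open>i\<close>.\<close>

definition conv2 :: "complex fps fps \<Rightarrow> bool" where
  "conv2 F \<longleftrightarrow> (\<exists>C R. C > 0 \<and> R \<ge> 1 \<and> (\<forall>i j. norm (F $ i $ j) \<le> C * R ^ (i + j)))"

lemma conv1I:
  assumes "\<And>i. norm (f $ i) \<le> C * R ^ i" "R \<ge> 0"
  shows "conv1 f"
proof -
  have "norm (f $ i) \<le> (\<bar>C\<bar> + 1) * (R + 1) ^ i" for i
  proof -
    have "C * R ^ i \<le> (\<bar>C\<bar> + 1) * (R + 1) ^ i"
      using assms(2) by (intro mult_mono power_mono) auto
    with assms(1)[of i] show ?thesis by linarith
  qed
  then show ?thesis
    unfolding conv1_def using assms(2) by (intro exI[of _ "\<bar>C\<bar> + 1"] exI[of _ "R + 1"]) auto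
qed

lemma conv2I:
  assumes "\<And>i j. norm (F $ i $ j) \<le> C * R ^ i * S ^ j" "R \<ge> 0" "S \<ge> 0"
  shows "conv2 F"
proof -
  define T where "T = R + S + 1"
  have "norm (F $ i $ j) \<le> (\<bar>C\<bar> + 1) * T ^ (i + j)" for i j
  proof -
    have "C * R ^ i * S ^ j \<le> (\<bar>C\<bar> + 1) * T ^ i * T ^ j"
      using assms(2,3) by (intro mult_mono power_mono) (auto simp: T_def)
    with assms(1)[of i j] show ?thesis by (simp add: power_add mult.assoc)
  qed
  then show ?thesis
    unfolding conv2_def using assms(2,3)
    by (intro exI[of _ "\<bar>C\<bar> + 1"] exI[of _ T]) (auto simp: T_def)
qed

lemma conv2_common:
  assumes "conv2 F" "conv2 G"
  obtains C R where "C > 0" "R \<ge> 1" "\<And>i j. norm (F $ i $ j) \<le> C * R ^ (i + j)"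
    "\<And>i j. norm (G $ i $ j) \<le> C * R ^ (i + j)"
proof -
  obtain C R where 1: "C > 0" "R \<ge> 1" "\<And>i j. norm (F $ i $ j) \<le> C * R ^ (i + j)"
    using assms(1) unfolding conv2_def by auto
  obtain C' R' where 2: "C' > 0" "R' \<ge> 1" "\<And>i j. norm (G $ i $ j) \<le> C' * R' ^ (i + j)"
    using assms(2) unfolding conv2_def by auto
  have "C * R ^ i \<le> max C C' * max R R' ^ i" for i
    using 1 2 by (intro mult_mono power_mono) auto
  moreover have "C' * R' ^ i \<le> max C C' * max R R' ^ i" for i
    using 1 2 by (intro mult_mono power_mono) auto
  ultimately show ?thesis
    using 1 2 by (intro that[of "max C C'" "max R R'"]) (auto intro: order.trans[OF 1(3)] order.trans[OF 2(3)])
qed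

lemma Suc_le_power_two: "real (Suc n) \<le> 2 ^ n"
proof -
  have "Suc n \<le> 2 ^ n" by (induction n) auto
  then have "real (Suc n) \<le> real (2 ^ n)" by (rule of_nat_mono)
  then show ?thesis by simp
qed

text \<open>A series in x is viewed as a series in x and y that is constant in y. Closure of
  \<open>conv1\<close> under sums and products is pulled back from \<open>conv2\<close> along this
  embedding, so that each estimate is made once.\<close>

definition fps_lift :: "complex fps \<Rightarrow> complex fps fps" where
  "fps_lift f = Abs_fps (\<lambda>i. fps_const (f $ i))"

lemma fps_lift_nth [simp]: "fps_lift f $ i = fps_const (f $ i)"
  by (simp add: fps_lift_def)

lemma conv2_lift_iff: "conv2 (fps_lift f) \<longleftrightarrow> conv1 f"
proof
  assume "conv2 (fps_lift f)"
  then obtain C R where *: "C > 0" "R \<ge> 1" "\<And>i j. norm (fps_lift f $ i $ j) \<le> C * R ^ (i + j)"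
    unfolding conv2_def by auto
  show "conv1 f"
    by (rule conv1I[of _ C R]) (use *(2) *(3)[of _ 0] in simp_all)
next
  assume "conv1 f"
  then obtain C R where *: "C > 0" "R \<ge> 1" "\<And>i. norm (f $ i) \<le> C * R ^ i"
    unfolding conv1_def by auto
  show "conv2 (fps_lift f)"
  proof (rule conv2I)
    show "norm (fps_lift f $ i $ j) \<le> C * R ^ i * 1 ^ j" for i j
      using * by (cases j) auto
  qed (use * in auto)
qed

lemma fps_lift_hom:
  "fps_lift (f + g) = fps_lift f + fps_lift g" "fps_lift (f - g) = fps_lift f - fps_lift g"
  "fps_lift (- f) = - fps_lift f" "fps_lift (f * g) = fps_lift f * fps_lift g"
  by (simp_all add: fps_eq_iff fps_mult_nth fps_sum_nth mult_delta_left)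

lemma conv1_const: "conv1 (fps_const c)"
proof (rule conv1I)
  show "norm (fps_const c $ i) \<le> norm c * 1 ^ i" for i by auto
qed auto

lemma conv1_0: "conv1 0" and conv1_1: "conv1 1"
  using conv1_const[of 0] conv1_const[of 1] by auto

lemma conv1_X: "conv1 fps_X"
proof (rule conv1I)
  show "norm (fps_X $ i :: complex) \<le> 1 * 1 ^ i" for i by (auto simp: fps_X_def)
qed auto

lemma conv2_const:
  assumes "conv1 f"
  shows "conv2 (fps_const f)"
proof -
  obtain C R where *: "C > 0" "R \<ge> 1" "\<And>i. norm (f $ i) \<le> C * R ^ i"
    using assms unfolding conv1_def by auto
  show ?thesis
  proof (rule conv2I)
    show "norm (fps_const f $ i $ j) \<le> C * 1 ^ i * R ^ j" for i j
      using * by (cases i) auto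
  qed (use * in auto)
qed

lemma conv2_0: "conv2 0" and conv2_1: "conv2 1"
  using conv2_const[OF conv1_const[of 0]] conv2_const[OF conv1_const[of 1]] by simp_all

lemma conv2_uminus: "conv2 F \<Longrightarrow> conv2 (- F)"
  unfolding conv2_def by simp

lemma conv2_add:
  assumes "conv2 F" "conv2 G"
  shows "conv2 (F + G)"
proof -
  obtain C R where *: "C > 0" "R \<ge> 1" "\<And>i j. norm (F $ i $ j) \<le> C * R ^ (i + j)"
    "\<And>i j. norm (G $ i $ j) \<le> C * R ^ (i + j)"
    using conv2_common[OF assms] by metis
  show ?thesis
  proof (rule conv2I)
    fix i j
    show "norm ((F + G) $ i $ j) \<le> (2 * C) * R ^ i * R ^ j"
      using norm_triangle_ineq[of "F $ i $ j" "G $ i $ j"] *(3,4)[of i j] by (simp add: power_add mult_ac)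
  qed (use * in auto)
qed

lemma conv2_diff: "conv2 F \<Longrightarrow> conv2 G \<Longrightarrow> conv2 (F - G)"
  using conv2_add[of F "- G"] conv2_uminus[of G] by simp

lemma fps2_mult_nth:
  fixes F G :: "'a::comm_ring_1 fps fps"
  shows "(F * G) $ i $ j = (\<Sum>a=0..i. \<Sum>b=0..j. F $ a $ b * G $ (i - a) $ (j - b))"
  by (simp add: fps_mult_nth fps_sum_nth)

lemma conv2_mult:
  assumes "conv2 F" "conv2 G"
  shows "conv2 (F * G)"
proof -
  obtain C R where *: "C > 0" "R \<ge> 1" "\<And>i j. norm (F $ i $ j) \<le> C * R ^ (i + j)"
    "\<And>i j. norm (G $ i $ j) \<le> C * R ^ (i + j)"
    using conv2_common[OF assms] by metis
  show ?thesis
  proof (rule conv2I)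
    fix i j
    have "norm ((F * G) $ i $ j) \<le> (\<Sum>a=0..i. \<Sum>b=0..j. norm (F $ a $ b * G $ (i - a) $ (j - b)))"
      unfolding fps2_mult_nth by (intro order.trans[OF norm_sum] sum_mono norm_sum)
    also have "\<dots> \<le> (\<Sum>a=0..i. \<Sum>b=0..j. C * C * R ^ (i + j))"
    proof (intro sum_mono)
      fix a b assume ab: "a \<in> {0..i}" "b \<in> {0..j}"
      have "norm (F $ a $ b * G $ (i - a) $ (j - b)) \<le> (C * R ^ (a + b)) * (C * R ^ ((i - a) + (j - b)))"
        unfolding norm_mult using * by (intro mult_mono) auto
      also have "\<dots> = C * C * R ^ ((a + b) + ((i - a) + (j - b)))" by (simp only: power_add mult_ac)
      also have "(a + b) + ((i - a) + (j - b)) = i + j" using ab by simp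
      finally show "norm (F $ a $ b * G $ (i - a) $ (j - b)) \<le> C * C * R ^ (i + j)" .
    qed
    also have "\<dots> = (real (Suc i) * real (Suc j)) * (C * C * R ^ (i + j))" by simp
    \<comment> \<open>The number of summands is absorbed by doubling the base of the geometric
      bound.\<close>
    also have "\<dots> \<le> (2 ^ i * 2 ^ j) * (C * C * R ^ (i + j))"
      using * by (intro mult_right_mono mult_mono Suc_le_power_two) auto
    also have "\<dots> = (C * C) * (2 * R) ^ i * (2 * R) ^ j"
      by (simp add: power_mult_distrib power_add mult_ac)
    finally show "norm ((F * G) $ i $ j) \<le> (C * C) * (2 * R) ^ i * (2 * R) ^ j" .
  qed (use * in auto)
qed

lemma conv1_add: "conv1 f \<Longrightarrow> conv1 g \<Longrightarrow> conv1 (f + g)"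
  and conv1_diff: "conv1 f \<Longrightarrow> conv1 g \<Longrightarrow> conv1 (f - g)"
  and conv1_uminus: "conv1 f \<Longrightarrow> conv1 (- f)"
  and conv1_mult: "conv1 f \<Longrightarrow> conv1 g \<Longrightarrow> conv1 (f * g)"
  unfolding conv2_lift_iff[symmetric] fps_lift_hom
  by (rule conv2_add conv2_diff conv2_uminus conv2_mult; assumption)+

text \<open>A bound c T^k reproduces itself in a linear recursion with geometric kernel. Since T - R
  = R c, the convolution of the powers of T with those of R is (T^i - R^i) / c, hence at most T^i /
  c. The two terms of the recursion then contribute at most K A T^i each, which dictates c = 2 K
  A.\<close>

lemma geometric_growth_step:
  fixes K A R :: real
  assumes pos: "K > 0" "A > 0" "R > 0"
  defines "c \<equiv> 2 * K * A"
  defines "T \<equiv> R * (1 + c)"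
  shows "K * (A * R ^ i + (\<Sum>k<i. (c * T ^ k) * (A * R ^ (i - k)))) \<le> c * T ^ i"
proof -
  have c: "c > 0" using pos by (simp add: c_def)
  have TR: "T - R = R * c" by (simp add: T_def algebra_simps)
  have geo: "(\<Sum>k<i. T ^ k * R ^ (i - k)) * c \<le> T ^ i"
  proof -
    have eq: "(\<Sum>k<i. T ^ k * R ^ (i - k)) = R * (\<Sum>k<i. T ^ k * R ^ (i - Suc k))"
      unfolding sum_distrib_left
    proof (rule sum.cong)
      fix k assume "k \<in> {..<i}"
      then have "i - k = Suc (i - Suc k)" by auto
      then show "T ^ k * R ^ (i - k) = R * (T ^ k * R ^ (i - Suc k))" by simp
    qed simp
    have "T ^ i - R ^ i = (T - R) * (\<Sum>k<i. R ^ (i - Suc k) * T ^ k)"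
      by (rule power_diff_sumr2)
    also have "\<dots> = (\<Sum>k<i. T ^ k * R ^ (i - k)) * c"
      unfolding eq TR by (simp add: mult_ac)
    finally have "(\<Sum>k<i. T ^ k * R ^ (i - k)) * c = T ^ i - R ^ i" by simp
    moreover have "R ^ i \<ge> 0" using pos by simp
    ultimately show ?thesis by linarith
  qed
  have "(\<Sum>k<i. (c * T ^ k) * (A * R ^ (i - k))) = A * ((\<Sum>k<i. T ^ k * R ^ (i - k)) * c)"
    by (simp add: sum_distrib_left sum_distrib_right mult_ac)
  also have "K * (A * R ^ i + A * ((\<Sum>k<i. T ^ k * R ^ (i - k)) * c)) \<le> K * (A * T ^ i + A * T ^ i)"
  proof -
    have "1 * R \<le> T" unfolding T_def using pos c by (simp add: mult_ac)
    then have "R ^ i \<le> T ^ i" using pos by (intro power_mono) auto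
    with geo pos show ?thesis by (intro mult_left_mono add_mono) auto
  qed
  also have "\<dots> = c * T ^ i" by (simp add: c_def)
  finally show ?thesis .
qed

lemma geometric_growth:
  fixes u :: "nat \<Rightarrow> real"
  assumes rec: "\<And>i. u i \<le> K * (A * R ^ i + (\<Sum>k<i. u k * (A * R ^ (i - k))))"
    and pos: "K > 0" "A > 0" "R > 0"
  shows "u i \<le> 2 * K * A * (R * (1 + 2 * K * A)) ^ i"
proof (induction i rule: less_induct)
  case (less i)
  have "u i \<le> K * (A * R ^ i + (\<Sum>k<i. u k * (A * R ^ (i - k))))" by (rule rec)
  also have "\<dots> \<le> K * (A * R ^ i + (\<Sum>k<i. (2 * K * A * (R * (1 + 2 * K * A)) ^ k) * (A * R ^ (i - k))))"
    using less pos by (intro mult_left_mono add_left_mono sum_mono mult_right_mono) auto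
  also have "\<dots> \<le> 2 * K * A * (R * (1 + 2 * K * A)) ^ i"
    by (rule geometric_growth_step[OF pos])
  finally show ?case .
qed

lemma conv1_inverse:
  assumes "conv1 f" "f $ 0 \<noteq> 0"
  shows "conv1 (inverse f)"
proof -
  obtain C R where *: "C > 0" "R \<ge> 1" "\<And>i. norm (f $ i) \<le> C * R ^ i"
    using assms unfolding conv1_def by auto
  define K where "K = inverse (norm (f $ 0))"
  have K: "K > 0" using assms by (simp add: K_def)
  \<comment> \<open>At least 1, so that A R^i also dominates the coefficients of the series 1, the
    inhomogeneous term of the recursion for the inverse.\<close>
  define A where "A = max C 1"
  have "norm (inverse f $ i) \<le> K * (A * R ^ i + (\<Sum>k<i. norm (inverse f $ k) * (A * R ^ (i - k))))" for i
  proof -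
    have "(\<Sum>k=0..i. inverse f $ k * f $ (i - k)) = (if i = 0 then 1 else 0)"
      using inverse_mult_eq_1[OF assms(2)] by (simp add: fps_eq_iff fps_mult_nth)
    moreover have "{0..i} = insert i {..<i}" by auto
    ultimately have "inverse f $ i * f $ 0 = (if i = 0 then 1 else 0) - (\<Sum>k<i. inverse f $ k * f $ (i - k))"
      by (simp add: algebra_simps)
    then have "inverse f $ i = inverse (f $ 0) * ((if i = 0 then 1 else 0) - (\<Sum>k<i. inverse f $ k * f $ (i - k)))"
      using assms(2) by (simp add: field_simps)
    then have "norm (inverse f $ i) = K * norm ((if i = 0 then 1 else 0) - (\<Sum>k<i. inverse f $ k * f $ (i - k)))"
      by (simp add: norm_mult norm_inverse K_def)
    also have "\<dots> \<le> K * (A * R ^ i + (\<Sum>k<i. norm (inverse f $ k) * (A * R ^ (i - k))))"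
    proof (intro mult_left_mono order.trans[OF norm_triangle_ineq4] add_mono order.trans[OF norm_sum] sum_mono)
      show "norm (if i = 0 then 1 else 0 :: complex) \<le> A * R ^ i" using * by (auto simp: A_def)
    next
      fix k assume "k \<in> {..<i}"
      have "C * R ^ (i - k) \<le> A * R ^ (i - k)" using * by (intro mult_right_mono) (auto simp: A_def)
      then show "norm (inverse f $ k * f $ (i - k)) \<le> norm (inverse f $ k) * (A * R ^ (i - k))"
        unfolding norm_mult using *(3)[of "i - k"] by (intro mult_left_mono) auto
    qed (use K in auto)
    finally show ?thesis .
  qed
  from geometric_growth[OF this K] * show ?thesis
    by (intro conv1I[of _ "2 * K * A" "R * (1 + 2 * K * A)"]) (auto simp: A_def K intro!: mult_nonneg_nonneg add_nonneg_nonneg less_imp_le[OF K])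
qed

section \<open>Weierstrass division\<close>

text \<open>\<open>M\<close> bounds the norm of \<open>a\<close> in the Banach algebra of series
  absolutely convergent on the closed disc of radius \<open>s\<close>. Unlike coefficientwise
  estimates, this norm is submultiplicative without loss, so products can be taken inside a
  recursion without shrinking the disc at every step.\<close>

definition bounded_sums :: "real \<Rightarrow> complex fps \<Rightarrow> real \<Rightarrow> bool" where
  "bounded_sums s a M \<longleftrightarrow> (\<forall>n. (\<Sum>k<n. norm (a $ k) * s ^ k) \<le> M)"

lemma bounded_sums_nonneg: "bounded_sums s a M \<Longrightarrow> 0 \<le> M"
  unfolding bounded_sums_def by (metis lessThan_0 sum.empty)

lemma bounded_sums_mono: "bounded_sums s a M \<Longrightarrow> M \<le> M' \<Longrightarrow> bounded_sums s a M'"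
  unfolding bounded_sums_def by (meson order.trans)

lemma bounded_sums_nth:
  assumes "bounded_sums s a M" "s > 0"
  shows "norm (a $ k) \<le> M * (1 / s) ^ k"
proof -
  have "norm (a $ k) * s ^ k \<le> (\<Sum>i<Suc k. norm (a $ i) * s ^ i)"
    using assms(2) by (intro member_le_sum) auto
  also have "\<dots> \<le> M" using assms(1) unfolding bounded_sums_def by blast
  finally show ?thesis using assms(2) by (simp add: field_simps)
qed

lemma bounded_sums_0: "bounded_sums s 0 0"
  by (simp add: bounded_sums_def)

lemma bounded_sums_diff:
  assumes "bounded_sums s a M" "bounded_sums s b M'" "s > 0"
  shows "bounded_sums s (a - b) (M + M')"
  unfolding bounded_sums_def
proof
  fix n
  have "(\<Sum>k<n. norm ((a - b) $ k) * s ^ k) \<le> (\<Sum>k<n. norm (a $ k) * s ^ k + norm (b $ k) * s ^ k)"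
    using assms(3) by (intro sum_mono) (simp add: norm_triangle_ineq4 flip: distrib_right)
  also have "\<dots> \<le> M + M'"
    using assms(1,2) unfolding bounded_sums_def sum.distrib by (intro add_mono) auto
  finally show "(\<Sum>k<n. norm ((a - b) $ k) * s ^ k) \<le> M + M'" .
qed

lemma bounded_sums_add:
  assumes "bounded_sums s a M" "bounded_sums s b M'" "s > 0"
  shows "bounded_sums s (a + b) (M + M')"
proof -
  have "bounded_sums s (- b) M'" using assms(2) by (simp add: bounded_sums_def)
  from bounded_sums_diff[OF assms(1) this assms(3)] show ?thesis by simp
qed

lemma bounded_sums_sum:
  assumes "\<And>k. k < (n::nat) \<Longrightarrow> bounded_sums s (a k) (M k)" "s > 0"
  shows "bounded_sums s (\<Sum>k<n. a k) (\<Sum>k<n. M k)"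
  using assms(1)
proof (induction n)
  case 0
  then show ?case by (simp add: bounded_sums_0)
next
  case (Suc n)
  then show ?case using bounded_sums_add[OF Suc.IH Suc.prems[of n] assms(2)] by simp
qed

lemma bounded_sums_mult:
  assumes "bounded_sums s a M" "bounded_sums s b M'" "s > 0"
  shows "bounded_sums s (a * b) (M * M')"
  unfolding bounded_sums_def
proof
  fix n
  have "(\<Sum>k<n. norm ((a * b) $ k) * s ^ k)
      \<le> (\<Sum>k<n. \<Sum>i=0..k. (norm (a $ i) * s ^ i) * (norm (b $ (k - i)) * s ^ (k - i)))"
  proof (rule sum_mono)
    fix k
    have "norm ((a * b) $ k) * s ^ k \<le> (\<Sum>i=0..k. norm (a $ i * b $ (k - i))) * s ^ k"
      unfolding fps_mult_nth using assms(3) by (intro mult_right_mono norm_sum) auto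
    also have "\<dots> = (\<Sum>i=0..k. (norm (a $ i) * s ^ i) * (norm (b $ (k - i)) * s ^ (k - i)))"
      unfolding sum_distrib_right
    proof (rule sum.cong)
      fix i assume "i \<in> {0..k}"
      then have "s ^ k = s ^ i * s ^ (k - i)" by (simp flip: power_add)
      then show "norm (a $ i * b $ (k - i)) * s ^ k = (norm (a $ i) * s ^ i) * (norm (b $ (k - i)) * s ^ (k - i))"
        by (simp add: norm_mult)
    qed simp
    finally show "norm ((a * b) $ k) * s ^ k \<le> (\<Sum>i=0..k. (norm (a $ i) * s ^ i) * (norm (b $ (k - i)) * s ^ (k - i)))" .
  qed
  also have "\<dots> = (\<Sum>(k,i)\<in>(SIGMA k:{..<n}. {0..k}). (norm (a $ i) * s ^ i) * (norm (b $ (k - i)) * s ^ (k - i)))"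
    by (subst sum.Sigma) auto
  also have "\<dots> = (\<Sum>(i,j)\<in>{(i,j). i + j < n}. (norm (a $ i) * s ^ i) * (norm (b $ j) * s ^ j))"
    by (rule sum.reindex_bij_witness[of _ "\<lambda>(i,j). (i + j, i)" "\<lambda>(k,i). (i, k - i)"]) auto
  \<comment> \<open>The triangle is enlarged to the full square, over which the sum factors.\<close>
  also have "\<dots> \<le> (\<Sum>(i,j)\<in>{..<n} \<times> {..<n}. (norm (a $ i) * s ^ i) * (norm (b $ j) * s ^ j))"
    using assms(3) by (intro sum_mono2) auto
  also have "\<dots> = (\<Sum>i<n. norm (a $ i) * s ^ i) * (\<Sum>j<n. norm (b $ j) * s ^ j)"
    by (simp add: sum_product sum.cartesian_product)
  also have "\<dots> \<le> M * M'"
    using assms bounded_sums_nonneg[OF assms(1)] unfolding bounded_sums_def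
    by (intro mult_mono) (auto intro!: sum_nonneg)
  finally show "(\<Sum>k<n. norm ((a * b) $ k) * s ^ k) \<le> M * M'" .
qed

lemma bounded_sums_shift:
  assumes "bounded_sums s a M" "s > 0"
  shows "bounded_sums s (fps_shift n a) (M / s ^ n)"
  unfolding bounded_sums_def
proof
  fix m
  have "(\<Sum>k<m. norm (fps_shift n a $ k) * s ^ k) * s ^ n = (\<Sum>k<m. norm (a $ (k + n)) * s ^ (k + n))"
    unfolding sum_distrib_right by (simp add: power_add mult_ac)
  also have "\<dots> = (\<Sum>k\<in>{n..<m + n}. norm (a $ k) * s ^ k)"
    by (rule sum.reindex_bij_witness[of _ "\<lambda>k. k - n" "\<lambda>k. k + n"]) auto
  also have "\<dots> \<le> (\<Sum>k<m + n. norm (a $ k) * s ^ k)"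
    using assms(2) by (intro sum_mono2) auto
  also have "\<dots> \<le> M" using assms(1) unfolding bounded_sums_def by blast
  finally show "(\<Sum>k<m. norm (fps_shift n a $ k) * s ^ k) \<le> M / s ^ n"
    using assms(2) by (simp add: field_simps)
qed

lemma sum_half_powers: "(\<Sum>k<n. (1 / 2 :: real) ^ k) \<le> 2"
proof -
  have "(\<Sum>k<n. (1 / 2 :: real) ^ k) = 2 - 2 * (1 / 2) ^ n"
    by (induction n) (auto simp: field_simps)
  then show ?thesis by simp
qed

lemma bounded_sums_geometric:
  assumes "\<And>j. norm (a $ j) \<le> C * R ^ j" "R > 0" "0 < s" "s \<le> 1 / (2 * R)" "C \<ge> 0"
  shows "bounded_sums s a (2 * C)"
  unfolding bounded_sums_def
proof
  fix n
  have "norm (a $ k) * s ^ k \<le> C * (1 / 2) ^ k" for k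
  proof -
    have "norm (a $ k) * s ^ k \<le> (C * R ^ k) * (1 / (2 * R)) ^ k"
      using assms by (intro mult_mono power_mono) auto
    also have "\<dots> = C * (1 / 2) ^ k" using assms(2) by (simp add: power_divide power_mult_distrib)
    finally show ?thesis .
  qed
  then have "(\<Sum>k<n. norm (a $ k) * s ^ k) \<le> C * (\<Sum>k<n. (1 / 2) ^ k)"
    unfolding sum_distrib_left by (intro sum_mono)
  also have "\<dots> \<le> C * 2" using assms(5) by (intro mult_left_mono sum_half_powers)
  finally show "(\<Sum>k<n. norm (a $ k) * s ^ k) \<le> 2 * C" by simp
qed

lemma conv2_bounded_sums:
  assumes "\<And>i. bounded_sums s (F $ i) (C * R ^ i)" "s > 0" "R \<ge> 0"
  shows "conv2 F"
  using bounded_sums_nth[OF assms(1,2)] assms(2,3)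
  by (intro conv2I[where C = C and R = R and S = "1 / s"]) auto

text \<open>The coefficient of x^i in the Weierstrass quotient of \<open>G\<close> by
  \<open>F\<close>. The argument \<open>e\<close> is meant to be the inverse of the unit part of
  \<open>F $ 0\<close>, and \<open>n\<close> its order in y: once the contributions of smaller k are
  subtracted, \<open>q $ i\<close> must cancel everything from y^n upwards.\<close>

fun division_quotient :: "nat \<Rightarrow> complex fps \<Rightarrow> complex fps fps \<Rightarrow> complex fps fps \<Rightarrow> nat \<Rightarrow> complex fps" where
  "division_quotient n e F G i =
     e * fps_shift n (G $ i - (\<Sum>k<i. division_quotient n e F G k * F $ (i - k)))"

declare division_quotient.simps [simp del]

lemma conv2_division_quotient:
  assumes "conv2 F" "conv2 G" "conv1 e"
  shows "conv2 (Abs_fps (division_quotient n e F G))"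
proof -
  obtain C R where *: "C > 0" "R \<ge> 1" "\<And>i j. norm (F $ i $ j) \<le> C * R ^ (i + j)"
    "\<And>i j. norm (G $ i $ j) \<le> C * R ^ (i + j)"
    using conv2_common[OF assms(1,2)] by metis
  obtain C' R' where e: "C' > 0" "R' \<ge> 1" "\<And>i. norm (e $ i) \<le> C' * R' ^ i"
    using assms(3) unfolding conv1_def by auto
  define s where "s = min (1 / (2 * R)) (1 / (2 * R'))"
  have s: "s > 0" "s \<le> 1 / (2 * R)" "s \<le> 1 / (2 * R')" using * e by (auto simp: s_def)
  define A where "A = 2 * C"
  have FG: "bounded_sums s (H $ i) (A * R ^ i)" if "\<And>i j. norm (H $ i $ j) \<le> C * R ^ (i + j)" for H i
  proof -
    have "bounded_sums s (H $ i) (2 * (C * R ^ i))"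
    proof (rule bounded_sums_geometric)
      show "norm (H $ i $ j) \<le> C * R ^ i * R ^ j" for j using that[of i j] by (simp add: power_add mult_ac)
    qed (use * s in auto)
    then show ?thesis by (simp add: A_def mult_ac)
  qed
  note F = FG[OF *(3)] and G = FG[OF *(4)]
  have E: "bounded_sums s e (2 * C')"
    using bounded_sums_geometric[of e C' R' s] e s by simp
  \<comment> \<open>Bounds the operator that shifts by \<open>n\<close> and multiplies by
    \<open>e\<close>. It is the same for all \<open>i\<close>, so the norms of the quotient
    coefficients obey the recursion of \<open>geometric_growth_step\<close>.\<close>
  define K where "K = 2 * C' / s ^ n"
  have K: "K > 0" using e s by (simp add: K_def)
  define T where "T = R * (1 + 2 * K * A)"
  have "bounded_sums s (division_quotient n e F G i) (2 * K * A * T ^ i)" for i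
  proof (induction i rule: less_induct)
    case (less i)
    have "bounded_sums s (division_quotient n e F G i)
        (2 * C' * ((A * R ^ i + (\<Sum>k<i. 2 * K * A * T ^ k * (A * R ^ (i - k)))) / s ^ n))"
      unfolding division_quotient.simps[of n e F G i]
      using less s(1)
      by (intro bounded_sums_mult[OF E] bounded_sums_shift bounded_sums_diff[OF G] bounded_sums_sum
          bounded_sums_mult[OF _ F]) auto
    also have "2 * C' * ((A * R ^ i + (\<Sum>k<i. 2 * K * A * T ^ k * (A * R ^ (i - k)))) / s ^ n)
      = K * (A * R ^ i + (\<Sum>k<i. 2 * K * A * T ^ k * (A * R ^ (i - k))))"
      by (simp add: K_def)
    finally have 1: "bounded_sums s (division_quotient n e F G i) \<dots>" .
    have "K * (A * R ^ i + (\<Sum>k<i. 2 * K * A * T ^ k * (A * R ^ (i - k)))) \<le> 2 * K * A * T ^ i"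
      unfolding T_def using K * by (intro geometric_growth_step) (auto simp: A_def)
    with 1 show ?case by (rule bounded_sums_mono)
  qed
  then show ?thesis
    using conv2_bounded_sums[of s "Abs_fps (division_quotient n e F G)" "2 * K * A" T] s(1) * K
    by (auto simp: T_def A_def)
qed

text \<open>With F_0 = e y^n and e a unit, the coefficient of x^i in the remainder is h - q_i F_0,
  where h collects what is already known. Taking q_i as 1/e times the shift of h by n removes the
  part of h from y^n upwards and leaves the part below untouched.\<close>

lemma conv2_division:
  assumes "conv2 F" "conv2 G" "F $ 0 \<noteq> 0"
  shows "\<exists>Q. conv2 Q \<and> (\<forall>i j. j \<ge> subdegree (F $ 0) \<longrightarrow> (G - Q * F) $ i $ j = 0)"
proof -
  define n where "n = subdegree (F $ 0)"
  define e where "e = fps_shift n (F $ 0)"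
  define Q where "Q = Abs_fps (division_quotient n (inverse e) F G)"
  have e0: "e $ 0 \<noteq> 0" using assms(3) by (simp add: e_def n_def)
  have F0: "F $ 0 = e * fps_X ^ n"
    unfolding e_def n_def by (simp add: subdegree_decompose[symmetric])
  obtain C R where CR: "C > 0" "R \<ge> 1" "\<And>i j. norm (F $ i $ j) \<le> C * R ^ (i + j)"
    using assms(1) unfolding conv2_def by auto
  have "conv1 e"
  proof (rule conv1I)
    show "norm (e $ j) \<le> (C * R ^ n) * R ^ j" for j
      using CR(3)[of 0 "j + n"] by (simp add: e_def power_add mult_ac)
  qed (use CR in auto)
  then have "conv1 (inverse e)" using e0 by (rule conv1_inverse)
  then have "conv2 Q" unfolding Q_def by (rule conv2_division_quotient[OF assms(1,2)])
  moreover have "(G - Q * F) $ i $ j = 0" if "j \<ge> n" for i j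
  proof -
    define h where "h = G $ i - (\<Sum>k<i. Q $ k * F $ (i - k))"
    have "{0..i} = insert i {..<i}" by auto
    then have "(Q * F) $ i = Q $ i * F $ 0 + (\<Sum>k<i. Q $ k * F $ (i - k))"
      unfolding fps_mult_nth by simp
    then have "(G - Q * F) $ i = h - Q $ i * F $ 0"
      by (simp add: h_def)
    also have "Q $ i = inverse e * fps_shift n h"
      unfolding Q_def h_def by (simp add: division_quotient.simps[of n _ F G i])
    also have "inverse e * fps_shift n h * F $ 0 = (inverse e * e) * (fps_shift n h * fps_X ^ n)"
      unfolding F0 by (simp add: mult_ac)
    also have "inverse e * e = 1" using e0 by (rule inverse_mult_eq_1)
    also have "h - 1 * (fps_shift n h * fps_X ^ n) = fps_cutoff n h"
      using fps_shift_cutoff[of n h] by (simp add: algebra_simps)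
    finally show ?thesis using that by simp
  qed
  ultimately show ?thesis unfolding n_def by blast
qed

text \<open>The rings \<open>\<complex>{x}\<close> and \<open>\<complex>{x, y}\<close>. In the second one \<open>x\<close> is the outer variable: the
  coefficient of \<open>x\<^sup>i y\<^sup>j\<close> is \<open>F $ i $ j\<close>.\<close>

typedef cser = "{f :: complex fps. conv1 f}"
  by (rule exI[of _ 0]) (simp add: conv1_0)

typedef cser2 = "{F :: complex fps fps. conv2 F}"
  by (rule exI[of _ 0]) (simp add: conv2_0)

setup_lifting type_definition_cser
setup_lifting type_definition_cser2

instantiation cser :: idom
begin
lift_definition zero_cser :: cser is 0 by (rule conv1_0)
lift_definition one_cser :: cser is 1 by (rule conv1_1)
lift_definition plus_cser :: "cser \<Rightarrow> cser \<Rightarrow> cser" is "(+)" by (rule conv1_add)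
lift_definition minus_cser :: "cser \<Rightarrow> cser \<Rightarrow> cser" is "(-)" by (rule conv1_diff)
lift_definition uminus_cser :: "cser \<Rightarrow> cser" is uminus by (rule conv1_uminus)
lift_definition times_cser :: "cser \<Rightarrow> cser \<Rightarrow> cser" is "(*)" by (rule conv1_mult)
instance by (intro_classes; transfer; simp add: algebra_simps)
end

instantiation cser2 :: idom
begin
lift_definition zero_cser2 :: cser2 is 0 by (rule conv2_0)
lift_definition one_cser2 :: cser2 is 1 by (rule conv2_1)
lift_definition plus_cser2 :: "cser2 \<Rightarrow> cser2 \<Rightarrow> cser2" is "(+)" by (rule conv2_add)
lift_definition minus_cser2 :: "cser2 \<Rightarrow> cser2 \<Rightarrow> cser2" is "(-)" by (rule conv2_diff)
lift_definition uminus_cser2 :: "cser2 \<Rightarrow> cser2" is uminus by (rule conv2_uminus)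
lift_definition times_cser2 :: "cser2 \<Rightarrow> cser2 \<Rightarrow> cser2" is "(*)" by (rule conv2_mult)
instance by (intro_classes; transfer; simp add: algebra_simps)
end

lift_definition nth1 :: "cser \<Rightarrow> nat \<Rightarrow> complex" is "\<lambda>f i. f $ i" .
lift_definition nth2 :: "cser2 \<Rightarrow> nat \<Rightarrow> nat \<Rightarrow> complex" is "\<lambda>F i j. F $ i $ j" .

lemma cser_eqI: "(\<And>i. nth1 f i = nth1 g i) \<Longrightarrow> f = g"
  by transfer (simp add: fps_eq_iff)

lemma cser2_eqI: "(\<And>i j. nth2 f i j = nth2 g i j) \<Longrightarrow> f = g"
  by transfer (simp add: fps_eq_iff)

lemma nth1_simps [simp]:
  "nth1 0 i = 0" "nth1 1 i = (if i = 0 then 1 else 0)" "nth1 (f + g) i = nth1 f i + nth1 g i"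
  "nth1 (f - g) i = nth1 f i - nth1 g i" "nth1 (- f) i = - nth1 f i"
  by (transfer; simp)+

lemma nth2_simps [simp]:
  "nth2 0 i j = 0" "nth2 1 i j = (if i = 0 \<and> j = 0 then 1 else 0)"
  "nth2 (f + g) i j = nth2 f i j + nth2 g i j"
  "nth2 (f - g) i j = nth2 f i j - nth2 g i j" "nth2 (- f) i j = - nth2 f i j"
  by (transfer; simp)+

lemma nth1_mult: "nth1 (f * g) n = (\<Sum>i=0..n. nth1 f i * nth1 g (n - i))"
  by transfer (simp add: fps_mult_nth)

lemma nth2_mult:
  "nth2 (F * G) i j = (\<Sum>a=0..i. \<Sum>b=0..j. nth2 F a b * nth2 G (i - a) (j - b))"
  by transfer (simp add: fps2_mult_nth)

lemma nth1_mult_0 [simp]: "nth1 (f * g) 0 = nth1 f 0 * nth1 g 0"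
  by (simp add: nth1_mult)

lemma nth2_mult_0_0 [simp]: "nth2 (f * g) 0 0 = nth2 f 0 0 * nth2 g 0 0"
  by (simp add: nth2_mult)

lemma nth1_sum: "nth1 (sum f A) i = (\<Sum>a\<in>A. nth1 (f a) i)"
  by (induction A rule: infinite_finite_induct) auto

lemma nth2_sum: "nth2 (sum f A) i j = (\<Sum>a\<in>A. nth2 (f a) i j)"
  by (induction A rule: infinite_finite_induct) auto

lemma nth1_power_0 [simp]: "nth1 (f ^ n) 0 = nth1 f 0 ^ n"
  by (induction n) auto

lift_definition const1 :: "complex \<Rightarrow> cser" is fps_const by (rule conv1_const)
lift_definition var1 :: cser is fps_X by (rule conv1_X)
lift_definition emb :: "cser \<Rightarrow> cser2" is fps_lift by (simp add: conv2_lift_iff)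
lift_definition varY :: cser2 is "fps_const fps_X" by (rule conv2_const[OF conv1_X])
lift_definition column :: "cser2 \<Rightarrow> nat \<Rightarrow> cser" is "\<lambda>F j. Abs_fps (\<lambda>i. F $ i $ j)"
proof -
  fix F :: "complex fps fps" and j
  assume "conv2 F"
  then obtain C R where "C > 0" "R \<ge> 1" "\<And>i j. norm (F $ i $ j) \<le> C * R ^ (i + j)"
    unfolding conv2_def by auto
  then show "conv1 (Abs_fps (\<lambda>i. F $ i $ j))"
    by (intro conv1I[of _ "C * R ^ j" R]) (auto simp: power_add mult_ac)
qed

lemma nth1_const1 [simp]: "nth1 (const1 c) i = (if i = 0 then c else 0)"
  by transfer simp

lemma nth1_var1 [simp]: "nth1 var1 i = (if i = 1 then 1 else 0)"
  by transfer (simp add: fps_X_def)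

lemma nth2_emb [simp]: "nth2 (emb f) i j = (if j = 0 then nth1 f i else 0)"
  by transfer simp

lemma nth1_column [simp]: "nth1 (column F j) i = nth2 F i j"
  by transfer simp

lemma nth1_var1_power [simp]: "nth1 (var1 ^ k) i = (if i = k then 1 else 0)"
proof -
  have *: "Rep_cser (var1 ^ k) = fps_X ^ k"
    by (induction k) (simp_all add: one_cser.rep_eq times_cser.rep_eq var1.rep_eq)
  show ?thesis unfolding nth1.rep_eq * by (simp add: fps_X_power_nth)
qed

lemma nth1_var1_power_mult [simp]: "nth1 (var1 ^ k * f) i = (if i < k then 0 else nth1 f (i - k))"
proof -
  have *: "Rep_cser (var1 ^ k * f) = fps_X ^ k * Rep_cser f"
    by (induction k) (simp_all add: one_cser.rep_eq times_cser.rep_eq var1.rep_eq mult.assoc)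
  show ?thesis unfolding nth1.rep_eq * by (simp add: fps_X_power_mult_nth)
qed

lemma nth1_const1_mult [simp]: "nth1 (const1 c * f) i = c * nth1 f i"
  by transfer simp

lemma const1_hom [simp]:
  "const1 0 = 0" "const1 1 = 1" "const1 (a + b) = const1 a + const1 b"
  "const1 (a * b) = const1 a * const1 b" "const1 (- a) = - const1 a"
  by (rule cser_eqI; simp)+

lemma emb_hom [simp]:
  "emb 0 = 0" "emb 1 = 1" "emb (f + g) = emb f + emb g" "emb (f - g) = emb f - emb g"
  "emb (- f) = - emb f"
  by (rule cser2_eqI; simp)+

lemma emb_mult [simp]: "emb (f * g) = emb f * emb g"
  by transfer (rule fps_lift_hom)

lemma emb_power [simp]: "emb (f ^ n) = emb f ^ n"
  by (induction n) auto

lemma emb_inject [simp]: "emb f = emb g \<longleftrightarrow> f = g"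
proof
  assume "emb f = emb g"
  then have "nth2 (emb f) i 0 = nth2 (emb g) i 0" for i by simp
  then show "f = g" by (intro cser_eqI) simp
qed simp

lemma emb_eq_0_iff [simp]: "emb f = 0 \<longleftrightarrow> f = 0"
  using emb_inject[of f 0] by simp

lemma nth2_varY_power_mult [simp]: "nth2 (varY ^ k * F) i j = (if j < k then 0 else nth2 F i (j - k))"
proof -
  have "Rep_cser2 (varY ^ k * F) = fps_const (fps_X ^ k) * Rep_cser2 F"
    by (induction k) (simp_all add: one_cser2.rep_eq times_cser2.rep_eq varY.rep_eq mult.assoc[symmetric]
        flip: fps_const_power fps_const_mult)
  then show ?thesis unfolding nth2.rep_eq by (simp add: fps_X_power_mult_nth)
qed

lemma nth2_varY_power [simp]: "nth2 (varY ^ k) i j = (if i = 0 \<and> j = k then 1 else 0)"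
  using nth2_varY_power_mult[of k 1 i j] by (auto simp del: nth2_varY_power_mult)

lemma nth2_varY [simp]: "nth2 varY i j = (if i = 0 \<and> j = 1 then 1 else 0)"
  using nth2_varY_power[of 1 i j] by (simp del: nth2_varY_power)

lemma nth2_emb_varY_power: "nth2 (emb c * varY ^ k) i j = (if j = k then nth1 c i else 0)"
  by (subst mult.commute) simp

lemma nth2_emb_var1_power_mult [simp]:
  "nth2 (emb var1 ^ k * F) i j = (if i < k then 0 else nth2 F (i - k) j)"
proof -
  have "Rep_cser2 (emb var1 ^ k * F) = fps_X ^ k * Rep_cser2 F"
  proof -
    have "fps_lift fps_X = fps_X" by (simp add: fps_eq_iff fps_X_def)
    then show ?thesis
      by (induction k) (simp_all add: one_cser2.rep_eq times_cser2.rep_eq emb.rep_eq var1.rep_eq mult.assoc)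
  qed
  then show ?thesis unfolding nth2.rep_eq by (simp add: fps_X_power_mult_nth)
qed

lemma polynomial_in_varY:
  assumes "\<And>i j. j \<ge> n \<Longrightarrow> nth2 r i j = 0"
  shows "r = (\<Sum>j<n. emb (column r j) * varY ^ j)"
proof (rule cser2_eqI)
  fix i j
  have "nth2 (\<Sum>j<n. emb (column r j) * varY ^ j) i j = (\<Sum>k<n. if j = k then nth2 r i k else 0)"
    unfolding nth2_sum by (simp add: nth2_emb_varY_power)
  then show "nth2 r i j = nth2 (\<Sum>j<n. emb (column r j) * varY ^ j) i j"
    using assms[of j i] by (auto simp: not_less)
qed

lemma weierstrass_division:
  assumes "nth2 F 0 n \<noteq> 0" "\<And>j. j < n \<Longrightarrow> nth2 F 0 j = 0"
  shows "\<exists>q. \<forall>i j. j \<ge> n \<longrightarrow> nth2 (G - q * F) i j = 0"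
proof -
  have "subdegree (Rep_cser2 F $ 0) = n"
    using assms by (intro subdegreeI) (auto simp: nth2.rep_eq)
  moreover have "Rep_cser2 F $ 0 \<noteq> 0" using assms(1) by (auto simp: nth2.rep_eq)
  ultimately obtain Q where Q: "conv2 Q" "\<And>i j. j \<ge> n \<Longrightarrow> (Rep_cser2 G - Q * Rep_cser2 F) $ i $ j = 0"
    using conv2_division[of "Rep_cser2 F" "Rep_cser2 G"] Rep_cser2[of F] Rep_cser2[of G] by auto
  have "nth2 (G - Abs_cser2 Q * F) i j = 0" if "j \<ge> n" for i j
    using Q that by (simp add: nth2.rep_eq minus_cser2.rep_eq times_cser2.rep_eq Abs_cser2_inverse)
  then show ?thesis by blast
qed

text \<open>If x^k is the lowest power of x occurring in \<open>q\<close>, then x^k has in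
  \<open>q * F\<close> the coefficient q_k F_0, a nonzero series in y of order at least
  \<open>n\<close>. Its leading term contradicts the degree bound.\<close>

lemma weierstrass_division_unique:
  assumes "nth2 F 0 n \<noteq> 0" "\<And>j. j < n \<Longrightarrow> nth2 F 0 j = 0"
    and q: "\<And>i j. j \<ge> n \<Longrightarrow> nth2 (q * F) i j = 0"
  shows "q = 0"
proof (rule ccontr)
  assume "q \<noteq> 0"
  define P where "P = Rep_cser2 q"
  have "P \<noteq> 0" using \<open>q \<noteq> 0\<close> by (metis P_def Rep_cser2_inject zero_cser2.rep_eq)
  define k where "k = subdegree P"
  define a where "a = P $ k"
  define b where "b = Rep_cser2 F $ 0"
  have a: "a \<noteq> 0" unfolding a_def k_def using \<open>P \<noteq> 0\<close> by simp
  have b: "b \<noteq> 0" "subdegree b = n"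
    using assms by (auto simp: b_def nth2.rep_eq intro!: subdegreeI)
  have "(P * Rep_cser2 F) $ k = (\<Sum>i=0..k. P $ i * Rep_cser2 F $ (k - i))" by (rule fps_mult_nth)
  also have "\<dots> = (\<Sum>i=0..k. if i = k then P $ k * Rep_cser2 F $ 0 else 0)"
    by (intro sum.cong) (auto simp: k_def intro: nth_less_subdegree_zero)
  also have "\<dots> = a * b" by (simp add: a_def b_def)
  finally have ab: "(P * Rep_cser2 F) $ k = a * b" .
  have "(a * b) $ subdegree (a * b) \<noteq> 0" using a b(1) by (simp del: subdegree_mult)
  moreover have "subdegree (a * b) \<ge> n" using a b by simp
  ultimately show False
    using q[of "subdegree (a * b)" k] ab by (simp add: nth2.rep_eq times_cser2.rep_eq P_def)
qed

section \<open>The substitutions x = t^N and x = z t\<close>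

lift_definition expand1 :: "nat \<Rightarrow> cser \<Rightarrow> cser" is "\<lambda>N f. f oo fps_X ^ N"
proof -
  fix N and f :: "complex fps"
  assume "conv1 f"
  then obtain C R where *: "C > 0" "R \<ge> 1" "\<And>i. norm (f $ i) \<le> C * R ^ i"
    unfolding conv1_def by auto
  show "conv1 (f oo fps_X ^ N)"
  proof (rule conv1I)
    fix i
    have "C * R ^ (i div N) \<le> C * R ^ i" using * by (intro mult_left_mono power_increasing) auto
    with *(3)[of "i div N"] have "norm (f $ (i div N)) \<le> C * R ^ i" by (rule order.trans)
    then show "norm ((f oo fps_X ^ N) $ i) \<le> C * R ^ i"
      using *(1,2) unfolding fps_nth_compose_X_power by auto
  qed (use * in auto)
qed

lift_definition expand2 :: "nat \<Rightarrow> cser2 \<Rightarrow> cser2" is "\<lambda>N F. F oo fps_X ^ N"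
proof -
  fix N and F :: "complex fps fps"
  assume "conv2 F"
  then obtain C R where *: "C > 0" "R \<ge> 1" "\<And>i j. norm (F $ i $ j) \<le> C * R ^ (i + j)"
    unfolding conv2_def by auto
  show "conv2 (F oo fps_X ^ N)"
  proof (rule conv2I)
    fix i j
    have "C * R ^ (i div N + j) \<le> C * R ^ (i + j)" using * by (intro mult_left_mono power_increasing) auto
    with *(3)[of "i div N" j] have "norm (F $ (i div N) $ j) \<le> C * R ^ (i + j)" by (rule order.trans)
    then show "norm ((F oo fps_X ^ N) $ i $ j) \<le> C * R ^ i * R ^ j"
      using *(1,2) unfolding fps_nth_compose_X_power by (auto simp: mult.assoc power_add)
  qed (use * in auto)
qed

lift_definition rotate1 :: "complex \<Rightarrow> cser \<Rightarrow> cser" is "\<lambda>z f. f oo (fps_const z * fps_X)"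
proof -
  fix z and f :: "complex fps"
  assume "conv1 f"
  then obtain C R where *: "C > 0" "R \<ge> 1" "\<And>i. norm (f $ i) \<le> C * R ^ i"
    unfolding conv1_def by auto
  show "conv1 (f oo (fps_const z * fps_X))"
  proof (rule conv1I)
    show "norm ((f oo (fps_const z * fps_X)) $ i) \<le> C * (norm z * R) ^ i" for i
      using mult_left_mono[OF *(3)[of i], of "norm z ^ i"]
      unfolding fps_nth_compose_linear by (auto simp: norm_mult norm_power power_mult_distrib mult_ac)
  qed (use * in auto)
qed

lift_definition rotate2 :: "complex \<Rightarrow> cser2 \<Rightarrow> cser2" is "\<lambda>z F. F oo (fps_const (fps_const z) * fps_X)"
proof -
  fix z and F :: "complex fps fps"
  assume "conv2 F"
  then obtain C R where *: "C > 0" "R \<ge> 1" "\<And>i j. norm (F $ i $ j) \<le> C * R ^ (i + j)"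
    unfolding conv2_def by auto
  show "conv2 (F oo (fps_const (fps_const z) * fps_X))"
  proof (rule conv2I)
    show "norm ((F oo (fps_const (fps_const z) * fps_X)) $ i $ j) \<le> C * (norm z * R) ^ i * R ^ j" for i j
      using mult_left_mono[OF *(3)[of i j], of "norm z ^ i"]
      unfolding fps_nth_compose_linear
      by (auto simp: fps_const_power norm_mult norm_power power_mult_distrib power_add mult_ac)
  qed (use * in auto)
qed

lemma nth1_expand1: "nth1 (expand1 N f) i = (if N dvd i then nth1 f (i div N) else 0)"
  by transfer (simp add: fps_nth_compose_X_power)

lemma nth2_expand2: "nth2 (expand2 N F) i j = (if N dvd i then nth2 F (i div N) j else 0)"
  by transfer (simp add: fps_nth_compose_X_power)

lemma nth1_rotate1 [simp]: "nth1 (rotate1 z f) i = z ^ i * nth1 f i"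
  by transfer simp

lemma nth2_rotate2 [simp]: "nth2 (rotate2 z F) i j = z ^ i * nth2 F i j"
  by transfer simp

lemma fps_compose_X_power_mult:
  fixes a b :: "'a::idom fps"
  shows "(a * b) oo fps_X ^ N = (a oo fps_X ^ N) * (b oo fps_X ^ N)"
proof (cases "N = 0")
  \<comment> \<open>The inner series is \<open>fps_X ^ 0 = 1\<close>, with nonzero constant term.
    The composite is then the constant coefficient of the outer series, and taking that coefficient
    is multiplicative.\<close>
  case True
  have eq: "f oo 1 = fps_const (f $ 0)" for f :: "'a fps"
    using fps_nth_compose_X_power[of f 0] by (auto simp: fps_eq_iff)
  show ?thesis unfolding True by (simp add: eq)
next
  case False
  then show ?thesis by (intro fps_compose_mult_distrib) auto
qed

lemma expand1_hom [simp]: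
  "expand1 N 0 = 0" "expand1 N 1 = 1" "expand1 N (f + g) = expand1 N f + expand1 N g"
  "expand1 N (f - g) = expand1 N f - expand1 N g" "expand1 N (- f) = - expand1 N f"
  by (rule cser_eqI; auto simp: nth1_expand1 elim!: dvdE split: if_splits)+

lemma expand2_hom [simp]:
  "expand2 N 0 = 0" "expand2 N 1 = 1" "expand2 N (F + G) = expand2 N F + expand2 N G"
  "expand2 N (F - G) = expand2 N F - expand2 N G" "expand2 N (- F) = - expand2 N F"
  by (rule cser2_eqI; auto simp: nth2_expand2 elim!: dvdE split: if_splits)+

lemma expand1_mult [simp]: "expand1 N (f * g) = expand1 N f * expand1 N g"
  by transfer (rule fps_compose_X_power_mult)

lemma expand2_mult [simp]: "expand2 N (F * G) = expand2 N F * expand2 N G"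
  by transfer (rule fps_compose_X_power_mult)

lemma rotate1_hom [simp]:
  "rotate1 z 0 = 0" "rotate1 z 1 = 1" "rotate1 z (f + g) = rotate1 z f + rotate1 z g"
  "rotate1 z (f - g) = rotate1 z f - rotate1 z g" "rotate1 z (- f) = - rotate1 z f"
  by (rule cser_eqI; auto simp: algebra_simps)+

lemma rotate2_hom [simp]:
  "rotate2 z 0 = 0" "rotate2 z 1 = 1" "rotate2 z (F + G) = rotate2 z F + rotate2 z G"
  "rotate2 z (F - G) = rotate2 z F - rotate2 z G" "rotate2 z (- F) = - rotate2 z F"
  by (rule cser2_eqI; auto simp: algebra_simps)+

lemma rotate1_mult [simp]: "rotate1 z (f * g) = rotate1 z f * rotate1 z g"
  by transfer (rule fps_compose_mult_distrib, simp)

lemma rotate2_mult [simp]: "rotate2 z (F * G) = rotate2 z F * rotate2 z G"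
  by transfer (rule fps_compose_mult_distrib, simp)

lemma expand1_power [simp]: "expand1 N (f ^ n) = expand1 N f ^ n"
  by (induction n) auto

lemma expand2_power [simp]: "expand2 N (F ^ n) = expand2 N F ^ n"
  by (induction n) auto

lemma expand1_sum: "expand1 N (sum f A) = (\<Sum>a\<in>A. expand1 N (f a))"
  by (induction A rule: infinite_finite_induct) auto

lemma expand2_sum: "expand2 N (sum f A) = (\<Sum>a\<in>A. expand2 N (f a))"
  by (induction A rule: infinite_finite_induct) auto

lemma expand2_prod: "expand2 N (prod f A) = (\<Prod>a\<in>A. expand2 N (f a))"
  by (induction A rule: infinite_finite_induct) auto

lemma rotate2_prod: "rotate2 z (prod f A) = (\<Prod>a\<in>A. rotate2 z (f a))"
  by (induction A rule: infinite_finite_induct) auto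

lemma expand_emb [simp]: "expand2 N (emb f) = emb (expand1 N f)"
  by (rule cser2_eqI) (simp add: nth2_expand2 nth1_expand1)

lemma expand2_varY [simp]: "N > 0 \<Longrightarrow> expand2 N varY = varY"
  by (rule cser2_eqI) (auto simp: nth2_expand2)

lemma rotate_emb [simp]: "rotate2 z (emb f) = emb (rotate1 z f)"
  by (rule cser2_eqI) simp

lemma rotate2_varY [simp]: "rotate2 z varY = varY"
  by (rule cser2_eqI) simp

lemma expand1_expand1: "expand1 M (expand1 N f) = expand1 (N * M) f"
  by (rule cser_eqI) (auto simp: nth1_expand1 div_mult2_eq mult.commute elim!: dvdE)

lemma expand2_expand2: "expand2 M (expand2 N F) = expand2 (N * M) F"
  by (rule cser2_eqI) (auto simp: nth2_expand2 div_mult2_eq mult.commute elim!: dvdE)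

lemma expand2_inject:
  assumes "N > 0" "expand2 N F = expand2 N G"
  shows "F = G"
proof (rule cser2_eqI)
  fix i j
  show "nth2 F i j = nth2 G i j"
    using arg_cong[OF assms(2), of "\<lambda>H. nth2 H (N * i) j"] assms(1) by (simp add: nth2_expand2)
qed

lemma expand1_var1: "N > 0 \<Longrightarrow> expand1 N var1 = var1 ^ N"
  by (rule cser_eqI) (auto simp: nth1_expand1 elim!: dvdE)

lemma expand1_const1 [simp]: "N > 0 \<Longrightarrow> expand1 N (const1 c) = const1 c"
  by (rule cser_eqI) (auto simp: nth1_expand1 elim!: dvdE)

lemma nth1_expand1_0 [simp]: "nth1 (expand1 N f) 0 = nth1 f 0"
  by (simp add: nth1_expand1)

lemma rotate1_rotate1: "rotate1 z (rotate1 w f) = rotate1 (z * w) f"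
  by (rule cser_eqI) (simp add: power_mult_distrib mult_ac)

lemma rotate1_one [simp]: "rotate1 1 f = f"
  by (rule cser_eqI) simp

lemma rotate2_expand2: "z ^ N = 1 \<Longrightarrow> rotate2 z (expand2 N F) = expand2 N F"
  by (rule cser2_eqI) (auto simp: nth2_expand2 power_mult elim!: dvdE)

text \<open>Inherits the default \<open>subdegree 0 = 0\<close>: the zero series has order 0 and not
  infinity. Inequalities between orders therefore come with nonvanishing assumptions or a separate
  case for 0.\<close>

lift_definition ord1 :: "cser \<Rightarrow> nat" is subdegree .

lift_definition shift1 :: "nat \<Rightarrow> cser \<Rightarrow> cser" is "fps_shift"
proof -
  fix k and f :: "complex fps"
  assume "conv1 f"
  then obtain C R where *: "C > 0" "R \<ge> 1" "\<And>i. norm (f $ i) \<le> C * R ^ i"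
    unfolding conv1_def by auto
  show "conv1 (fps_shift k f)"
  proof (rule conv1I)
    show "norm (fps_shift k f $ i) \<le> (C * R ^ k) * R ^ i" for i
      using *(3)[of "i + k"] by (simp add: power_add mult_ac)
  qed (use * in auto)
qed

lemma expand1_one [simp]: "expand1 (Suc 0) f = f"
  by (rule cser_eqI) (simp add: nth1_expand1)

lemma nth1_shift1 [simp]: "nth1 (shift1 k f) i = nth1 f (i + k)"
  by transfer simp

lemma nth1_ord1: "f \<noteq> 0 \<Longrightarrow> nth1 f (ord1 f) \<noteq> 0"
  by transfer simp

lemma nth1_less_ord1: "i < ord1 f \<Longrightarrow> nth1 f i = 0"
  by transfer auto

lemma ord1_geI: "f \<noteq> 0 \<Longrightarrow> (\<And>i. i < k \<Longrightarrow> nth1 f i = 0) \<Longrightarrow> k \<le> ord1 f"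
  by transfer (auto intro: subdegree_geI)

lemma ord1_eqI: "nth1 f k \<noteq> 0 \<Longrightarrow> (\<And>i. i < k \<Longrightarrow> nth1 f i = 0) \<Longrightarrow> ord1 f = k"
  by transfer (auto intro: subdegreeI)

lemma ord1_mult: "f \<noteq> 0 \<Longrightarrow> g \<noteq> 0 \<Longrightarrow> ord1 (f * g) = ord1 f + ord1 g"
  by transfer simp

lemma ord1_uminus [simp]: "ord1 (- f) = ord1 f"
  by transfer simp

lemma ord1_diff_commute: "ord1 (f - g) = ord1 (g - f)"
  using ord1_uminus[of "f - g"] by simp

lemma ord1_add_ge: "f + g \<noteq> 0 \<Longrightarrow> k \<le> ord1 f \<Longrightarrow> k \<le> ord1 g \<Longrightarrow> k \<le> ord1 (f + g)"
  by (rule ord1_geI) (auto simp: nth1_less_ord1)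

lemma ord1_pos: "f \<noteq> 0 \<Longrightarrow> nth1 f 0 = 0 \<Longrightarrow> 0 < ord1 f"
  using ord1_geI[of f 1] by auto

lemma ord1_prod: "(\<And>a. a \<in> A \<Longrightarrow> f a \<noteq> 0) \<Longrightarrow> ord1 (prod f A) = (\<Sum>a\<in>A. ord1 (f a))"
proof (induction A rule: infinite_finite_induct)
  case (infinite A)
  then show ?case by (simp add: ord1_eqI)
next
  case empty
  then show ?case by (simp add: ord1_eqI)
next
  case (insert a A)
  then show ?case by (simp add: ord1_mult)
qed

lemma ord1_unit:
  assumes "f dvd 1"
  shows "ord1 f = 0"
proof -
  obtain g where "1 = f * g" using assms by (elim dvdE)
  then have "nth1 f 0 * nth1 g 0 = 1" by (metis nth1_mult_0 nth1_simps(2))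
  then have "nth1 f 0 \<noteq> 0" by auto
  then show ?thesis by (intro ord1_eqI) auto
qed

lemma ord1_rotate1: "z \<noteq> 0 \<Longrightarrow> ord1 (rotate1 z f) = ord1 f"
proof (cases "f = 0")
  case False
  assume "z \<noteq> 0"
  with False show ?thesis by (intro ord1_eqI) (auto simp: nth1_ord1 nth1_less_ord1)
qed simp

lemma ord1_expand1:
  assumes "N > 0"
  shows "ord1 (expand1 N f) = N * ord1 f"
proof (cases "f = 0")
  case True
  have "ord1 0 = 0" by transfer simp
  with True show ?thesis by simp
next
  case False
  show ?thesis
  proof (rule ord1_eqI)
    show "nth1 (expand1 N f) (N * ord1 f) \<noteq> 0" using False assms by (simp add: nth1_expand1 nth1_ord1)
    show "nth1 (expand1 N f) i = 0" if "i < N * ord1 f" for i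
      using that assms by (auto simp: nth1_expand1 nth1_less_ord1 elim!: dvdE)
  qed
qed

lemma var1_power_dvd:
  assumes "\<And>i. i < k \<Longrightarrow> nth1 f i = 0"
  shows "f = var1 ^ k * shift1 k f"
  using assms by (intro cser_eqI) (auto simp: not_less)

lemma var1_nonzero [simp]: "var1 \<noteq> 0"
proof
  assume "var1 = 0"
  then have "nth1 var1 1 = nth1 0 1" by simp
  then show False by simp
qed

text \<open>Division of 1 by a series of order 0 on the axis leaves no remainder, and the quotient
  is the inverse.\<close>

lemma cser2_unit_iff: "F dvd 1 \<longleftrightarrow> nth2 F 0 0 \<noteq> 0"
proof
  assume "F dvd 1"
  then obtain G where "1 = F * G" by (elim dvdE)
  then have "nth2 F 0 0 * nth2 G 0 0 = 1" by (metis nth2_mult_0_0 nth2_simps(2))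
  then show "nth2 F 0 0 \<noteq> 0" by auto
next
  assume "nth2 F 0 0 \<noteq> 0"
  then obtain q where "\<And>i j. nth2 (1 - q * F) i j = 0"
    using weierstrass_division[of F 0 1] by auto
  then have "1 - q * F = 0" by (intro cser2_eqI) simp
  then have "1 = F * q" by (simp add: mult.commute)
  then show "F dvd 1" by (rule dvdI)
qed

section \<open>Evaluation along a smooth curve\<close>

text \<open>Substitution of a series without constant term for the second variable is the remainder
  of the division by \<open>y - a\<close>, so it is a ring homomorphism by uniqueness of the division.\<close>

definition ev :: "cser \<Rightarrow> cser2 \<Rightarrow> cser" where
  "ev a F = (THE r. \<exists>q. F = q * (varY - emb a) + emb r)"

lemma ev_exists:
  assumes "nth1 a 0 = 0"
  shows "\<exists>q r. F = q * (varY - emb a) + emb r"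
proof -
  obtain q where q: "\<And>i j. j \<ge> 1 \<Longrightarrow> nth2 (F - q * (varY - emb a)) i j = 0"
    using weierstrass_division[of "varY - emb a" 1 F] assms by auto
  from polynomial_in_varY[of 1, OF this]
  have "F - q * (varY - emb a) = emb (column (F - q * (varY - emb a)) 0)" by simp
  then have "F = q * (varY - emb a) + emb (column (F - q * (varY - emb a)) 0)"
    by (simp add: algebra_simps)
  then show ?thesis by blast
qed

lemma ev_unique:
  assumes "nth1 a 0 = 0" "q * (varY - emb a) + emb r = q' * (varY - emb a) + emb r'"
  shows "r = r'"
proof -
  have eq: "(q - q') * (varY - emb a) = emb (r' - r)" using assms(2) by (simp add: algebra_simps)
  have "q - q' = 0"
  proof (rule weierstrass_division_unique)
    show "nth2 (varY - emb a) 0 1 \<noteq> 0" by simp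
    show "nth2 (varY - emb a) 0 j = 0" if "j < 1" for j using that assms(1) by simp
    show "nth2 ((q - q') * (varY - emb a)) i j = 0" if "j \<ge> 1" for i j using that unfolding eq by simp
  qed
  with eq have "emb (r' - r) = 0" by simp
  then show ?thesis unfolding emb_eq_0_iff by simp
qed

lemma ev_eqI:
  assumes "nth1 a 0 = 0" "F = q * (varY - emb a) + emb r"
  shows "ev a F = r"
  unfolding ev_def
proof (rule the_equality)
  show "\<exists>q. F = q * (varY - emb a) + emb r" using assms(2) by blast
next
  fix r' assume "\<exists>q. F = q * (varY - emb a) + emb r'"
  then obtain q' where "F = q' * (varY - emb a) + emb r'" by blast
  with assms show "r' = r" by (intro ev_unique) auto
qed

lemma ev_decomp:
  assumes "nth1 a 0 = 0"
  obtains q where "F = q * (varY - emb a) + emb (ev a F)"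
proof -
  obtain q r where "F = q * (varY - emb a) + emb r" using ev_exists[OF assms] by blast
  with ev_eqI[OF assms this] that show ?thesis by blast
qed

context
  fixes a :: cser
  assumes a: "nth1 a 0 = 0"
begin

lemma ev_emb [simp]: "ev a (emb f) = f"
  by (rule ev_eqI[OF a, where q = 0]) simp

lemma ev_varY [simp]: "ev a varY = a"
  by (rule ev_eqI[OF a, where q = 1]) simp

lemma ev_0 [simp]: "ev a 0 = 0" and ev_1 [simp]: "ev a 1 = 1"
  using ev_emb[of 0] ev_emb[of 1] by (simp_all del: ev_emb)

lemma ev_add [simp]: "ev a (F + G) = ev a F + ev a G"
proof -
  obtain p where p: "F = p * (varY - emb a) + emb (ev a F)" using ev_decomp[OF a] .
  obtain q where q: "G = q * (varY - emb a) + emb (ev a G)" using ev_decomp[OF a] .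
  show ?thesis
    by (rule ev_eqI[OF a, where q = "p + q"]) (subst p, subst q, simp add: algebra_simps)
qed

lemma ev_mult [simp]: "ev a (F * G) = ev a F * ev a G"
proof -
  obtain p where p: "F = p * (varY - emb a) + emb (ev a F)" using ev_decomp[OF a] .
  obtain q where q: "G = q * (varY - emb a) + emb (ev a G)" using ev_decomp[OF a] .
  have "F * G = p * G * (varY - emb a) + emb (ev a F) * G"
    using arg_cong[OF p, of "\<lambda>x. x * G"] by (simp add: algebra_simps)
  also have "emb (ev a F) * G = emb (ev a F) * q * (varY - emb a) + emb (ev a F) * emb (ev a G)"
    using arg_cong[OF q, of "\<lambda>x. emb (ev a F) * x"] by (simp add: algebra_simps)
  finally have "F * G = (p * G + emb (ev a F) * q) * (varY - emb a) + emb (ev a F * ev a G)"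
    by (simp add: algebra_simps)
  then show ?thesis by (rule ev_eqI[OF a])
qed

lemma ev_uminus [simp]: "ev a (- F) = - ev a F"
  using ev_add[of F "- F"] by (simp add: eq_neg_iff_add_eq_0 add.commute)

lemma ev_diff [simp]: "ev a (F - G) = ev a F - ev a G"
  using ev_add[of F "- G"] by simp

lemma ev_power [simp]: "ev a (F ^ n) = ev a F ^ n"
  by (induction n) auto

lemma ev_sum: "ev a (sum f A) = (\<Sum>x\<in>A. ev a (f x))"
  by (induction A rule: infinite_finite_induct) auto

lemma ev_prod: "ev a (prod f A) = (\<Prod>x\<in>A. ev a (f x))"
  by (induction A rule: infinite_finite_induct) auto

lemma ev_eq_0_iff: "ev a F = 0 \<longleftrightarrow> (varY - emb a) dvd F"
proof
  assume *: "ev a F = 0"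
  obtain q where "F = q * (varY - emb a) + emb (ev a F)" using ev_decomp[OF a] .
  with * have "F = (varY - emb a) * q" by (simp add: mult.commute)
  then show "(varY - emb a) dvd F" by (rule dvdI)
next
  assume "(varY - emb a) dvd F"
  then obtain q where "F = (varY - emb a) * q" by (elim dvdE)
  then show "ev a F = 0" by simp
qed

lemma ev_unit: "F dvd 1 \<Longrightarrow> ev a F dvd 1"
  by (metis dvd_def ev_1 ev_mult)

lemma ev_unit_nonzero: "F dvd 1 \<Longrightarrow> ev a F \<noteq> 0"
  using ev_unit by fastforce

lemma nth1_ev_0: "nth1 (ev a F) 0 = nth2 F 0 0"
proof -
  obtain q where "F = q * (varY - emb a) + emb (ev a F)" using ev_decomp[OF a] .
  then have "nth2 F 0 0 = nth2 (q * (varY - emb a) + emb (ev a F)) 0 0" by simp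
  then show ?thesis using a by simp
qed

text \<open>Rotation fixes y, hence carries the division by \<open>varY - emb a\<close> to the
  division by \<open>varY - emb (rotate1 z a)\<close>. For a series in t^N, which is invariant, all
  conjugates of a root are thus roots.\<close>

lemma ev_rotate: "ev (rotate1 z a) (rotate2 z F) = rotate1 z (ev a F)"
proof -
  obtain q where "F = q * (varY - emb a) + emb (ev a F)" using ev_decomp[OF a] .
  from arg_cong[OF this, of "rotate2 z"]
  show ?thesis using a by (intro ev_eqI[where q = "rotate2 z q"]) simp_all
qed

end

section \<open>Existence of Puiseux roots\<close>

text \<open>The Taylor coefficients at \<open>b\<close> of the polynomial of degree at most
  \<open>n\<close> with coefficients \<open>r\<close>. Polynomials in y are kept as coefficient
  functions with a degree bound, so that the same formula serves over the series in x and over the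
  complex numbers, and passing to constant terms or to x = t^N is done coefficient by
  coefficient.\<close>

definition shift_coeff :: "(nat \<Rightarrow> 'a::comm_ring_1) \<Rightarrow> 'a \<Rightarrow> nat \<Rightarrow> nat \<Rightarrow> 'a" where
  "shift_coeff r b n k = (\<Sum>j=k..n. of_nat (j choose k) * r j * b ^ (j - k))"

lemma shift_coeff_sum:
  fixes r :: "nat \<Rightarrow> 'a::comm_ring_1"
  shows "(\<Sum>k\<le>n. shift_coeff r b n k * y ^ k) = (\<Sum>j\<le>n. r j * (y + b) ^ j)"
proof -
  have "(\<Sum>j\<le>n. r j * (y + b) ^ j) = (\<Sum>j\<le>n. \<Sum>k\<le>j. of_nat (j choose k) * r j * b ^ (j - k) * y ^ k)"
    by (simp add: binomial_ring sum_distrib_left mult_ac)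
  also have "\<dots> = (\<Sum>k\<le>n. \<Sum>j=k..n. of_nat (j choose k) * r j * b ^ (j - k) * y ^ k)"
    unfolding sum.Sigma[OF finite_atMost ballI[OF finite_atMost]]
      sum.Sigma[OF finite_atMost ballI[OF finite_atLeastAtMost]]
    by (rule sum.reindex_bij_witness[of _ "\<lambda>(k,j). (j,k)" "\<lambda>(j,k). (k,j)"]) auto
  finally show ?thesis by (simp add: shift_coeff_def sum_distrib_right)
qed

lemma shift_coeff_top [simp]: "shift_coeff r b n n = r n"
  by (simp add: shift_coeff_def)

lemma shift_coeff_subtop:
  assumes "n > 0"
  shows "shift_coeff r b n (n - 1) = r (n - 1) + of_nat n * r n * b"
proof -
  obtain m where "n = Suc m" using assms gr0_implies_Suc by blast
  then show ?thesis by (simp add: shift_coeff_def)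
qed

lemma shift_coeff_0_right: "k \<le> n \<Longrightarrow> shift_coeff r 0 n k = r k"
proof -
  assume "k \<le> n"
  have "shift_coeff r 0 n k = (\<Sum>j=k..n. if j = k then r k else 0)"
    unfolding shift_coeff_def by (intro sum.cong) (auto simp: power_0_left)
  then show ?thesis using \<open>k \<le> n\<close> by simp
qed

lemma nth1_of_nat_0 [simp]: "nth1 (of_nat k) 0 = of_nat k"
  by (induction k) auto

lemma nth1_shift_coeff: "nth1 (shift_coeff r b n k) 0 = shift_coeff (\<lambda>j. nth1 (r j) 0) (nth1 b 0) n k"
  by (simp add: shift_coeff_def nth1_sum)

lemma expand1_of_nat [simp]: "expand1 N (of_nat k) = of_nat k"
  by (induction k) auto

lemma expand1_shift_coeff:
  "expand1 N (shift_coeff r b n k) = shift_coeff (\<lambda>j. expand1 N (r j)) (expand1 N b) n k"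
  by (simp add: shift_coeff_def expand1_sum)

lemma monic_complex_root:
  fixes v :: "nat \<Rightarrow> complex"
  assumes "n > 0" "v n \<noteq> 0"
  shows "\<exists>z. (\<Sum>j\<le>n. v j * z ^ j) = 0"
proof -
  define p where "p = (\<Sum>j\<le>n. Polynomial.monom (v j) j)"
  have cp: "Polynomial.coeff p n = v n" by (simp add: p_def coeff_sum)
  then have "Polynomial.degree p \<ge> n" using assms by (intro le_degree) auto
  then have "Polynomial.degree p \<noteq> 0" using assms by simp
  then obtain z where "poly p z = 0"
    using fundamental_theorem_of_algebra[of p] constant_degree[of p] by auto
  then show ?thesis by (auto simp: p_def poly_sum poly_monom)
qed

text \<open>Divide y^n by \<open>F\<close>: y^n minus the remainder is a multiple
  \<open>q * F\<close> and a monic polynomial of degree \<open>n\<close>. On the axis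
  \<open>F\<close> starts with y^n, so the lower coefficients of \<open>q * F\<close> vanish at x =
  0, and comparing the coefficients of y^n shows that \<open>q\<close> is a unit.\<close>

lemma weierstrass_preparation:
  assumes "nth2 F 0 n \<noteq> 0" "\<And>j. j < n \<Longrightarrow> nth2 F 0 j = 0"
  shows "\<exists>u r. u dvd 1 \<and> u * F = (\<Sum>j\<le>n. emb (r j) * varY ^ j) \<and> r n = 1 \<and> (\<forall>j<n. nth1 (r j) 0 = 0)"
proof -
  obtain q where q: "\<And>i j. j \<ge> n \<Longrightarrow> nth2 (varY ^ n - q * F) i j = 0"
    using weierstrass_division[OF assms, of "varY ^ n"] by auto
  define R where "R = varY ^ n - q * F"
  define r where "r = (\<lambda>j. if j = n then 1 else - column R j)"
  have "R = (\<Sum>j<n. emb (column R j) * varY ^ j)"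
    using q unfolding R_def by (rule polynomial_in_varY)
  then have "q * F = varY ^ n - (\<Sum>j<n. emb (column R j) * varY ^ j)" by (simp add: R_def)
  also have "\<dots> = (\<Sum>j\<le>n. emb (r j) * varY ^ j)"
  proof -
    have "{..n} = insert n {..<n}" by auto
    then show ?thesis by (simp add: r_def sum_negf)
  qed
  finally have qF: "q * F = (\<Sum>j\<le>n. emb (r j) * varY ^ j)" .
  have low: "nth2 (q * F) 0 j = (if j < n then 0 else nth2 q 0 0 * nth2 F 0 n)" if "j \<le> n" for j
  proof -
    have "nth2 (q * F) 0 j = (\<Sum>b=0..j. nth2 q 0 b * nth2 F 0 (j - b))" by (simp add: nth2_mult)
    also have "\<dots> = (\<Sum>b=0..j. if b = 0 then nth2 q 0 0 * nth2 F 0 j else 0)"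
      using that assms(2) by (intro sum.cong) auto
    finally show ?thesis using that assms(2) by auto
  qed
  have "nth2 q 0 0 * nth2 F 0 n = 1"
    using low[of n] q[of n 0] by simp
  then have "nth2 q 0 0 \<noteq> 0" by auto
  moreover have "nth1 (r j) 0 = 0" if "j < n" for j
    using low[of j] that by (simp add: r_def R_def)
  ultimately show ?thesis using qF by (intro exI[of _ q] exI[of _ r]) (auto simp: cser2_unit_iff r_def)
qed

text \<open>Induction on the order \<open>n\<close> of \<open>F\<close> on the axis. The
  substitution x = t^q, y = t^p (y + c) along one edge of the Newton polygon gives a polynomial
  whose order on the axis is some m with 0 < m < n. For n = 1 the preliminary shift already yields
  the root. All series stay in \<open>cser\<close>, so the root is convergent by
  construction.\<close>

theorem puiseux_root:
  assumes "nth2 F 0 n \<noteq> 0" "\<And>j. j < n \<Longrightarrow> nth2 F 0 j = 0" "n > 0"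
  shows "\<exists>N a. N > 0 \<and> nth1 a 0 = 0 \<and> ev a (expand2 N F) = 0"
  using assms
proof (induction n arbitrary: F rule: less_induct)
  case (less n)
  obtain u r where u: "u dvd 1" and uF: "u * F = (\<Sum>j\<le>n. emb (r j) * varY ^ j)"
    and r: "r n = 1" "\<And>j. j < n \<Longrightarrow> nth1 (r j) 0 = 0"
    using weierstrass_preparation[OF less.prems(1,2)] by auto
  have root: "\<exists>N a. N > 0 \<and> nth1 a 0 = 0 \<and> ev a (expand2 N F) = 0"
    if "N > 0" "nth1 a 0 = 0" "(\<Sum>j\<le>n. expand1 N (r j) * a ^ j) = 0" for N a
  proof -
    have "ev a (expand2 N (u * F)) = 0"
      unfolding uF using that by (simp add: expand2_sum ev_sum)
    then have "ev a (expand2 N u) * ev a (expand2 N F) = 0" using that(2) by simp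
    moreover have "expand2 N u dvd 1" using u by (metis dvd_def expand2_hom(2) expand2_mult)
    ultimately show ?thesis using ev_unit_nonzero[OF that(2)] that by auto
  qed
  txt \<open>The shift by \<open>b\<close> removes the coefficient of \<open>y\<^sup>n\<^sup>-\<^sup>1\<close>, so that below the polynomial
    obtained from the first edge of the Newton polygon is not a power of a linear factor.\<close>
  define b where "b = - const1 (1 / of_nat n) * r (n - 1)"
  define s where "s = shift_coeff r b n"
  have nb: "nth1 b 0 = 0" using r(2)[of "n - 1"] less.prems(3) by (simp add: b_def)
  have sn: "s n = 1" by (simp add: s_def r)
  have "of_nat n * const1 (1 / of_nat n) = 1"
  proof -
    have "const1 (of_nat n) = of_nat n" for n by (induction n) auto
    then have "of_nat n * const1 (1 / of_nat n) = const1 (of_nat n * (1 / of_nat n))"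
      unfolding const1_hom(4) by simp
    then show ?thesis using less.prems(3) by simp
  qed
  then have "of_nat n * b = - r (n - 1)" by (simp add: b_def flip: mult.assoc)
  then have sn1: "s (n - 1) = 0"
    unfolding s_def shift_coeff_subtop[OF less.prems(3)] r by simp
  have s0: "nth1 (s k) 0 = 0" if "k < n" for k
    using that r(2) by (simp add: s_def nth1_shift_coeff nb shift_coeff_0_right)
  have rs: "(\<Sum>j\<le>n. expand1 M (r j) * (y + expand1 M b) ^ j) = (\<Sum>k\<le>n. expand1 M (s k) * y ^ k)" for M y
    unfolding s_def expand1_shift_coeff shift_coeff_sum ..
  show ?case
  proof (cases "\<forall>k<n. s k = 0")
    case True
    have "(\<Sum>k\<le>n. s k * 0 ^ k) = 0"
      using True less.prems(3) by (intro sum.neutral) (auto simp: le_less)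
    with rs[of 1 0] show ?thesis using nb by (intro root[of 1 b]) (auto simp: less.prems(3))
  next
    case False
    define S where "S = {k. k < n \<and> s k \<noteq> 0}"
    \<comment> \<open>Up to sign the slope of the segment from (k, ord s_k) to (n, 0). The minimum
      selects the edge of the Newton polygon that ends in (n, 0).\<close>
    define slope where "slope = (\<lambda>k. real (ord1 (s k)) / real (n - k))"
    have S: "finite S" "S \<noteq> {}" using False by (auto simp: S_def)
    then have "Min (slope ` S) \<in> slope ` S" by (intro Min_in) auto
    then obtain j0 where j0: "j0 \<in> S" "slope j0 = Min (slope ` S)" by auto
    \<comment> \<open>The minimal slope is p / q. The fraction need not be in lowest terms; a larger
      ramification index does no harm.\<close>
    define p where "p = ord1 (s j0)"
    define q where "q = n - j0"
    have q: "q > 0" using j0 by (simp add: q_def S_def)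
    have p: "p > 0" using j0 s0 by (auto simp: p_def S_def intro: ord1_pos)
    have slope: "p * (n - k) \<le> q * ord1 (s k)" if "k < n" "s k \<noteq> 0" for k
    proof -
      have "slope j0 \<le> slope k" unfolding j0(2) using S that by (intro Min_le) (auto simp: S_def)
      then have "real p * real (n - k) \<le> real q * real (ord1 (s k))"
        using that q by (simp add: slope_def p_def q_def field_simps)
      then show ?thesis by (metis of_nat_le_iff of_nat_mult)
    qed
    \<comment> \<open>The coefficients after x = t^q, y = t^p y' and division by t^(p n). By
      minimality of the slope, the shift discards only zero coefficients.\<close>
    define d where "d = (\<lambda>k. shift1 (p * (n - k)) (expand1 q (s k)))"
    have d: "expand1 q (s k) = var1 ^ (p * (n - k)) * d k" if "k \<le> n" for k
    proof -
      have "nth1 (expand1 q (s k)) i = 0" if "i < p * (n - k)" for i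
      proof (cases "s k = 0")
        case False
        then have "i < ord1 (expand1 q (s k))"
          using slope[of k] that \<open>k \<le> n\<close> q by (cases "k = n") (auto simp: ord1_expand1)
        then show ?thesis by (rule nth1_less_ord1)
      qed simp
      then show ?thesis unfolding d_def by (rule var1_power_dvd)
    qed
    have dn: "d n = 1" using d[of n] sn by simp
    have dn1: "d (n - 1) = 0" using sn1 by (auto simp: d_def intro: cser_eqI)
    have dj0: "nth1 (d j0) 0 \<noteq> 0"
      using j0 q by (simp add: d_def nth1_expand1 S_def nth1_ord1 flip: q_def p_def)
        (simp add: p_def nth1_ord1)
    \<comment> \<open>The polynomial of the edge. It is monic, has no term of degree n - 1, and its
      coefficient at \<open>j0\<close> is nonzero, because there the slope inequality is an
      equality.\<close>
    define v where "v = (\<lambda>k. nth1 (d k) 0)"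
    obtain c where c: "(\<Sum>j\<le>n. v j * c ^ j) = 0"
      using monic_complex_root[of n v] less.prems(3) dn by (auto simp: v_def)
    define e where "e = shift_coeff d (const1 c) n"
    define P where "P = shift_coeff v c n"
    have e0: "nth1 (e k) 0 = P k" for k
      by (simp add: e_def P_def nth1_shift_coeff v_def)
    have P0: "P 0 = 0"
    proof -
      have "(\<Sum>k\<le>n. P k * 0 ^ k) = 0" unfolding P_def shift_coeff_sum using c by simp
      then show ?thesis by (simp add: power_0_left if_distrib cong: if_cong)
    qed
    have Pn: "P n = 1" by (simp add: P_def v_def dn)
    \<comment> \<open>Otherwise the edge polynomial is the n-th power of y - c. Its vanishing
      coefficient in degree n - 1 forces c = 0, and then it is y^n, against the nonzero coefficient
      at \<open>j0\<close>.\<close>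
    have "\<exists>k<n. P k \<noteq> 0"
    proof (rule ccontr)
      assume "\<not> ?thesis"
      then have *: "P k = 0" if "k < n" for k using that by auto
      have "P (n - 1) = of_nat n * c"
        unfolding P_def shift_coeff_subtop[OF less.prems(3)] v_def dn1 dn by simp
      with *[of "n - 1"] less.prems(3) have "c = 0" by simp
      then have "P j0 = v j0" using j0 by (simp add: P_def shift_coeff_0_right S_def)
      with * j0 dj0 show False by (auto simp: v_def S_def)
    qed
    then obtain k where k: "k < n" "P k \<noteq> 0" by blast
    \<comment> \<open>The multiplicity of \<open>c\<close> as a root of the edge polynomial. It
      becomes the order on the axis of the next series \<open>G\<close>.\<close>
    define m where "m = (LEAST k. P k \<noteq> 0)"
    have "m \<le> k" unfolding m_def using k(2) by (rule Least_le)
    with k(1) have "m < n" by simp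
    moreover have "P m \<noteq> 0" unfolding m_def using k(2) by (rule LeastI)
    moreover have "P l = 0" if "l < m" for l
      using not_less_Least[OF that[unfolded m_def]] by simp
    ultimately have m: "m < n" "P m \<noteq> 0" "\<And>k. k < m \<Longrightarrow> P k = 0" by blast+
    define G where "G = (\<Sum>k\<le>n. emb (e k) * varY ^ k)"
    have nG: "nth2 G 0 k = P k" if "k \<le> n" for k
    proof -
      have "nth2 G 0 k = (\<Sum>l\<le>n. if k = l then nth1 (e l) 0 else 0)"
        by (simp add: G_def nth2_sum nth2_emb_varY_power)
      then show ?thesis using that by (simp add: e0)
    qed
    have "m > 0" using m P0 by (cases m) auto
    then obtain N g where N: "N > 0" "nth1 g 0 = 0" "ev g (expand2 N G) = 0"
      using less.IH[of m G] m nG by auto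
    define h where "h = g + const1 c"
    have "(\<Sum>k\<le>n. expand1 N (e k) * g ^ k) = 0"
      using N unfolding G_def by (simp add: expand2_sum ev_sum)
    then have dh: "(\<Sum>k\<le>n. expand1 N (d k) * h ^ k) = 0"
      unfolding e_def expand1_shift_coeff shift_coeff_sum h_def using N(1) by simp
    \<comment> \<open>Undoes the substitution: with x = t^(q N) in total, the factor t^p has become
      t^(N p), and \<open>h\<close> is the root \<open>g\<close> of \<open>G\<close> moved back by
      \<open>c\<close>.\<close>
    define y where "y = var1 ^ (N * p) * h"
    have "(\<Sum>k\<le>n. expand1 (q * N) (s k) * y ^ k) = var1 ^ (N * p * n) * (\<Sum>k\<le>n. expand1 N (d k) * h ^ k)"
      unfolding sum_distrib_left
    proof (rule sum.cong)
      fix k assume k: "k \<in> {..n}"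
      have "expand1 (q * N) (s k) * y ^ k
          = (var1 ^ (N * (p * (n - k))) * var1 ^ (N * p * k)) * (expand1 N (d k) * h ^ k)"
      proof -
        have "expand1 (q * N) (s k) = expand1 N (var1 ^ (p * (n - k)) * d k)"
          using d[of k] k by (simp flip: expand1_expand1)
        also have "\<dots> = var1 ^ (N * (p * (n - k))) * expand1 N (d k)"
          using N(1) by (simp add: expand1_var1 power_mult)
        finally have 1: "expand1 (q * N) (s k) = var1 ^ (N * (p * (n - k))) * expand1 N (d k)" .
        have 2: "y ^ k = var1 ^ (N * p * k) * h ^ k"
          by (simp only: y_def power_mult_distrib power_mult)
        show ?thesis unfolding 1 2 by (simp only: mult.assoc mult.left_commute mult.commute)
      qed
      also have "N * (p * (n - k)) + N * p * k = N * p * n"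
        using k by (simp add: diff_mult_distrib2 mult.assoc)
      then have "var1 ^ (N * (p * (n - k))) * var1 ^ (N * p * k) = var1 ^ (N * p * n)"
        by (metis power_add)
      finally show "expand1 (q * N) (s k) * y ^ k = var1 ^ (N * p * n) * (expand1 N (d k) * h ^ k)" .
    qed simp
    then have "(\<Sum>j\<le>n. expand1 (q * N) (r j) * (y + expand1 (q * N) b) ^ j) = 0"
      unfolding rs dh by simp
    moreover have "nth1 (y + expand1 (q * N) b) 0 = 0" using nb N(1) p by (simp add: y_def)
    ultimately show ?thesis using q N(1) by (intro root[of "q * N" "y + expand1 (q * N) b"]) auto
  qed
qed

section \<open>Orbits under roots of unity and the factorization after x = t^N\<close>

definition orbit :: "nat \<Rightarrow> cser \<Rightarrow> cser set" where
  "orbit N a = (\<lambda>z. rotate1 z a) ` {z. z ^ N = 1}"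

lemma root_unity_nonzero: "N > 0 \<Longrightarrow> z ^ N = 1 \<Longrightarrow> (z :: complex) \<noteq> 0"
  by (metis power_0_left one_neq_zero gr0_conv_Suc nat.distinct(1))

lemma finite_orbit: "N > 0 \<Longrightarrow> finite (orbit N a)"
  unfolding orbit_def by (intro finite_imageI finite_roots_unity) simp

lemma orbit_self: "a \<in> orbit N a"
  unfolding orbit_def by (rule image_eqI[of _ _ 1]) auto

lemma rotate1_in_orbit: "z ^ N = 1 \<Longrightarrow> b \<in> orbit N a \<Longrightarrow> rotate1 z b \<in> orbit N a"
  unfolding orbit_def by (auto simp: rotate1_rotate1 power_mult_distrib)

lemma orbit_eq:
  assumes "b \<in> orbit N a" "N > 0"
  shows "orbit N b = orbit N a"
proof -
  obtain w where w: "w ^ N = 1" "b = rotate1 w a" using assms(1) by (auto simp: orbit_def)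
  have "w \<noteq> 0" using w assms root_unity_nonzero by blast
  have "rotate1 z a = rotate1 (z / w) b \<and> (z / w) ^ N = 1" if "z ^ N = 1" for z
    using w that \<open>w \<noteq> 0\<close> by (simp add: rotate1_rotate1 power_divide)
  moreover have "rotate1 z b = rotate1 (z * w) a \<and> (z * w) ^ N = 1" if "z ^ N = 1" for z
    using w that by (simp add: rotate1_rotate1 power_mult_distrib)
  ultimately show ?thesis unfolding orbit_def by blast
qed

lemma bij_betw_rotate_orbit:
  assumes "N > 0" "z ^ N = 1"
  shows "bij_betw (rotate1 z) (orbit N a) (orbit N a)"
proof (rule bij_betw_byWitness[where f' = "rotate1 (inverse z)"])
  have z: "z \<noteq> 0" using root_unity_nonzero[OF assms] .
  show "\<forall>b\<in>orbit N a. rotate1 (inverse z) (rotate1 z b) = b"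
    "\<forall>b\<in>orbit N a. rotate1 z (rotate1 (inverse z) b) = b"
    using z by (simp_all add: rotate1_rotate1)
  show "rotate1 z ` orbit N a \<subseteq> orbit N a" using rotate1_in_orbit[OF assms(2)] by blast
  have "inverse z ^ N = 1" using assms(2) by (simp add: power_inverse)
  then show "rotate1 (inverse z) ` orbit N a \<subseteq> orbit N a" using rotate1_in_orbit by blast
qed

lemma nth1_orbit_0: "b \<in> orbit N a \<Longrightarrow> nth1 a 0 = 0 \<Longrightarrow> nth1 b 0 = 0"
  by (auto simp: orbit_def)

text \<open>The component F_l in the decomposition of F as a sum of x^l F_l(x^N, y) over l < N. For
  l = 0 it inverts \<open>expand2 N\<close> on its image; for N = 1 and l = 1 it is division by x,
  the terms without x being dropped.\<close>

lift_definition contract2 :: "nat \<Rightarrow> nat \<Rightarrow> cser2 \<Rightarrow> cser2" is "\<lambda>N l F. Abs_fps (\<lambda>i. F $ (N * i + l))"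
proof -
  fix N l and F :: "complex fps fps"
  assume "conv2 F"
  then obtain C R where *: "C > 0" "R \<ge> 1" "\<And>i j. norm (F $ i $ j) \<le> C * R ^ (i + j)"
    unfolding conv2_def by auto
  show "conv2 (Abs_fps (\<lambda>i. F $ (N * i + l)))"
  proof (rule conv2I)
    show "norm (Abs_fps (\<lambda>i. F $ (N * i + l)) $ i $ j) \<le> (C * R ^ l) * (R ^ N) ^ i * R ^ j" for i j
      using *(3)[of "N * i + l" j] by (simp add: power_add mult_ac flip: power_mult)
  qed (use * in auto)
qed

lemma nth2_contract2 [simp]: "nth2 (contract2 N l F) i j = nth2 F (N * i + l) j"
  by transfer simp

text \<open>If \<open>N\<close> does not divide \<open>i\<close>, some N-th root of unity satisfies
  z^i \<noteq> 1: with r = i mod N, there are N solutions of z^N = 1 but only r < N solutions of z^r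
  = 1. Invariance under this z kills the coefficients of x^i.\<close>

lemma rotation_invariant_imp_expand:
  assumes "N > 0" "\<And>z. z ^ N = 1 \<Longrightarrow> rotate2 z F = F"
  shows "F = expand2 N (contract2 N 0 F)"
proof (rule cser2_eqI)
  fix i j
  show "nth2 F i j = nth2 (expand2 N (contract2 N 0 F)) i j"
  proof (cases "N dvd i")
    case True
    then show ?thesis using assms(1) by (auto simp: nth2_expand2)
  next
    case False
    define r where "r = i mod N"
    have r: "r > 0" "r < N" using False assms(1) by (auto simp: r_def dvd_eq_mod_eq_0)
    have "\<not> {z::complex. z ^ N = 1} \<subseteq> {z. z ^ r = 1}"
    proof
      assume "{z::complex. z ^ N = 1} \<subseteq> {z. z ^ r = 1}"
      then have "card {z::complex. z ^ N = 1} \<le> card {z::complex. z ^ r = 1}"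
        using r by (intro card_mono finite_roots_unity) auto
      then show False using card_roots_unity_eq[of N] card_roots_unity_eq[of r] r by simp
    qed
    then obtain z :: complex where z: "z ^ N = 1" "z ^ r \<noteq> 1" by blast
    have "z ^ i = z ^ (N * (i div N) + r)" by (simp add: r_def)
    also have "\<dots> = z ^ r" unfolding power_add power_mult z by simp
    finally have "z ^ i \<noteq> 1" using z by simp
    moreover have "nth2 (rotate2 z F) i j = nth2 F i j" using assms(2)[OF z(1)] by simp
    ultimately have "nth2 F i j = 0" by simp
    then show ?thesis using False by (simp add: nth2_expand2)
  qed
qed

text \<open>The linear factors are split off one at a time. At a root \<open>b\<close> outside
  \<open>S\<close> the product over \<open>S\<close> takes the value of the product of the
  differences b - c, which is nonzero, so the cofactor must vanish at \<open>b\<close>.\<close>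

lemma linear_factors_dvd:
  assumes "finite S" "\<And>b. b \<in> S \<Longrightarrow> nth1 b 0 = 0" "\<And>b. b \<in> S \<Longrightarrow> ev b G = 0"
  shows "(\<Prod>b\<in>S. varY - emb b) dvd G"
  using assms
proof (induction S rule: finite_induct)
  case (insert b S)
  then have "(\<Prod>b\<in>S. varY - emb b) dvd G" by auto
  then obtain H where H: "G = (\<Prod>b\<in>S. varY - emb b) * H" by (elim dvdE)
  have b: "nth1 b 0 = 0" using insert by auto
  have "(\<Prod>c\<in>S. b - c) * ev b H = 0"
    using insert.prems(2)[of b] unfolding H by (simp add: b ev_prod)
  moreover have "(\<Prod>c\<in>S. b - c) \<noteq> 0" using insert by auto
  ultimately have "(varY - emb b) dvd H" using ev_eq_0_iff[OF b] by simp
  then show ?case using insert H by (simp add: mult.commute mult_dvd_mono)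
qed simp

lemma linear_factor_nonzero: "varY - emb b \<noteq> 0"
proof
  assume "varY - emb b = 0"
  then have "nth2 (varY - emb b) 0 1 = 0" by simp
  then show False by simp
qed

text \<open>The product over the orbit of a root is invariant under all rotations, hence it comes from
  a factor of \<open>F\<close> itself, which is \<open>F\<close> up to a unit by irreducibility.\<close>

theorem puiseux_factorization:
  assumes irr: "Factorial_Ring.irreducible F" and "nth2 F 0 n \<noteq> 0"
  shows "\<exists>N a U. N > 0 \<and> nth1 a 0 = 0 \<and> U dvd 1 \<and> expand2 N F = U * (\<Prod>b\<in>orbit N a. varY - emb b)"
proof -
  \<comment> \<open>The index \<open>n\<close> only witnesses that \<open>F\<close> does not vanish
    on the axis; the root theorem wants the least such index.\<close>
  define m where "m = (LEAST j. nth2 F 0 j \<noteq> 0)"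
  have m: "nth2 F 0 m \<noteq> 0" "\<And>j. j < m \<Longrightarrow> nth2 F 0 j = 0"
    unfolding m_def by (rule LeastI[of "\<lambda>j. nth2 F 0 j \<noteq> 0"], rule assms(2)) (use not_less_Least in blast)
  have "\<not> F dvd 1" using irr by (simp add: Factorial_Ring.irreducible_def)
  then have "m > 0" using m by (cases m) (auto simp: cser2_unit_iff)
  from puiseux_root[OF m this] obtain N a where
    N: "N > 0" and a: "nth1 a 0 = 0" and root: "ev a (expand2 N F) = 0" by blast
  define S where "S = orbit N a"
  define P where "P = (\<Prod>b\<in>S. varY - emb b)"
  have S: "finite S" "\<And>b. b \<in> S \<Longrightarrow> nth1 b 0 = 0"
    unfolding S_def using finite_orbit[OF N] nth1_orbit_0 a by blast+
  have "ev b (expand2 N F) = 0" if b: "b \<in> S" for b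
  proof -
    obtain z where z: "z ^ N = 1" "b = rotate1 z a" using b by (auto simp: S_def orbit_def)
    have "ev b (expand2 N F) = ev (rotate1 z a) (rotate2 z (expand2 N F))"
      using z rotate2_expand2 by simp
    also have "\<dots> = 0" using ev_rotate[OF a] root by simp
    finally show ?thesis .
  qed
  then have "P dvd expand2 N F" unfolding P_def using S by (intro linear_factors_dvd) auto
  then obtain H where H: "expand2 N F = P * H" by (elim dvdE)
  have P0: "P \<noteq> 0" unfolding P_def using S(1) linear_factor_nonzero by simp
  have rP: "rotate2 z P = P" if "z ^ N = 1" for z
  proof -
    have "rotate2 z P = (\<Prod>b\<in>S. varY - emb (rotate1 z b))" by (simp add: P_def rotate2_prod)
    also have "\<dots> = P" unfolding P_def S_def
      using prod.reindex_bij_betw[OF bij_betw_rotate_orbit[OF N that], of "\<lambda>b. varY - emb b"] .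
    finally show ?thesis .
  qed
  have rH: "rotate2 z H = H" if "z ^ N = 1" for z
  proof -
    have "P * rotate2 z H = P * H"
      using arg_cong[OF H, of "rotate2 z"] rotate2_expand2[OF that, of F] rP[OF that] H by (metis rotate2_mult)
    then show ?thesis using P0 by simp
  qed
  define p where "p = contract2 N 0 P"
  define h where "h = contract2 N 0 H"
  have p: "P = expand2 N p" and h: "H = expand2 N h"
    unfolding p_def h_def using rotation_invariant_imp_expand[OF N] rP rH by blast+
  have "expand2 N F = expand2 N (p * h)" using H p h by simp
  then have "F = p * h" using expand2_inject[OF N] by blast
  then have "p dvd 1 \<or> h dvd 1" using irr by (simp add: Factorial_Ring.irreducible_def)
  \<comment> \<open>The product vanishes at the root \<open>a\<close>, and \<open>a\<close> passes
    through the origin; so \<open>p\<close> vanishes there and the unit is the other factor.\<close>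
  moreover have "\<not> p dvd 1"
  proof -
    have "ev a P = 0" unfolding P_def using S a orbit_self[of a N]
      by (auto simp: ev_prod S_def[symmetric] intro!: prod_zero bexI[of _ a])
    then have "nth2 P 0 0 = 0" using nth1_ev_0[OF a, of P] by simp
    then show ?thesis by (simp add: cser2_unit_iff p_def)
  qed
  ultimately have "H dvd 1" unfolding h by (metis dvd_def expand2_hom(2) expand2_mult)
  then show ?thesis using N a H unfolding P_def S_def by (metis mult.commute)
qed

section \<open>Codimension of ideals\<close>

definition cst :: "complex \<Rightarrow> cser2" where
  "cst c = emb (const1 c)"

lemma cst_hom [simp]: "cst 0 = 0" "cst 1 = 1" "cst (a + b) = cst a + cst b"
  "cst (a * b) = cst a * cst b" "cst (- a) = - cst a"
  by (simp_all add: cst_def)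

lemma cst_sum: "cst (sum f A) = (\<Sum>x\<in>A. cst (f x))"
  by (induction A rule: infinite_finite_induct) auto

lemma nth2_cst: "nth2 (cst c) i j = (if i = 0 \<and> j = 0 then c else 0)"
  by (simp add: cst_def)

lemma expand2_cst [simp]: "N > 0 \<Longrightarrow> expand2 N (cst c) = cst c"
  by (simp add: cst_def)

definition ideal2 :: "cser2 \<Rightarrow> cser2 \<Rightarrow> cser2 set" where
  "ideal2 f g = {f * a + g * b | a b. True}"

lemma ideal2I: "G = f * a + g * b \<Longrightarrow> G \<in> ideal2 f g"
  by (auto simp: ideal2_def)

lemma ideal2_0 [simp]: "0 \<in> ideal2 f g"
  by (rule ideal2I[of _ _ 0 _ 0]) simp

lemma ideal2_add: "G \<in> ideal2 f g \<Longrightarrow> H \<in> ideal2 f g \<Longrightarrow> G + H \<in> ideal2 f g"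
proof -
  assume "G \<in> ideal2 f g" "H \<in> ideal2 f g"
  then obtain a b a' b' where "G = f * a + g * b" "H = f * a' + g * b'" by (auto simp: ideal2_def)
  then show ?thesis by (intro ideal2I[of _ _ "a + a'" _ "b + b'"]) (simp add: algebra_simps)
qed

lemma ideal2_mult: "G \<in> ideal2 f g \<Longrightarrow> H * G \<in> ideal2 f g"
proof -
  assume "G \<in> ideal2 f g"
  then obtain a b where "G = f * a + g * b" by (auto simp: ideal2_def)
  then show ?thesis by (intro ideal2I[of _ _ "H * a" _ "H * b"]) (simp add: algebra_simps)
qed

lemma ideal2_uminus: "G \<in> ideal2 f g \<Longrightarrow> - G \<in> ideal2 f g"
  using ideal2_mult[of G f g "- 1"] by simp

lemma ideal2_diff: "G \<in> ideal2 f g \<Longrightarrow> H \<in> ideal2 f g \<Longrightarrow> G - H \<in> ideal2 f g"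
  using ideal2_add[of G f g "- H"] ideal2_uminus by simp

lemma ideal2_sum: "(\<And>x. x \<in> A \<Longrightarrow> F x \<in> ideal2 f g) \<Longrightarrow> sum F A \<in> ideal2 f g"
  by (induction A rule: infinite_finite_induct) (auto intro: ideal2_add)

lemma ideal2_unit_mult:
  assumes "u dvd 1"
  shows "ideal2 (u * f) g = ideal2 f g"
proof -
  obtain v where v: "1 = u * v" using assms by (elim dvdE)
  have "f * a + g * b = u * f * (v * a) + g * b" for a b
    using arg_cong[OF v, of "\<lambda>x. x * f * a"] by (simp add: mult_ac)
  moreover have "u * f * a + g * b = f * (u * a) + g * b" for a b by (simp add: mult_ac)
  ultimately show ?thesis unfolding ideal2_def by blast
qed

lemma ideal2_commute: "ideal2 f g = ideal2 g f"
  unfolding ideal2_def by (metis add.commute)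

text \<open>Linear independence over the constants in the quotient by \<open>M\<close>, expressed
  through representatives. The quotient is formed only at the very end, where it has to be matched
  with the one in the definition of the intersection number.\<close>

definition indep_mod :: "cser2 set \<Rightarrow> 'i set \<Rightarrow> ('i \<Rightarrow> cser2) \<Rightarrow> bool" where
  "indep_mod M J e \<longleftrightarrow> (\<forall>c. (\<Sum>j\<in>J. cst (c j) * e j) \<in> M \<longrightarrow> (\<forall>j\<in>J. c j = 0))"

definition span_mod :: "cser2 set \<Rightarrow> 'i set \<Rightarrow> ('i \<Rightarrow> cser2) \<Rightarrow> bool" where
  "span_mod M J e \<longleftrightarrow> (\<forall>G. \<exists>c. G - (\<Sum>j\<in>J. cst (c j) * e j) \<in> M)"

text \<open>A relation and not a number: it includes finite dimension, so each lemma that transports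
  a codimension transports finiteness with it.\<close>

definition has_codim :: "cser2 set \<Rightarrow> nat \<Rightarrow> bool" where
  "has_codim M n \<longleftrightarrow> (\<exists>e. indep_mod M {..<n} e \<and> span_mod M {..<n} e)"

lemma indep_modD:
  "indep_mod M J e \<Longrightarrow> (\<Sum>j\<in>J. cst (c j) * e j) \<in> M \<Longrightarrow> j \<in> J \<Longrightarrow> c j = 0"
  by (auto simp: indep_mod_def)

lemma has_codimI:
  assumes "finite J" "indep_mod M J e" "span_mod M J e"
  shows "has_codim M (card J)"
proof -
  obtain h where h: "bij_betw h {..<card J} J"
    using ex_bij_betw_nat_finite[OF assms(1)] by (auto simp: atLeast0LessThan)
  have eq: "(\<Sum>i<card J. cst (c (h i)) * e (h i)) = (\<Sum>j\<in>J. cst (c j) * e j)" for c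
    by (rule sum.reindex_bij_betw[OF h])
  have "indep_mod M {..<card J} (e \<circ> h)"
    unfolding indep_mod_def
  proof (intro allI impI ballI)
    fix c i
    assume c: "(\<Sum>i<card J. cst (c i) * (e \<circ> h) i) \<in> M" and i: "i \<in> {..<card J}"
    define c' where "c' = c \<circ> inv_into {..<card J} h"
    have c': "c' (h i) = c i" if "i < card J" for i
      using that h by (simp add: c'_def bij_betw_inv_into_left)
    have "(\<Sum>i<card J. cst (c i) * (e \<circ> h) i) = (\<Sum>i<card J. cst (c' (h i)) * e (h i))"
      by (intro sum.cong) (auto simp: c')
    with c eq have "(\<Sum>j\<in>J. cst (c' j) * e j) \<in> M" by simp
    then have "c' (h i) = 0" using assms(2) h i by (auto simp: indep_mod_def bij_betw_def)
    then show "c i = 0" using c' i by simp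
  qed
  moreover have "span_mod M {..<card J} (e \<circ> h)"
    unfolding span_mod_def
  proof
    fix G
    obtain c where "G - (\<Sum>j\<in>J. cst (c j) * e j) \<in> M" using assms(3) by (auto simp: span_mod_def)
    then show "\<exists>c. G - (\<Sum>i<card J. cst (c i) * (e \<circ> h) i) \<in> M"
      using eq[of c] by (intro exI[of _ "c \<circ> h"]) simp
  qed
  ultimately show ?thesis unfolding has_codim_def by blast
qed

text \<open>Gaussian elimination: equation \<open>D\<close>, if it is not trivial, is solved for one
  unknown \<open>p\<close>, which is substituted into the others. One equation and one unknown
  disappear.\<close>

lemma homogeneous_system_nontrivial:
  fixes A :: "nat \<Rightarrow> 'j \<Rightarrow> complex"
  assumes "finite J" "card J > D"
  shows "\<exists>x. (\<exists>j\<in>J. x j \<noteq> 0) \<and> (\<forall>i<D. (\<Sum>j\<in>J. A i j * x j) = 0)"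
  using assms
proof (induction D arbitrary: A J)
  case 0
  then obtain j where "j \<in> J" by fastforce
  then show ?case by (intro exI[of _ "\<lambda>_. 1"]) auto
next
  case (Suc D)
  show ?case
  proof (cases "\<forall>j\<in>J. A D j = 0")
    case True
    obtain x where "\<exists>j\<in>J. x j \<noteq> 0" "\<forall>i<D. (\<Sum>j\<in>J. A i j * x j) = 0"
      using Suc.IH[of J A] Suc.prems by auto
    with True show ?thesis by (intro exI[of _ x]) (auto simp: less_Suc_eq)
  next
    case False
    then obtain p where p: "p \<in> J" "A D p \<noteq> 0" by blast
    define J' where "J' = J - {p}"
    have J': "finite J'" "J = insert p J'" "p \<notin> J'" using Suc.prems p by (auto simp: J'_def)
    have "card J' > D" using Suc.prems p by (simp add: J'_def)
    from Suc.IH[OF J'(1) this, of "\<lambda>i j. A i j - A i p * A D j / A D p"] obtain x where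
      x: "\<exists>j\<in>J'. x j \<noteq> 0" "\<And>i. i < D \<Longrightarrow> (\<Sum>j\<in>J'. (A i j - A i p * A D j / A D p) * x j) = 0" by blast
    define y where "y = x(p := - (\<Sum>j\<in>J'. A D j * x j) / A D p)"
    have yJ: "(\<Sum>j\<in>J'. B j * y j) = (\<Sum>j\<in>J'. B j * x j)" for B
      using J'(3) by (intro sum.cong) (auto simp: y_def)
    have "(\<Sum>j\<in>J. A i j * y j) = 0" if "i < Suc D" for i
    proof -
      have "(\<Sum>j\<in>J. A i j * y j) = A i p * y p + (\<Sum>j\<in>J'. A i j * x j)"
        unfolding J'(2) using J' yJ by simp
      also have "\<dots> = (\<Sum>j\<in>J'. (A i j - A i p * A D j / A D p) * x j)"
        by (simp add: y_def sum_subtractf sum_distrib_left sum_divide_distrib algebra_simps)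
      also have "\<dots> = 0"
      proof (cases "i = D")
        case True
        then show ?thesis using p(2) by simp
      qed (use that x(2) in auto)
      finally show ?thesis .
    qed
    moreover have "\<exists>j\<in>J. y j \<noteq> 0" using x(1) J' by (auto simp: y_def)
    ultimately show ?thesis by blast
  qed
qed

text \<open>Expressing the \<open>e j\<close> through the spanning family gives fewer equations than
  unknowns; a nontrivial solution is a relation among the \<open>e j\<close>.\<close>

lemma indep_card_le:
  fixes D :: nat
  assumes "finite J" "indep_mod (ideal2 f g) J e" "span_mod (ideal2 f g) {..<D} d"
  shows "card J \<le> D"
proof (rule ccontr)
  assume "\<not> card J \<le> D"
  then have cD: "D < card J" by simp
  have "\<forall>j. \<exists>c. e j - (\<Sum>i<D. cst (c i) * d i) \<in> ideal2 f g"
    using assms(3) by (auto simp: span_mod_def)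
  then obtain c where c: "\<And>j. e j - (\<Sum>i<D. cst (c j i) * d i) \<in> ideal2 f g" by metis
  obtain x where x: "\<exists>j\<in>J. x j \<noteq> 0" "\<And>i. i < D \<Longrightarrow> (\<Sum>j\<in>J. c j i * x j) = 0"
    using homogeneous_system_nontrivial[OF assms(1) cD, of "\<lambda>i j. c j i"] by auto
  have "(\<Sum>j\<in>J. cst (x j) * (\<Sum>i<D. cst (c j i) * d i)) = (\<Sum>j\<in>J. \<Sum>i<D. cst (c j i * x j) * d i)"
    by (simp add: sum_distrib_left mult_ac)
  also have "\<dots> = (\<Sum>i<D. \<Sum>j\<in>J. cst (c j i * x j) * d i)" by (rule sum.swap)
  also have "\<dots> = (\<Sum>i<D. cst (\<Sum>j\<in>J. c j i * x j) * d i)"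
    by (simp only: cst_sum sum_distrib_right)
  also have "\<dots> = 0" using x(2) by simp
  finally have "(\<Sum>j\<in>J. cst (x j) * e j) = (\<Sum>j\<in>J. cst (x j) * (e j - (\<Sum>i<D. cst (c j i) * d i)))"
    by (simp add: right_diff_distrib sum_subtractf)
  also have "\<dots> \<in> ideal2 f g" by (intro ideal2_sum ideal2_mult c)
  finally show False using assms(2) x(1) by (auto simp: indep_mod_def)
qed

lemma has_codim_card:
  assumes "has_codim (ideal2 f g) D" "finite J" "indep_mod (ideal2 f g) J e" "span_mod (ideal2 f g) J e"
  shows "card J = D"
proof -
  obtain d where d: "indep_mod (ideal2 f g) {..<D} d" "span_mod (ideal2 f g) {..<D} d"
    using assms(1) by (auto simp: has_codim_def)
  obtain e' where e': "span_mod (ideal2 f g) {..<card J} e'"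
    using has_codimI[OF assms(2-4)] by (auto simp: has_codim_def)
  have "card J \<le> D" using indep_card_le[OF assms(2,3) d(2)] .
  moreover have "card {..<D} \<le> card J" using indep_card_le[OF _ d(1) e'] by simp
  ultimately show ?thesis by simp
qed

text \<open>Multiplication by \<open>h\<close> and the projection form a sequence from O/(f, g) to
  O/(f h, g) to O/(h, g). The hypothesis \<open>cancel\<close> is the injectivity of the first map;
  the rest of the exactness is automatic. The basis consists of a basis for (h, g) and
  \<open>h\<close> times a basis for (f, g).\<close>

lemma has_codim_mult:
  assumes "has_codim (ideal2 h g) m" "has_codim (ideal2 f g) n"
    and cancel: "\<And>c x y. h * c = f * h * x + g * y \<Longrightarrow> c \<in> ideal2 f g"
  shows "has_codim (ideal2 (f * h) g) (m + n)"
proof -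
  obtain d where d: "indep_mod (ideal2 h g) {..<m} d" "span_mod (ideal2 h g) {..<m} d"
    using assms(1) by (auto simp: has_codim_def)
  obtain e where e: "indep_mod (ideal2 f g) {..<n} e" "span_mod (ideal2 f g) {..<n} e"
    using assms(2) by (auto simp: has_codim_def)
  define J where "J = {..<m} <+> {..<n}"
  define b where "b = case_sum d (\<lambda>j. h * e j)"
  have sumJ: "(\<Sum>j\<in>J. cst (c j) * b j)
      = (\<Sum>i<m. cst (c (Inl i)) * d i) + h * (\<Sum>j<n. cst (c (Inr j)) * e j)" for c
    unfolding J_def by (subst sum.Plus) (auto simp: b_def sum_distrib_left mult_ac)
  have sub: "G \<in> ideal2 h g" if G: "G \<in> ideal2 (f * h) g" for G
  proof -
    obtain x y where "G = f * h * x + g * y" using G by (auto simp: ideal2_def)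
    then show ?thesis by (intro ideal2I[of _ _ "f * x" _ y]) (simp add: mult_ac)
  qed
  have "indep_mod (ideal2 (f * h) g) J b"
    unfolding indep_mod_def
  proof (intro allI impI)
    fix c assume "(\<Sum>j\<in>J. cst (c j) * b j) \<in> ideal2 (f * h) g"
    then have *: "(\<Sum>i<m. cst (c (Inl i)) * d i) + h * (\<Sum>j<n. cst (c (Inr j)) * e j) \<in> ideal2 (f * h) g"
      unfolding sumJ .
    have "h * (\<Sum>j<n. cst (c (Inr j)) * e j) \<in> ideal2 h g"
      by (rule ideal2I[of _ _ "\<Sum>j<n. cst (c (Inr j)) * e j" _ 0]) simp
    from ideal2_diff[OF sub[OF *] this] have 1: "(\<Sum>i<m. cst (c (Inl i)) * d i) \<in> ideal2 h g" by simp
    have l: "c (Inl i) = 0" if "i < m" for i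
      using indep_modD[where c = "\<lambda>i. c (Inl i)", OF d(1) 1] that by simp
    with * have "h * (\<Sum>j<n. cst (c (Inr j)) * e j) \<in> ideal2 (f * h) g" by simp
    then obtain x y where "h * (\<Sum>j<n. cst (c (Inr j)) * e j) = f * h * x + g * y"
      by (auto simp: ideal2_def)
    then have 2: "(\<Sum>j<n. cst (c (Inr j)) * e j) \<in> ideal2 f g" by (rule cancel)
    have "c (Inr j) = 0" if "j < n" for j
      using indep_modD[where c = "\<lambda>j. c (Inr j)", OF e(1) 2] that by simp
    with l show "\<forall>j\<in>J. c j = 0" by (auto simp: J_def)
  qed
  moreover have "span_mod (ideal2 (f * h) g) J b"
    unfolding span_mod_def
  proof
    fix G
    obtain c where "G - (\<Sum>i<m. cst (c i) * d i) \<in> ideal2 h g" using d(2) by (auto simp: span_mod_def)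
    then obtain x y where xy: "G - (\<Sum>i<m. cst (c i) * d i) = h * x + g * y" by (auto simp: ideal2_def)
    obtain c' where "x - (\<Sum>j<n. cst (c' j) * e j) \<in> ideal2 f g" using e(2) by (auto simp: span_mod_def)
    then obtain x' y' where x': "x - (\<Sum>j<n. cst (c' j) * e j) = f * x' + g * y'" by (auto simp: ideal2_def)
    have "G = (\<Sum>i<m. cst (c i) * d i) + h * x + g * y" using xy by (simp add: algebra_simps)
    moreover have "x = (\<Sum>j<n. cst (c' j) * e j) + (f * x' + g * y')" using x' by (simp add: algebra_simps)
    ultimately have "G - (\<Sum>j\<in>J. cst (case_sum c c' j) * b j) = f * h * x' + g * (h * y' + y)"
      unfolding sumJ by (simp add: algebra_simps)
    then show "\<exists>c. G - (\<Sum>j\<in>J. cst (c j) * b j) \<in> ideal2 (f * h) g"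
      by (intro exI[of _ "case_sum c c'"] ideal2I)
  qed
  ultimately have "has_codim (ideal2 (f * h) g) (card J)" by (intro has_codimI) (auto simp: J_def)
  then show ?thesis by (simp add: J_def card_Plus)
qed

text \<open>Evaluation at y = b identifies O/(y - b) with the series in x and sends \<open>g\<close>
  to a unit times x^k, with k the order. The powers of x below k are a basis of the
  quotient.\<close>

lemma has_codim_linear_factor:
  assumes b: "nth1 b 0 = 0" and g: "ev b g \<noteq> 0"
  shows "has_codim (ideal2 (varY - emb b) g) (ord1 (ev b g))"
proof -
  define k where "k = ord1 (ev b g)"
  define s where "s = shift1 k (ev b g)"
  have gs: "ev b g = var1 ^ k * s"
    unfolding s_def k_def by (rule var1_power_dvd) (rule nth1_less_ord1)
  have "nth2 (emb s) 0 0 \<noteq> 0" using nth1_ord1[OF g] by (simp add: s_def k_def)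
  then obtain v where v: "1 = emb s * v" unfolding cser2_unit_iff[symmetric] by (elim dvdE)
  obtain q where q: "g = q * (varY - emb b) + emb (ev b g)" using ev_decomp[OF b] .
  have mem: "G \<in> ideal2 (varY - emb b) g \<longleftrightarrow> (\<forall>i<k. nth1 (ev b G) i = 0)" for G
  proof
    assume "G \<in> ideal2 (varY - emb b) g"
    then obtain x y where "G = (varY - emb b) * x + g * y" by (auto simp: ideal2_def)
    then have "ev b G = var1 ^ k * (s * ev b y)" using b gs by (simp add: mult.assoc)
    then show "\<forall>i<k. nth1 (ev b G) i = 0" by simp
  next
    assume *: "\<forall>i<k. nth1 (ev b G) i = 0"
    define w where "w = shift1 k (ev b G)"
    have w: "ev b G = var1 ^ k * w" unfolding w_def using * by (intro var1_power_dvd) auto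
    obtain p where p: "G = p * (varY - emb b) + emb (ev b G)" using ev_decomp[OF b] .
    have "emb (ev b G) = emb (var1 ^ k) * (emb s * v) * emb w" unfolding w v[symmetric] by simp
    also have "\<dots> = emb (ev b g) * v * emb w" unfolding gs by (simp add: mult_ac)
    also have "emb (ev b g) = g - q * (varY - emb b)" using q by (simp add: algebra_simps)
    finally have "G = p * (varY - emb b) + (g - q * (varY - emb b)) * v * emb w" using p by simp
    then show "G \<in> ideal2 (varY - emb b) g"
      by (intro ideal2I[of _ _ "p - q * v * emb w" _ "v * emb w"]) (simp add: algebra_simps)
  qed
  define e where "e = (\<lambda>i. emb (var1 ^ i))"
  have evs: "nth1 (ev b (\<Sum>i<k. cst (c i) * e i)) l = c l" if "l < k" for c l
  proof -
    have "nth1 (ev b (\<Sum>i<k. cst (c i) * e i)) l = (\<Sum>i<k. c i * (if l = i then 1 else 0))"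
      using b by (simp add: ev_sum nth1_sum cst_def e_def)
    also have "\<dots> = (\<Sum>i<k. if l = i then c i else 0)" by (intro sum.cong) auto
    also have "\<dots> = c l" using that by simp
    finally show ?thesis .
  qed
  have "indep_mod (ideal2 (varY - emb b) g) {..<k} e"
    unfolding indep_mod_def mem by (auto simp: evs)
  moreover have "span_mod (ideal2 (varY - emb b) g) {..<k} e"
    unfolding span_mod_def mem
  proof
    fix G
    show "\<exists>c. \<forall>i<k. nth1 (ev b (G - (\<Sum>j<k. cst (c j) * e j))) i = 0"
      using b by (intro exI[of _ "nth1 (ev b G)"]) (simp add: evs)
  qed
  ultimately show ?thesis unfolding has_codim_def k_def by blast
qed

lemma has_codim_linear_factors:
  assumes "finite S" "\<And>b. b \<in> S \<Longrightarrow> nth1 b 0 = 0" "\<And>b. b \<in> S \<Longrightarrow> ev b g \<noteq> 0"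
  shows "has_codim (ideal2 (\<Prod>b\<in>S. varY - emb b) g) (\<Sum>b\<in>S. ord1 (ev b g))"
  using assms
proof (induction S rule: finite_induct)
  case empty
  have "G \<in> ideal2 1 g" for G by (rule ideal2I[of _ _ G _ 0]) simp
  then show ?case by (auto simp: has_codim_def indep_mod_def span_mod_def)
next
  case (insert b S)
  have b: "nth1 b 0 = 0" "ev b g \<noteq> 0" using insert.prems by auto
  have "has_codim (ideal2 ((\<Prod>b\<in>S. varY - emb b) * (varY - emb b)) g)
      (ord1 (ev b g) + (\<Sum>b\<in>S. ord1 (ev b g)))"
  proof (rule has_codim_mult)
    show "has_codim (ideal2 (varY - emb b) g) (ord1 (ev b g))" by (rule has_codim_linear_factor[OF b])
    show "has_codim (ideal2 (\<Prod>b\<in>S. varY - emb b) g) (\<Sum>b\<in>S. ord1 (ev b g))" using insert by auto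
    fix c x y
    assume *: "(varY - emb b) * c = (\<Prod>b\<in>S. varY - emb b) * (varY - emb b) * x + g * y"
    \<comment> \<open>At y = b only g y survives. As \<open>g\<close> does not vanish there,
      \<open>y\<close> is divisible by y - b, and this factor can be cancelled.\<close>
    from arg_cong[OF *, of "ev b"] have "ev b g * ev b y = 0" using b(1) by simp
    then have "(varY - emb b) dvd y" using b ev_eq_0_iff[OF b(1)] by simp
    then obtain y' where "y = (varY - emb b) * y'" by (elim dvdE)
    with * have "(varY - emb b) * c = (varY - emb b) * ((\<Prod>b\<in>S. varY - emb b) * x + g * y')"
      by (simp add: algebra_simps)
    then have "c = (\<Prod>b\<in>S. varY - emb b) * x + g * y'" using linear_factor_nonzero[of b] by simp
    then show "c \<in> ideal2 (\<Prod>b\<in>S. varY - emb b) g" by (rule ideal2I)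
  qed
  then show ?case using insert.hyps by (simp add: mult.commute)
qed

section \<open>Codimension under x = t^N: the ring over t is free over the ring over x\<close>

lemma contract_decomp:
  assumes "N > 0"
  shows "G = (\<Sum>l<N. emb var1 ^ l * expand2 N (contract2 N l G))"
proof (rule cser2_eqI)
  fix i j
  have "nth2 (emb var1 ^ l * expand2 N (contract2 N l G)) i j = (if l = i mod N then nth2 G i j else 0)"
    if "l < N" for l
  proof (cases "l \<le> i \<and> N dvd i - l")
    case True
    then have "N * ((i - l) div N) + l = i" by simp
    moreover from this have "i mod N = l" using that by (metis mod_less mod_mult_self4)
    ultimately show ?thesis using True by (auto simp: nth2_expand2)
  next
    case False
    have "l \<noteq> i mod N"
    proof
      assume "l = i mod N"
      then have "l \<le> i \<and> N dvd i - l" by (simp add: minus_mod_eq_mult_div)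
      with False show False by simp
    qed
    then show ?thesis using False by (auto simp: nth2_expand2)
  qed
  then show "nth2 G i j = nth2 (\<Sum>l<N. emb var1 ^ l * expand2 N (contract2 N l G)) i j"
    using assms by (simp add: nth2_sum)
qed

lemma contract_of_decomp:
  assumes "l < N"
  shows "contract2 N l (\<Sum>k<N. emb var1 ^ k * expand2 N (p k)) = p l"
proof (rule cser2_eqI)
  fix i j
  have "nth2 (emb var1 ^ k * expand2 N (p k)) (N * i + l) j = (if k = l then nth2 (p l) i j else 0)"
    if "k < N" for k
  proof (cases "k = l")
    case True
    then show ?thesis using assms by (simp add: nth2_expand2)
  next
    case False
    have "\<not> (k \<le> N * i + l \<and> N dvd N * i + l - k)"
    proof
      assume *: "k \<le> N * i + l \<and> N dvd N * i + l - k"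
      then obtain c where "N * i + l - k = N * c" by (elim conjE dvdE)
      then have "N * i + l = N * c + k" using * by simp
      then have "(N * i + l) mod N = (N * c + k) mod N" by simp
      then show False using that assms False by simp
    qed
    then show ?thesis using False by (auto simp: nth2_expand2)
  qed
  then show "nth2 (contract2 N l (\<Sum>k<N. emb var1 ^ k * expand2 N (p k))) i j = nth2 (p l) i j"
    using assms by (simp add: nth2_sum)
qed

text \<open>The extended ideal is generated by elements of the smaller ring, so with respect to the
  free basis 1, t, ..., t^(N-1) membership is decided component by component.\<close>

lemma ideal2_expand_iff:
  assumes N: "N > 0"
  shows "G \<in> ideal2 (expand2 N f) (expand2 N g) \<longleftrightarrow> (\<forall>l<N. contract2 N l G \<in> ideal2 f g)"
proof
  assume "G \<in> ideal2 (expand2 N f) (expand2 N g)"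
  then obtain x y where G: "G = expand2 N f * x + expand2 N g * y" by (auto simp: ideal2_def)
  have "G = (\<Sum>l<N. emb var1 ^ l * expand2 N (f * contract2 N l x + g * contract2 N l y))"
  proof -
    have "G = expand2 N f * (\<Sum>l<N. emb var1 ^ l * expand2 N (contract2 N l x))
        + expand2 N g * (\<Sum>l<N. emb var1 ^ l * expand2 N (contract2 N l y))"
      using G contract_decomp[OF N, of x] contract_decomp[OF N, of y] by simp
    then show ?thesis by (simp add: sum_distrib_left algebra_simps sum.distrib)
  qed
  then have "contract2 N l G = f * contract2 N l x + g * contract2 N l y" if "l < N" for l
    using contract_of_decomp[OF that] by metis
  then show "\<forall>l<N. contract2 N l G \<in> ideal2 f g" by (auto intro: ideal2I)
next
  assume *: "\<forall>l<N. contract2 N l G \<in> ideal2 f g"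
  have "emb var1 ^ l * expand2 N (contract2 N l G) \<in> ideal2 (expand2 N f) (expand2 N g)" if l: "l < N" for l
  proof -
    obtain x y where xy: "contract2 N l G = f * x + g * y" using * l by (auto simp: ideal2_def)
    have "expand2 N (contract2 N l G) \<in> ideal2 (expand2 N f) (expand2 N g)"
      unfolding xy by (rule ideal2I[of _ _ "expand2 N x" _ "expand2 N y"]) simp
    then show ?thesis by (rule ideal2_mult)
  qed
  then have "(\<Sum>l<N. emb var1 ^ l * expand2 N (contract2 N l G)) \<in> ideal2 (expand2 N f) (expand2 N g)"
    by (intro ideal2_sum) auto
  then show "G \<in> ideal2 (expand2 N f) (expand2 N g)" using contract_decomp[OF N, of G] by simp
qed

lemma sum_expand_pairs:
  assumes "N > 0"
  shows "(\<Sum>p\<in>{..<N} \<times> J. cst (c p) * (case p of (l, j) \<Rightarrow> emb var1 ^ l * expand2 N (e j)))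
    = (\<Sum>l<N. emb var1 ^ l * expand2 N (\<Sum>j\<in>J. cst (c (l, j)) * e j))"
proof -
  have "(\<Sum>p\<in>{..<N} \<times> J. cst (c p) * (case p of (l, j) \<Rightarrow> emb var1 ^ l * expand2 N (e j)))
      = (\<Sum>(l, j)\<in>{..<N} \<times> J. cst (c (l, j)) * (emb var1 ^ l * expand2 N (e j)))"
    by (intro sum.cong) auto
  also have "\<dots> = (\<Sum>l<N. \<Sum>j\<in>J. cst (c (l, j)) * (emb var1 ^ l * expand2 N (e j)))"
    by (rule sum.cartesian_product[symmetric])
  also have "\<dots> = (\<Sum>l<N. emb var1 ^ l * expand2 N (\<Sum>j\<in>J. cst (c (l, j)) * e j))"
    using assms by (simp add: expand2_sum sum_distrib_left mult_ac)
  finally show ?thesis .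
qed

lemma indep_mod_expand:
  assumes N: "N > 0" and e: "indep_mod (ideal2 f g) J e"
  shows "indep_mod (ideal2 (expand2 N f) (expand2 N g)) ({..<N} \<times> J)
    (\<lambda>(l, j). emb var1 ^ l * expand2 N (e j))"
  unfolding indep_mod_def sum_expand_pairs[OF N] ideal2_expand_iff[OF N]
proof (intro allI impI ballI)
  fix c p
  assume *: "\<forall>l<N. contract2 N l (\<Sum>l<N. emb var1 ^ l * expand2 N (\<Sum>j\<in>J. cst (c (l, j)) * e j))
    \<in> ideal2 f g" and p: "p \<in> {..<N} \<times> J"
  have "(\<Sum>j\<in>J. cst (c (fst p, j)) * e j) \<in> ideal2 f g"
    using *[rule_format, of "fst p"] p by (auto simp: contract_of_decomp)
  then show "c p = 0" using e p by (auto simp: indep_mod_def)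
qed

lemma span_mod_expand:
  assumes N: "N > 0" and e: "span_mod (ideal2 f g) J e"
  shows "span_mod (ideal2 (expand2 N f) (expand2 N g)) ({..<N} \<times> J)
    (\<lambda>(l, j). emb var1 ^ l * expand2 N (e j))"
  unfolding span_mod_def sum_expand_pairs[OF N] ideal2_expand_iff[OF N]
proof
  fix G
  have "\<forall>l. \<exists>c. contract2 N l G - (\<Sum>j\<in>J. cst (c j) * e j) \<in> ideal2 f g"
    using e by (auto simp: span_mod_def)
  then obtain c where c: "\<And>l. contract2 N l G - (\<Sum>j\<in>J. cst (c l j) * e j) \<in> ideal2 f g" by metis
  define s where "s = (\<lambda>l. \<Sum>j\<in>J. cst (c l j) * e j)"
  have "G - (\<Sum>l<N. emb var1 ^ l * expand2 N (s l))
      = (\<Sum>l<N. emb var1 ^ l * expand2 N (contract2 N l G)) - (\<Sum>l<N. emb var1 ^ l * expand2 N (s l))"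
    by (rule arg_cong2[where f = minus, OF contract_decomp[OF N, of G] refl])
  also have "\<dots> = (\<Sum>l<N. emb var1 ^ l * expand2 N (contract2 N l G - s l))"
    by (simp add: right_diff_distrib sum_subtractf)
  finally have eq: "G - (\<Sum>l<N. emb var1 ^ l * expand2 N (s l))
      = (\<Sum>l<N. emb var1 ^ l * expand2 N (contract2 N l G - s l))" .
  have "contract2 N l (G - (\<Sum>l<N. emb var1 ^ l * expand2 N (s l))) \<in> ideal2 f g" if "l < N" for l
    unfolding eq contract_of_decomp[OF that] using c by (simp add: s_def)
  then show "\<exists>c. \<forall>l<N. contract2 N l (G - (\<Sum>l<N. emb var1 ^ l * expand2 N (\<Sum>j\<in>J. cst (c (l, j)) * e j)))
      \<in> ideal2 f g"
    by (intro exI[of _ "\<lambda>(l, j). c l j"]) (simp add: s_def)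
qed

text \<open>An independent family of size k below yields one of size N k above, so k is bounded by
  \<open>D\<close>. A family of maximal size spans, because any further element enters a relation
  with nonzero coefficient. Its N-fold is a basis above, and comparing cardinalities gives N k =
  D.\<close>

lemma has_codim_expandD:
  assumes N: "N > 0" and D: "has_codim (ideal2 (expand2 N f) (expand2 N g)) D"
  shows "\<exists>d. has_codim (ideal2 f g) d \<and> N * d = D"
proof -
  define K where "K = {k::nat. \<exists>e. indep_mod (ideal2 f g) {..<k} e}"
  obtain b where b: "span_mod (ideal2 (expand2 N f) (expand2 N g)) {..<D} b"
    using D by (auto simp: has_codim_def)
  have le: "k \<le> D" if "k \<in> K" for k
  proof -
    have "\<exists>e. indep_mod (ideal2 f g) {..<k} e" using that by (simp add: K_def)
    then obtain e where "indep_mod (ideal2 f g) {..<k} e" ..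
    from indep_card_le[OF _ indep_mod_expand[OF N this] b] have "N * k \<le> D" by simp
    moreover have "k \<le> N * k" using N by simp
    ultimately show ?thesis by linarith
  qed
  have "finite K" using le by (intro finite_subset[of K "{..D}"]) auto
  have "K \<noteq> {}" by (auto simp: K_def indep_mod_def intro!: exI[of _ 0])
  define k where "k = Max K"
  have "k \<in> K" unfolding k_def using \<open>finite K\<close> \<open>K \<noteq> {}\<close> by (rule Max_in)
  then obtain e where e: "indep_mod (ideal2 f g) {..<k} e" by (auto simp: K_def)
  have "Suc k \<notin> K" using Max_ge[OF \<open>finite K\<close>, of "Suc k"] by (auto simp: k_def)
  have "span_mod (ideal2 f g) {..<k} e"
    unfolding span_mod_def
  proof
    fix G
    define e' where "e' = e(k := G)"
    have "\<not> indep_mod (ideal2 f g) {..<Suc k} e'" using \<open>Suc k \<notin> K\<close> by (auto simp: K_def)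
    then obtain c where c: "(\<Sum>j<Suc k. cst (c j) * e' j) \<in> ideal2 f g" "\<exists>j<Suc k. c j \<noteq> 0"
      by (auto simp: indep_mod_def)
    have "(\<Sum>j<k. cst (c j) * e' j) = (\<Sum>j<k. cst (c j) * e j)"
      by (intro sum.cong) (auto simp: e'_def)
    with c(1) have *: "(\<Sum>j<k. cst (c j) * e j) + cst (c k) * G \<in> ideal2 f g" by (simp add: e'_def)
    have "c k \<noteq> 0"
    proof
      assume "c k = 0"
      with * have "\<forall>j\<in>{..<k}. c j = 0" using e unfolding indep_mod_def by simp
      with \<open>c k = 0\<close> c(2) show False by (auto simp: less_Suc_eq)
    qed
    then have "cst (1 / c k) * cst (c k) = 1" unfolding cst_hom(4)[symmetric] by simp
    then obtain w where w: "cst w * cst (c k) = 1" by blast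
    have "cst w * ((\<Sum>j<k. cst (c j) * e j) + cst (c k) * G)
        = cst w * (\<Sum>j<k. cst (c j) * e j) + (cst w * cst (c k)) * G"
      by (simp only: distrib_left mult.assoc)
    also have "\<dots> = G - (\<Sum>j<k. cst (- w * c j) * e j)"
      unfolding w by (simp add: sum_distrib_left sum_negf mult.assoc)
    finally have "G - (\<Sum>j<k. cst (- w * c j) * e j)
        = cst w * ((\<Sum>j<k. cst (c j) * e j) + cst (c k) * G)" ..
    also have "\<dots> \<in> ideal2 f g" by (rule ideal2_mult[OF *])
    finally show "\<exists>c. G - (\<Sum>j<k. cst (c j) * e j) \<in> ideal2 f g" by (intro exI[of _ "\<lambda>j. - w * c j"])
  qed
  note span = this
  have "has_codim (ideal2 f g) k" using e span by (auto simp: has_codim_def)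
  moreover have "N * k = D"
    using has_codim_card[OF D _ indep_mod_expand[OF N e] span_mod_expand[OF N span]] by simp
  ultimately show ?thesis by blast
qed

theorem has_codim_puiseux:
  assumes "N > 0" "expand2 N f = u * (\<Prod>b\<in>S. varY - emb b)" "u dvd 1"
    and "finite S" "\<And>b. b \<in> S \<Longrightarrow> nth1 b 0 = 0" "\<And>b. b \<in> S \<Longrightarrow> ev b (expand2 N g) \<noteq> 0"
  shows "\<exists>d. has_codim (ideal2 f g) d \<and> N * d = (\<Sum>b\<in>S. ord1 (ev b (expand2 N g)))"
proof (rule has_codim_expandD[OF assms(1)])
  show "has_codim (ideal2 (expand2 N f) (expand2 N g)) (\<Sum>b\<in>S. ord1 (ev b (expand2 N g)))"
    unfolding assms(2) ideal2_unit_mult[OF assms(3)] by (rule has_codim_linear_factors[OF assms(4-6)])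
qed

section \<open>Contact of branches\<close>

definition puiseux_param :: "nat \<Rightarrow> cser \<Rightarrow> cser2 \<Rightarrow> bool" where
  "puiseux_param N a F \<longleftrightarrow> N > 0 \<and> nth1 a 0 = 0 \<and>
     (\<exists>U. U dvd 1 \<and> expand2 N F = U * (\<Prod>b\<in>orbit N a. varY - emb b))"

lemma expand1_inject:
  assumes "N > 0" "expand1 N f = expand1 N g"
  shows "f = g"
proof (rule cser_eqI)
  fix i
  show "nth1 f i = nth1 g i"
    using arg_cong[OF assms(2), of "\<lambda>h. nth1 h (N * i)"] assms(1) by (simp add: nth1_expand1)
qed

lemma rotate1_expand1: "rotate1 z (expand1 M f) = expand1 M (rotate1 (z ^ M) f)"
  by (rule cser_eqI) (auto simp: nth1_expand1 power_mult elim!: dvdE)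

lemma complex_root_exists:
  assumes "M > 0"
  shows "\<exists>z::complex. z ^ M = w"
proof -
  define v where "v = (\<lambda>j. if j = M then 1 else if j = 0 then - w else 0)"
  obtain z where "(\<Sum>j\<le>M. v j * z ^ j) = 0"
    using monic_complex_root[of M v] assms by (auto simp: v_def)
  moreover have "(\<Sum>j\<le>M. v j * z ^ j) = (\<Sum>j\<in>{0, M}. v j * z ^ j)"
    by (rule sum.mono_neutral_right) (auto simp: v_def)
  ultimately show ?thesis using assms by (auto simp: v_def intro!: exI[of _ z])
qed

text \<open>Rotating a(t^M) by z amounts to rotating a by z^M. As complex numbers have M-th roots,
  z^M runs through all N-th roots of unity.\<close>

lemma orbit_expand:
  assumes "M > 0"
  shows "orbit (N * M) (expand1 M a) = expand1 M ` orbit N a"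
proof (intro subset_antisym subsetI)
  fix b assume "b \<in> orbit (N * M) (expand1 M a)"
  then obtain z where z: "z ^ (N * M) = 1" "b = rotate1 z (expand1 M a)" by (auto simp: orbit_def)
  then have "(z ^ M) ^ N = 1" by (simp add: mult.commute flip: power_mult)
  then show "b \<in> expand1 M ` orbit N a" using z by (auto simp: orbit_def rotate1_expand1)
next
  fix b assume "b \<in> expand1 M ` orbit N a"
  then obtain w where w: "w ^ N = 1" "b = expand1 M (rotate1 w a)" by (auto simp: orbit_def)
  obtain z where z: "z ^ M = w" using complex_root_exists[OF assms] by blast
  have "z ^ (N * M) = 1" using w z by (metis mult.commute power_mult)
  then show "b \<in> orbit (N * M) (expand1 M a)"
    using w z by (auto simp: orbit_def rotate1_expand1)
qed

lemma puiseux_param_expand: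
  assumes "puiseux_param N a F" "M > 0"
  shows "puiseux_param (N * M) (expand1 M a) F"
proof -
  obtain U where U: "U dvd 1" "expand2 N F = U * (\<Prod>b\<in>orbit N a. varY - emb b)"
    and N: "N > 0" "nth1 a 0 = 0"
    using assms(1) by (auto simp: puiseux_param_def)
  have "expand2 (N * M) F = expand2 M U * (\<Prod>b\<in>orbit N a. varY - emb (expand1 M b))"
    using U(2) assms(2) by (simp add: expand2_prod flip: expand2_expand2)
  also have "(\<Prod>b\<in>orbit N a. varY - emb (expand1 M b)) = (\<Prod>b\<in>expand1 M ` orbit N a. varY - emb b)"
    by (subst prod.reindex) (auto intro: inj_onI expand1_inject[OF assms(2)])
  finally have "expand2 (N * M) F = expand2 M U * (\<Prod>b\<in>orbit (N * M) (expand1 M a). varY - emb b)"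
    by (simp add: orbit_expand[OF assms(2)])
  moreover have "expand2 M U dvd 1" using U(1) by (metis dvd_def expand2_hom(2) expand2_mult)
  ultimately show ?thesis using N assms(2) by (auto simp: puiseux_param_def)
qed

lemma puiseux_param_common:
  assumes "puiseux_param N a F" "puiseux_param N' b G" "puiseux_param N'' c H"
  obtains M a' b' c' where "puiseux_param M a' F" "puiseux_param M b' G" "puiseux_param M c' H"
proof -
  have pos: "N > 0" "N' > 0" "N'' > 0" using assms by (auto simp: puiseux_param_def)
  show ?thesis
    using puiseux_param_expand[OF assms(1), of "N' * N''"] puiseux_param_expand[OF assms(2), of "N * N''"]
      puiseux_param_expand[OF assms(3), of "N * N'"] pos
    by (intro that[of "N * N' * N''"]) (simp_all add: mult_ac)
qed

lemma puiseux_param_exists: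
  assumes "Factorial_Ring.irreducible F" "\<exists>j. nth2 F 0 j \<noteq> 0"
  shows "\<exists>N a. puiseux_param N a F"
proof -
  obtain n where "nth2 F 0 n \<noteq> 0" using assms(2) ..
  from puiseux_factorization[OF assms(1) this] show ?thesis unfolding puiseux_param_def by blast
qed

lemma puiseux_param_ev:
  assumes "puiseux_param N a F" "nth1 b 0 = 0" "b \<notin> orbit N a"
  shows "ev b (expand2 N F) \<noteq> 0" "ord1 (ev b (expand2 N F)) = (\<Sum>c\<in>orbit N a. ord1 (b - c))"
proof -
  obtain U where U: "U dvd 1" "expand2 N F = U * (\<Prod>b\<in>orbit N a. varY - emb b)" and N: "N > 0"
    using assms(1) by (auto simp: puiseux_param_def)
  have eq: "ev b (expand2 N F) = ev b U * (\<Prod>c\<in>orbit N a. b - c)"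
    using U(2) assms(2) by (simp add: ev_prod)
  have nz: "b - c \<noteq> 0" if "c \<in> orbit N a" for c using that assms(3) by auto
  then have nz2: "(\<Prod>c\<in>orbit N a. b - c) \<noteq> 0" using finite_orbit[OF N] by simp
  note u = ev_unit_nonzero[OF assms(2) U(1)]
  show "ev b (expand2 N F) \<noteq> 0" unfolding eq using u nz2 by simp
  show "ord1 (ev b (expand2 N F)) = (\<Sum>c\<in>orbit N a. ord1 (b - c))"
    unfolding eq using u nz2 nz ord1_unit[OF ev_unit[OF assms(2) U(1)]]
    by (simp add: ord1_mult ord1_prod)
qed

text \<open>A common root means equal orbits, hence equal products. The quotient of the two unit
  factors is invariant under all rotations and therefore a unit in the original x. Read backwards:
  branches with non-associated equations have disjoint orbits.\<close>

lemma puiseux_param_associated: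
  assumes "puiseux_param N a F" "puiseux_param N b G" "b \<in> orbit N a"
  shows "\<exists>w. w dvd 1 \<and> F = w * G"
proof -
  have N: "N > 0" using assms(1) by (simp add: puiseux_param_def)
  define P where "P = (\<Prod>b\<in>orbit N a. varY - emb b)"
  obtain U where U: "U dvd 1" "expand2 N F = U * P"
    using assms(1) by (auto simp: puiseux_param_def P_def)
  obtain V where V: "V dvd 1" "expand2 N G = V * P"
    using assms(2) orbit_eq[OF assms(3) N] by (auto simp: puiseux_param_def P_def)
  obtain V' where V': "1 = V * V'" using V(1) by (elim dvdE)
  define W where "W = U * V'"
  have P0: "P \<noteq> 0" unfolding P_def using finite_orbit[OF N] linear_factor_nonzero by simp
  have FG: "expand2 N F = W * expand2 N G"
    using U V arg_cong[OF V', of "\<lambda>x. x * U * P"] by (simp add: W_def mult_ac)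
  have G0: "expand2 N G \<noteq> 0" using P0 V by auto
  have "rotate2 z W = W" if "z ^ N = 1" for z
  proof -
    have "rotate2 z W * expand2 N G = W * expand2 N G"
      using arg_cong[OF FG, of "rotate2 z"] rotate2_expand2[OF that] FG by (metis rotate2_mult)
    then show ?thesis using G0 by simp
  qed
  from rotation_invariant_imp_expand[OF N this] obtain w where w: "W = expand2 N w" by blast
  have "expand2 N F = expand2 N (w * G)" using FG w by simp
  then have "F = w * G" by (rule expand2_inject[OF N])
  moreover have "w dvd 1"
  proof -
    have "V' dvd 1" using V' by (metis dvd_triv_right)
    then have "W dvd 1" unfolding W_def using U(1) by (metis mult_dvd_mono mult_1)
    then have "nth2 W 0 0 \<noteq> 0" by (simp add: cser2_unit_iff)
    then show ?thesis unfolding cser2_unit_iff w by (simp add: nth2_expand2)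
  qed
  ultimately show ?thesis by blast
qed

text \<open>Summed over group elements, so each root of the second branch is counted
  \<open>N / card (orbit N b)\<close> times. This normalization removes the orbit sizes from the
  comparison of different branches.\<close>

definition contact_sum :: "nat \<Rightarrow> cser \<Rightarrow> cser \<Rightarrow> nat" where
  "contact_sum N a b = (\<Sum>z | z ^ N = 1. ord1 (a - rotate1 z b))"

lemma ord1_rotate1_diff: "z \<noteq> 0 \<Longrightarrow> ord1 (rotate1 z a - rotate1 z b) = ord1 (a - b)"
  using ord1_rotate1[of z "a - b"] by simp

lemma bij_betw_mult_roots_unity:
  assumes "N > 0" "(w::complex) ^ N = 1"
  shows "bij_betw (\<lambda>z. z * w) {z. z ^ N = 1} {z. z ^ N = 1}"
  using root_unity_nonzero[OF assms] assms(2)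
  by (intro bij_betw_byWitness[where f' = "\<lambda>z. z / w"]) (auto simp: power_mult_distrib power_divide)

lemma sum_roots_unity_orbit:
  fixes h :: "cser \<Rightarrow> nat"
  assumes N: "N > 0" and b: "b \<in> orbit N a"
  shows "(\<Sum>z | z ^ N = 1. h (rotate1 z b)) = (\<Sum>z | z ^ N = 1. h (rotate1 z a))"
proof -
  obtain w where w: "w ^ N = 1" "b = rotate1 w a" using b by (auto simp: orbit_def)
  have "(\<Sum>z | z ^ N = 1. h (rotate1 z b)) = (\<Sum>z | z ^ N = 1. h (rotate1 (z * w) a))"
    using w by (simp add: rotate1_rotate1)
  also have "\<dots> = (\<Sum>z | z ^ N = 1. h (rotate1 z a))"
    by (rule sum.reindex_bij_betw[OF bij_betw_mult_roots_unity[OF N w(1)], of "\<lambda>z. h (rotate1 z a)"])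
  finally show ?thesis .
qed

text \<open>Double counting in place of the orbit-stabilizer formula: every rotation permutes the
  orbit, and the sum over all rotations is the same for each of its elements.\<close>

lemma orbit_average:
  fixes h :: "cser \<Rightarrow> nat"
  assumes N: "N > 0"
  shows "N * (\<Sum>b\<in>orbit N a. h b) = card (orbit N a) * (\<Sum>z | z ^ N = 1. h (rotate1 z a))"
proof -
  have "N * (\<Sum>b\<in>orbit N a. h b) = (\<Sum>z | z ^ N = (1::complex). \<Sum>b\<in>orbit N a. h b)"
    using card_roots_unity_eq[OF N] by simp
  also have "\<dots> = (\<Sum>z | z ^ N = 1. \<Sum>b\<in>orbit N a. h (rotate1 z b))"
    by (rule sum.cong) (use sum.reindex_bij_betw[OF bij_betw_rotate_orbit[OF N], of _ h] in auto)
  also have "\<dots> = (\<Sum>b\<in>orbit N a. \<Sum>z | z ^ N = 1. h (rotate1 z b))" by (rule sum.swap)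
  also have "\<dots> = (\<Sum>b\<in>orbit N a. \<Sum>z | z ^ N = 1. h (rotate1 z a))"
    by (rule sum.cong) (use sum_roots_unity_orbit[OF N] in auto)
  finally show ?thesis by simp
qed

lemma orbit_double_sum:
  assumes N: "N > 0"
  shows "N * (\<Sum>a'\<in>orbit N a. \<Sum>b'\<in>orbit N b. ord1 (a' - b'))
    = card (orbit N a) * card (orbit N b) * contact_sum N a b"
proof -
  have "(\<Sum>b'\<in>orbit N b. ord1 (a' - b')) = (\<Sum>b'\<in>orbit N b. ord1 (a - b'))" if a': "a' \<in> orbit N a" for a'
  proof -
    obtain w where w: "w ^ N = 1" "a' = rotate1 w a" using a' by (auto simp: orbit_def)
    have "(\<Sum>b'\<in>orbit N b. ord1 (a' - b')) = (\<Sum>b'\<in>orbit N b. ord1 (a' - rotate1 w b'))"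
      using sum.reindex_bij_betw[OF bij_betw_rotate_orbit[OF N w(1)], of "\<lambda>b'. ord1 (a' - b')"] by simp
    also have "\<dots> = (\<Sum>b'\<in>orbit N b. ord1 (a - b'))"
      unfolding w(2) using root_unity_nonzero[OF N w(1)] by (simp add: ord1_rotate1_diff)
    finally show ?thesis .
  qed
  then have "(\<Sum>a'\<in>orbit N a. \<Sum>b'\<in>orbit N b. ord1 (a' - b'))
      = card (orbit N a) * (\<Sum>b'\<in>orbit N b. ord1 (a - b'))" by simp
  then have "N * (\<Sum>a'\<in>orbit N a. \<Sum>b'\<in>orbit N b. ord1 (a' - b'))
      = card (orbit N a) * (N * (\<Sum>b'\<in>orbit N b. ord1 (a - b')))" by (simp add: mult_ac)
  then show ?thesis unfolding orbit_average[OF N] contact_sum_def by (simp add: mult_ac)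
qed

lemma contact_sum_orbit_right:
  "N > 0 \<Longrightarrow> b' \<in> orbit N b \<Longrightarrow> contact_sum N a b' = contact_sum N a b"
  unfolding contact_sum_def by (rule sum_roots_unity_orbit)

lemma orbit_disjointD:
  assumes "N > 0" "b \<notin> orbit N a"
  shows "b' \<in> orbit N b \<Longrightarrow> b' \<notin> orbit N a" "b' \<in> orbit N b \<Longrightarrow> a' \<in> orbit N a \<Longrightarrow> a' - b' \<noteq> 0"
  using assms orbit_eq orbit_self by (metis, metis eq_iff_diff_eq_0)

text \<open>Up to the same nonzero factor on both sides, a contact sum is the sum of the orders of
  all differences of roots, which is symmetric.\<close>

lemma contact_sum_commute:
  assumes "N > 0"
  shows "contact_sum N a b = contact_sum N b a"
proof -
  have "N * (\<Sum>a'\<in>orbit N a. \<Sum>b'\<in>orbit N b. ord1 (a' - b'))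
      = N * (\<Sum>b'\<in>orbit N b. \<Sum>a'\<in>orbit N a. ord1 (b' - a'))"
    by (subst sum.swap) (simp add: ord1_diff_commute)
  moreover have "card (orbit N a) \<noteq> 0" "card (orbit N b) \<noteq> 0"
    using finite_orbit[OF assms] orbit_self by auto
  ultimately show ?thesis unfolding orbit_double_sum[OF assms] by (simp add: mult_ac)
qed

lemma contact_sum_pos:
  assumes "N > 0" "nth1 a 0 = 0" "nth1 b 0 = 0" "b \<notin> orbit N a"
  shows "contact_sum N a b > 0"
proof -
  have "ord1 (a - rotate1 1 b) > 0"
    using assms orbit_self[of a N] by (intro ord1_pos) auto
  also have "ord1 (a - rotate1 1 b) \<le> contact_sum N a b"
    unfolding contact_sum_def using finite_roots_unity[of N] assms(1) by (intro member_le_sum) auto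
  finally show ?thesis .
qed

text \<open>Write \<open>z b\<close> for \<open>rotate1 z b\<close>. In \<open>a - z b = (a - z c) + (z c - z a) + (z a - z b)\<close> the last
  two summands have order at least that of \<open>a - c\<close>, which bounds the order of the first one.\<close>

lemma contact_sum_le:
  assumes N: "N > 0" and disj: "b \<notin> orbit N a" "c \<notin> orbit N a"
    and max: "\<And>c'. c' \<in> orbit N c \<Longrightarrow> ord1 (a - c') \<le> ord1 (a - c)"
    and close: "ord1 (a - c) \<le> ord1 (c - b)"
  shows "contact_sum N a c \<le> contact_sum N a b"
  unfolding contact_sum_def
proof (rule sum_mono)
  fix z :: complex assume "z \<in> {z. z ^ N = 1}"
  then have z: "z ^ N = 1" by simp
  have z0: "z \<noteq> 0" using root_unity_nonzero[OF N z] .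
  have ab: "a - b \<noteq> 0" "a - rotate1 z b \<noteq> 0"
    using orbit_disjointD(2)[OF N disj(1)] orbit_self rotate1_in_orbit[OF z] by blast+
  have k: "ord1 (a - rotate1 z c) \<le> ord1 (a - c)"
    using max rotate1_in_orbit[OF z] orbit_self by blast
  have "a - b = (a - c) + (c - b)" by simp
  then have "ord1 (a - c) \<le> ord1 (a - b)"
    using ord1_add_ge[of "a - c" "c - b" "ord1 (a - c)"] close ab(1) by simp
  then have 1: "ord1 (a - c) \<le> ord1 (rotate1 z a - rotate1 z b)"
    unfolding ord1_rotate1_diff[OF z0] .
  have 2: "ord1 (rotate1 z c - rotate1 z a) = ord1 (a - c)"
    unfolding ord1_rotate1_diff[OF z0] by (rule ord1_diff_commute)
  have "a - rotate1 z b = (a - rotate1 z c) + (rotate1 z c - rotate1 z b)" by simp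
  \<comment> \<open>The case 0 is separate because \<open>ord1 0 = 0\<close> carries no information;
    there the two orders to be compared are equal.\<close>
  moreover have "ord1 (a - rotate1 z c) \<le> ord1 (rotate1 z c - rotate1 z b)
      \<or> rotate1 z c - rotate1 z b = 0"
  proof -
    have "rotate1 z c - rotate1 z b = (rotate1 z c - rotate1 z a) + (rotate1 z a - rotate1 z b)" by simp
    then show ?thesis using ord1_add_ge[of "rotate1 z c - rotate1 z a" "rotate1 z a - rotate1 z b"
          "ord1 (a - rotate1 z c)"] 1 2 k by auto
  qed
  ultimately show "ord1 (a - rotate1 z c) \<le> ord1 (a - rotate1 z b)"
    using ord1_add_ge[of "a - rotate1 z c" "rotate1 z c - rotate1 z b" "ord1 (a - rotate1 z c)"] ab(2)
    by auto
qed

lemma contact_sum_strong_triangle: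
  assumes N: "N > 0" and disj: "b \<notin> orbit N a" "c \<notin> orbit N a" "c \<notin> orbit N b"
  shows "contact_sum N a b \<ge> min (contact_sum N a c) (contact_sum N b c)"
proof -
  have half: "contact_sum N a c \<le> contact_sum N a b"
    if ba: "b \<notin> orbit N a" and ca: "c \<notin> orbit N a"
      and c1: "c1 \<in> orbit N c" "\<And>c'. c' \<in> orbit N c \<Longrightarrow> ord1 (a - c') \<le> ord1 (a - c1)"
      and c2: "c2 \<in> orbit N c" "ord1 (a - c1) \<le> ord1 (b - c2)" for a b c1 c2
  proof -
    have "c1 \<in> orbit N c2" using orbit_eq[OF c2(1) N] c1(1) by simp
    then obtain w where w: "w ^ N = 1" "c1 = rotate1 w c2" by (auto simp: orbit_def)
    \<comment> \<open>The rotation that carries \<open>c2\<close> to \<open>c1\<close> is applied to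
      \<open>b\<close>, so that \<open>b'\<close> is as close to \<open>c1\<close> as
      \<open>b\<close> is to \<open>c2\<close>.\<close>
    define b' where "b' = rotate1 w b"
    have b': "b' \<in> orbit N b" unfolding b'_def using rotate1_in_orbit[OF w(1) orbit_self] .
    have "ord1 (c1 - b') = ord1 (b - c2)"
      unfolding w(2) b'_def ord1_rotate1_diff[OF root_unity_nonzero[OF N w(1)]] by (rule ord1_diff_commute)
    then have "contact_sum N a c1 \<le> contact_sum N a b'"
      using c1 c2 orbit_disjointD(1)[OF N ba b'] orbit_disjointD(1)[OF N ca c1(1)] orbit_eq[OF c1(1) N]
      by (intro contact_sum_le[OF N]) auto
    then show ?thesis using contact_sum_orbit_right[OF N] b' c1(1) by simp
  qed
  have ex: "\<exists>c1\<in>orbit N c. \<forall>c'\<in>orbit N c. ord1 (x - c') \<le> ord1 (x - c1)" for x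
  proof -
    have "Max ((\<lambda>c'. ord1 (x - c')) ` orbit N c) \<in> (\<lambda>c'. ord1 (x - c')) ` orbit N c"
      using finite_orbit[OF N] orbit_self by (intro Max_in) auto
    then obtain c1 where "c1 \<in> orbit N c" "ord1 (x - c1) = Max ((\<lambda>c'. ord1 (x - c')) ` orbit N c)" by auto
    then show ?thesis using finite_orbit[OF N] by (intro bexI[of _ c1]) (auto intro: Max_ge)
  qed
  obtain c1 where c1: "c1 \<in> orbit N c" "\<And>c'. c' \<in> orbit N c \<Longrightarrow> ord1 (a - c') \<le> ord1 (a - c1)"
    using ex[of a] by blast
  obtain c2 where c2: "c2 \<in> orbit N c" "\<And>c'. c' \<in> orbit N c \<Longrightarrow> ord1 (b - c') \<le> ord1 (b - c2)"
    using ex[of b] by blast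
  have ab: "a \<notin> orbit N b" using disj(1) orbit_eq[OF _ N] orbit_self by metis
  \<comment> \<open>The two maximal contacts of \<open>c\<close> are compared. The branch with the
    smaller one takes the role of \<open>a\<close> in \<open>half\<close>, and symmetry of the
    contact sum covers the exchanged case.\<close>
  show ?thesis
  proof (cases "ord1 (a - c1) \<le> ord1 (b - c2)")
    case True
    have "contact_sum N a c \<le> contact_sum N a b"
      by (rule half[OF disj(1,2) c1 c2(1) True])
    then show ?thesis by simp
  next
    case False
    then have "ord1 (b - c2) \<le> ord1 (a - c1)" by simp
    from half[OF ab disj(3) c2 c1(1) this] show ?thesis
      using contact_sum_commute[OF N, of a b] by simp
  qed
qed

section \<open>From contact sums back to codimensions\<close>

lemma puiseux_codim:
  assumes F: "puiseux_param N a F" and G: "puiseux_param N b G" and "b \<notin> orbit N a"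
  shows "\<exists>d. has_codim (ideal2 F G) d \<and>
    N * N * d = card (orbit N a) * card (orbit N b) * contact_sum N a b"
proof -
  obtain U where U: "U dvd 1" "expand2 N F = U * (\<Prod>b\<in>orbit N a. varY - emb b)"
    and N: "N > 0" and a: "nth1 a 0 = 0"
    using F by (auto simp: puiseux_param_def)
  have *: "nth1 a' 0 = 0" "a' \<notin> orbit N b" if "a' \<in> orbit N a" for a'
    using nth1_orbit_0[OF that a] that orbit_disjointD(1)[OF N assms(3)] orbit_eq[OF _ N] orbit_self
    by metis+
  obtain d where d: "has_codim (ideal2 F G) d"
    "N * d = (\<Sum>a'\<in>orbit N a. ord1 (ev a' (expand2 N G)))"
    using has_codim_puiseux[OF N U(2,1) finite_orbit[OF N], of G] * puiseux_param_ev(1)[OF G] by blast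
  have "N * d = (\<Sum>a'\<in>orbit N a. \<Sum>b'\<in>orbit N b. ord1 (a' - b'))"
    unfolding d(2) by (rule sum.cong) (use * puiseux_param_ev(2)[OF G] in auto)
  then have "N * N * d = N * (\<Sum>a'\<in>orbit N a. \<Sum>b'\<in>orbit N b. ord1 (a' - b'))" by simp
  then show ?thesis using d(1) orbit_double_sum[OF N] by auto
qed

text \<open>Over t, the equation x = 0 becomes t^N, which has order N along every root; the factor N
  cancels.\<close>

lemma puiseux_codim_axis:
  assumes F: "puiseux_param N a F"
  shows "has_codim (ideal2 (emb var1) F) (card (orbit N a))"
proof -
  obtain U where U: "U dvd 1" "expand2 N F = U * (\<Prod>b\<in>orbit N a. varY - emb b)"
    and N: "N > 0" and a: "nth1 a 0 = 0"
    using F by (auto simp: puiseux_param_def)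
  have *: "nth1 a' 0 = 0" if "a' \<in> orbit N a" for a' using nth1_orbit_0[OF that a] .
  have ev: "ev a' (expand2 N (emb var1)) = var1 ^ N" if "a' \<in> orbit N a" for a'
    using *[OF that] N by (simp add: expand1_var1)
  have ord: "ord1 (var1 ^ N) = N" by (rule ord1_eqI) auto
  obtain d where d: "has_codim (ideal2 F (emb var1)) d"
    "N * d = (\<Sum>a'\<in>orbit N a. ord1 (ev a' (expand2 N (emb var1))))"
    using has_codim_puiseux[OF N U(2,1) finite_orbit[OF N], of "emb var1"] * ev by fastforce
  have "N * d = N * card (orbit N a)" unfolding d(2) using ev ord by simp
  then show ?thesis using d(1) N by (simp add: ideal2_commute)
qed

text \<open>The inequality inside the series ring, with L as the axis x = 0. The hypotheses
  \<open>axis\<close> exclude L itself, and \<open>distinct\<close> excludes associated equations.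
  Positivity is recorded because the passage to intersection numbers,
  \<open>intersection_number_eq\<close>, asks for a positive codimension.\<close>

theorem codim_strong_triangle:
  assumes irr: "Factorial_Ring.irreducible F" "Factorial_Ring.irreducible G" "Factorial_Ring.irreducible H"
    and axis: "\<exists>j. nth2 F 0 j \<noteq> 0" "\<exists>j. nth2 G 0 j \<noteq> 0" "\<exists>j. nth2 H 0 j \<noteq> 0"
    and distinct: "\<And>w. w dvd 1 \<Longrightarrow> F \<noteq> w * G" "\<And>w. w dvd 1 \<Longrightarrow> F \<noteq> w * H" "\<And>w. w dvd 1 \<Longrightarrow> G \<noteq> w * H"
  shows "\<exists>f g h x y z.
    has_codim (ideal2 (emb var1) F) f \<and> has_codim (ideal2 (emb var1) G) g \<and>
    has_codim (ideal2 (emb var1) H) h \<and>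
    has_codim (ideal2 F G) x \<and> has_codim (ideal2 F H) y \<and> has_codim (ideal2 G H) z \<and>
    f > 0 \<and> g > 0 \<and> h > 0 \<and> x > 0 \<and> y > 0 \<and> z > 0 \<and>
    real f * real g / real x \<le> max (real f * real h / real y) (real g * real h / real z)"
proof -
  obtain N1 a1 where 1: "puiseux_param N1 a1 F" using puiseux_param_exists[OF irr(1) axis(1)] by blast
  obtain N2 b2 where 2: "puiseux_param N2 b2 G" using puiseux_param_exists[OF irr(2) axis(2)] by blast
  obtain N3 c3 where 3: "puiseux_param N3 c3 H" using puiseux_param_exists[OF irr(3) axis(3)] by blast
  obtain N a b c where F: "puiseux_param N a F" and G: "puiseux_param N b G" and H: "puiseux_param N c H"
    using puiseux_param_common[OF 1 2 3] .
  have N: "N > 0" and zero: "nth1 a 0 = 0" "nth1 b 0 = 0" "nth1 c 0 = 0"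
    using F G H by (auto simp: puiseux_param_def)
  have disj: "b \<notin> orbit N a" "c \<notin> orbit N a" "c \<notin> orbit N b"
    using puiseux_param_associated[OF F G] distinct(1) puiseux_param_associated[OF F H] distinct(2)
      puiseux_param_associated[OF G H] distinct(3) by metis+
  define f g h where "f = card (orbit N a)" and "g = card (orbit N b)" and "h = card (orbit N c)"
  have fgh: "f > 0" "g > 0" "h > 0"
    unfolding f_def g_def h_def using finite_orbit[OF N] orbit_self by (auto simp: card_gt_0_iff)
  define p q r where "p = contact_sum N a b" and "q = contact_sum N a c" and "r = contact_sum N b c"
  have pqr: "p > 0" "q > 0" "r > 0"
    unfolding p_def q_def r_def using contact_sum_pos[OF N] zero disj by blast+
  have pqr': "min q r \<le> p" unfolding p_def q_def r_def by (rule contact_sum_strong_triangle[OF N disj])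
  obtain x where x: "has_codim (ideal2 F G) x" "N * N * x = f * g * p"
    using puiseux_codim[OF F G disj(1)] unfolding f_def g_def p_def by blast
  obtain y where y: "has_codim (ideal2 F H) y" "N * N * y = f * h * q"
    using puiseux_codim[OF F H disj(2)] unfolding f_def h_def q_def by blast
  obtain z where z: "has_codim (ideal2 G H) z" "N * N * z = g * h * r"
    using puiseux_codim[OF G H disj(3)] unfolding g_def h_def r_def by blast
  have pos: "x > 0" "y > 0" "z > 0" using x(2) y(2) z(2) fgh pqr by (auto intro!: Nat.gr0I)
  have eq: "real i * real j / real u = real (N * N) / real k"
    if "N * N * u = i * j * k" "u > 0" "k > 0" for i j u k
  proof -
    have "real (N * N) * real u = real i * real j * real k" using that(1) by (metis of_nat_mult)
    then show ?thesis using that by (simp add: field_simps)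
  qed
  have "real f * real g / real x \<le> max (real f * real h / real y) (real g * real h / real z)"
    unfolding eq[OF x(2) pos(1) pqr(1)] eq[OF y(2) pos(2) pqr(2)] eq[OF z(2) pos(3) pqr(3)]
  proof (cases "q \<le> r")
    case True
    then have "real (N * N) / real p \<le> real (N * N) / real q" using pqr pqr' by (intro divide_left_mono) auto
    then show "real (N * N) / real p \<le> max (real (N * N) / real q) (real (N * N) / real r)" by simp
  next
    case False
    then have "real (N * N) / real p \<le> real (N * N) / real r" using pqr pqr' by (intro divide_left_mono) auto
    then show "real (N * N) / real p \<le> max (real (N * N) / real q) (real (N * N) / real r)" by simp
  qed
  then show ?thesis
    using x(1) y(1) z(1) pos fgh puiseux_codim_axis[OF F] puiseux_codim_axis[OF G] puiseux_codim_axis[OF H]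
    unfolding f_def g_def h_def by blast
qed

text \<open>The version for two branches: distances must be positive also in families without a
  third branch.\<close>

theorem codim_positive:
  assumes irr: "Factorial_Ring.irreducible F" "Factorial_Ring.irreducible G"
    and axis: "\<exists>j. nth2 F 0 j \<noteq> 0" "\<exists>j. nth2 G 0 j \<noteq> 0"
    and distinct: "\<And>w. w dvd 1 \<Longrightarrow> F \<noteq> w * G"
  shows "\<exists>f x. has_codim (ideal2 (emb var1) F) f \<and> has_codim (ideal2 F G) x \<and> f > 0 \<and> x > 0"
proof -
  obtain N1 a1 where 1: "puiseux_param N1 a1 F" using puiseux_param_exists[OF irr(1) axis(1)] by blast
  obtain N2 b2 where 2: "puiseux_param N2 b2 G" using puiseux_param_exists[OF irr(2) axis(2)] by blast
  obtain N a b where F: "puiseux_param N a F" and G: "puiseux_param N b G"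
    using puiseux_param_common[OF 1 2 2] .
  have N: "N > 0" and zero: "nth1 a 0 = 0" "nth1 b 0 = 0"
    using F G by (auto simp: puiseux_param_def)
  have disj: "b \<notin> orbit N a" using puiseux_param_associated[OF F G] distinct by blast
  obtain x where x: "has_codim (ideal2 F G) x"
    "N * N * x = card (orbit N a) * card (orbit N b) * contact_sum N a b"
    using puiseux_codim[OF F G disj] by blast
  have "card (orbit N a) > 0" "card (orbit N b) > 0"
    using finite_orbit[OF N] orbit_self by (auto simp: card_gt_0_iff)
  moreover from this have "x > 0" using x(2) contact_sum_pos[OF N zero disj] by (auto intro!: Nat.gr0I)
  ultimately show ?thesis using x(1) puiseux_codim_axis[OF F] by blast
qed

section \<open>Expansions of analytic functions\<close>

no_notation Infinite_Set_Sum.abs_summable_on (infix \<open>abs'_summable'_on\<close> 50)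

definition expands :: "(nat \<Rightarrow> nat \<Rightarrow> complex) \<Rightarrow> complex \<Rightarrow> complex \<Rightarrow> complex \<Rightarrow> bool" where
  "expands a x y v \<longleftrightarrow> ((\<lambda>(i, j). a i j * x ^ i * y ^ j) has_sum v) UNIV"

lemma has_expansion_iff:
  "has_expansion s \<phi> f a \<longleftrightarrow> (\<forall>\<^sub>F p in nhds s. expands a (fst (\<phi> p)) (snd (\<phi> p)) (f p))"
  by (simp add: has_expansion_def expands_def)

lemma eventually_nhds_zero_prod:
  fixes P :: "complex \<Rightarrow> complex \<Rightarrow> bool"
  shows "(\<forall>\<^sub>F q in nhds (0, 0). P (fst q) (snd q)) \<longleftrightarrow>
    (\<exists>r>0. \<forall>x y. norm x < r \<longrightarrow> norm y < r \<longrightarrow> P x y)"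
proof
  assume "\<forall>\<^sub>F q in nhds (0, 0). P (fst q) (snd q)"
  then obtain d where d: "d > 0" "\<And>q. dist q (0, 0) < d \<Longrightarrow> P (fst q) (snd q)"
    unfolding eventually_nhds_metric by blast
  have "P x y" if "norm x < d / 2" "norm y < d / 2" for x y
  proof -
    have "dist (x, y) (0, 0) \<le> norm x + norm y"
      using norm_Pair_le[of x y] by (simp add: dist_norm)
    then show ?thesis using that d(2)[of "(x, y)"] by simp
  qed
  then show "\<exists>r>0. \<forall>x y. norm x < r \<longrightarrow> norm y < r \<longrightarrow> P x y"
    using d(1) by (intro exI[of _ "d / 2"]) auto
next
  assume "\<exists>r>0. \<forall>x y. norm x < r \<longrightarrow> norm y < r \<longrightarrow> P x y"
  then obtain r where r: "r > 0" "\<And>x y. norm x < r \<Longrightarrow> norm y < r \<Longrightarrow> P x y" by blast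
  show "\<forall>\<^sub>F q in nhds (0, 0). P (fst q) (snd q)"
    unfolding eventually_nhds_metric
  proof (intro exI[of _ r] conjI allI impI)
    fix q :: "complex \<times> complex"
    assume q: "dist q (0, 0) < r"
    have "norm (fst q) \<le> norm q" "norm (snd q) \<le> norm q"
      using norm_fst_le[of "fst q" "snd q"] norm_snd_le[of "snd q" "fst q"] by simp_all
    moreover have "norm q < r" using q by (simp add: dist_norm flip: zero_prod_def)
    ultimately show "P (fst q) (snd q)" using r(2)[of "fst q" "snd q"] by linarith
  qed (rule r(1))
qed

lemma abs_summable_exhaustion:
  fixes f :: "'a \<Rightarrow> complex"
  assumes "\<And>F. finite F \<Longrightarrow> \<exists>n. F \<subseteq> B n" "\<And>n. finite (B n)" "\<And>n. (\<Sum>k\<in>B n. norm (f k)) \<le> M"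
  shows "f abs_summable_on UNIV"
  unfolding abs_summable_iff_bdd_above
proof (rule bdd_aboveI2)
  fix F :: "'a set" assume "F \<in> {F. F \<subseteq> UNIV \<and> finite F}"
  then obtain n where "F \<subseteq> B n" using assms(1) by blast
  then have "(\<Sum>k\<in>F. norm (f k)) \<le> (\<Sum>k\<in>B n. norm (f k))"
    using assms(2) by (intro sum_mono2) auto
  with assms(3)[of n] show "(\<Sum>k\<in>F. norm (f k)) \<le> M" by linarith
qed

lemma finite_subset_box: "finite F \<Longrightarrow> \<exists>n. F \<subseteq> {..<n} \<times> {..<(n::nat)}"
proof -
  assume "finite F"
  then have "finite (fst ` F \<union> snd ` F)" by simp
  then obtain n where "\<forall>k\<in>fst ` F \<union> snd ` F. k < n" unfolding finite_nat_set_iff_bounded by blast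
  then show ?thesis by (intro exI[of _ n]) force
qed

lemma finite_subset_box2:
  "finite F \<Longrightarrow> \<exists>n. F \<subseteq> ({..<n} \<times> {..<n}) \<times> ({..<n} \<times> {..<(n::nat)})"
proof -
  assume F: "finite F"
  obtain m where m: "fst ` F \<subseteq> {..<m} \<times> {..<m}" using finite_subset_box[of "fst ` F"] F by blast
  obtain k where k: "snd ` F \<subseteq> {..<k} \<times> {..<k}" using finite_subset_box[of "snd ` F"] F by blast
  show ?thesis
  proof (intro exI[of _ "max m k"] subsetI)
    fix p assume p: "p \<in> F"
    have "fst p \<in> {..<m} \<times> {..<m}" "snd p \<in> {..<k} \<times> {..<k}" using m k p by blast+
    then show "p \<in> ({..<max m k} \<times> {..<max m k}) \<times> ({..<max m k} \<times> {..<max m k})"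
      by (auto simp: mem_Times_iff)
  qed
qed

lemma double_geometric_bound:
  fixes t u :: real
  assumes "0 \<le> t" "t \<le> 1 / 2" "0 \<le> u" "u \<le> 1 / 2" "C \<ge> 0"
  shows "(\<Sum>(i, j)\<in>{..<n} \<times> {..<n}. C * t ^ i * u ^ j) \<le> 4 * C"
proof -
  have geo: "(\<Sum>i<n. t ^ i) \<le> 2" if "0 \<le> t" "t \<le> 1 / 2" for t :: real
  proof -
    have "(\<Sum>i<n. t ^ i) \<le> (\<Sum>i<n. (1 / 2) ^ i)" using that by (intro sum_mono power_mono) auto
    also have "\<dots> \<le> 2" by (rule sum_half_powers)
    finally show ?thesis .
  qed
  have "(\<Sum>(i, j)\<in>{..<n} \<times> {..<n}. C * t ^ i * u ^ j) = C * (\<Sum>(i, j)\<in>{..<n} \<times> {..<n}. t ^ i * u ^ j)"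
    by (simp add: sum_distrib_left case_prod_unfold mult.assoc)
  also have "\<dots> = C * ((\<Sum>i<n. t ^ i) * (\<Sum>j<n. u ^ j))"
    unfolding sum_product sum.cartesian_product ..
  also have "\<dots> \<le> C * (2 * 2)"
    using geo[of t] geo[of u] assms by (intro mult_left_mono mult_mono) (auto intro!: sum_nonneg)
  finally show ?thesis by simp
qed

lemma expands_abs_summable:
  assumes F: "\<And>i j. norm (nth2 F i j) \<le> C * R ^ (i + j)" "C > 0" "R > 0"
    and xy: "R * norm x \<le> 1 / 2" "R * norm y \<le> 1 / 2"
  shows "(\<lambda>(i, j). nth2 F i j * x ^ i * y ^ j) abs_summable_on UNIV"
proof (rule abs_summable_exhaustion[OF finite_subset_box])
  fix n
  have "(\<Sum>k\<in>{..<n} \<times> {..<n}. norm (case k of (i, j) \<Rightarrow> nth2 F i j * x ^ i * y ^ j))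
      \<le> (\<Sum>(i, j)\<in>{..<n} \<times> {..<n}. C * (R * norm x) ^ i * (R * norm y) ^ j)"
  proof (rule sum_mono, clarify)
    fix i j
    have "norm (nth2 F i j * x ^ i * y ^ j) \<le> (C * R ^ (i + j)) * norm x ^ i * norm y ^ j"
      unfolding norm_mult norm_power using F by (intro mult_right_mono) auto
    then show "norm (nth2 F i j * x ^ i * y ^ j) \<le> C * (R * norm x) ^ i * (R * norm y) ^ j"
      by (simp add: power_add power_mult_distrib mult_ac)
  qed
  also have "\<dots> \<le> 4 * C" using F xy by (intro double_geometric_bound) auto
  finally show "(\<Sum>k\<in>{..<n} \<times> {..<n}. norm (case k of (i, j) \<Rightarrow> nth2 F i j * x ^ i * y ^ j)) \<le> 4 * C" .
qed auto

lemma cser2_bound: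
  obtains C R where "C > 0" "R \<ge> 1" "\<And>i j. norm (nth2 F i j) \<le> C * R ^ (i + j)"
  using Rep_cser2[of F] unfolding mem_Collect_eq conv2_def nth2.rep_eq by auto

lemma cser_bound:
  obtains C R where "C > 0" "R \<ge> 1" "\<And>i. norm (nth1 f i) \<le> C * R ^ i"
  using Rep_cser[of f] unfolding mem_Collect_eq conv1_def nth1.rep_eq by auto

lemma expands_summable_near_0:
  "\<exists>r>0. \<forall>x y. norm x < r \<longrightarrow> norm y < r \<longrightarrow> (\<lambda>(i, j). nth2 F i j * x ^ i * y ^ j) abs_summable_on UNIV"
proof -
  obtain C R where CR: "C > 0" "R \<ge> 1" "\<And>i j. norm (nth2 F i j) \<le> C * R ^ (i + j)"
    using cser2_bound[of F] by blast
  have "R * norm x \<le> 1 / 2" if "norm x < 1 / (2 * R)" for x :: complex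
  proof -
    have "R * norm x \<le> R * (1 / (2 * R))" using that CR by (intro mult_left_mono) auto
    then show ?thesis using CR by simp
  qed
  then show ?thesis
    using CR by (intro exI[of _ "1 / (2 * R)"] conjI allI impI expands_abs_summable[OF CR(3)]) auto
qed

text \<open>\<open>infsum\<close> has the default value 0 where the series is not summable; near the
  origin it always is, and only germs matter.\<close>

definition val2 :: "cser2 \<Rightarrow> complex \<Rightarrow> complex \<Rightarrow> complex" where
  "val2 F x y = infsum (\<lambda>(i, j). nth2 F i j * x ^ i * y ^ j) UNIV"

lemma expands_unique: "expands a x y v \<Longrightarrow> expands a x y w \<Longrightarrow> v = w"
  unfolding expands_def by (rule has_sum_unique)

lemma expands_val2:
  assumes "(\<lambda>(i, j). nth2 F i j * x ^ i * y ^ j) abs_summable_on UNIV"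
  shows "expands (nth2 F) x y (val2 F x y)"
  unfolding expands_def val2_def using abs_summable_summable[OF assms] by simp

text \<open>The sum at the single point (r, r) is absolute, so all its terms are bounded, and this
  is the Cauchy estimate of \<open>conv2\<close>. It makes every expansion in the sense of the
  definitions a convergent series.\<close>

lemma coefficient_bound:
  assumes "expands a (of_real r) (of_real r) v" "r > 0"
  shows "\<exists>F. a = nth2 F"
proof -
  define f where "f = (\<lambda>(i, j). a i j * of_real r ^ i * of_real r ^ j)"
  have "f summable_on UNIV" using assms(1) unfolding expands_def f_def by (rule has_sum_imp_summable)
  then have abs: "f abs_summable_on UNIV" by (simp add: summable_on_iff_abs_summable_on_complex)
  define M where "M = infsum (\<lambda>p. norm (f p)) UNIV"
  have bound: "norm (a i j) \<le> M * (1 / r) ^ i * (1 / r) ^ j" for i j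
  proof -
    have "(\<Sum>p\<in>{(i, j)}. norm (f p)) \<le> M"
      unfolding M_def by (rule finite_sum_le_infsum[OF abs]) auto
    then have "norm (a i j) * r ^ i * r ^ j \<le> M"
      using assms(2) by (simp add: f_def norm_mult norm_power)
    then show ?thesis using assms(2) by (simp add: field_simps)
  qed
  define G where "G = Abs_fps (\<lambda>i. Abs_fps (a i))"
  have "conv2 G" by (rule conv2I[of _ M "1 / r" "1 / r"]) (use bound assms(2) in \<open>auto simp: G_def\<close>)
  then have "nth2 (Abs_cser2 G) = a"
    by (intro ext) (simp add: nth2.rep_eq Abs_cser2_inverse G_def)
  then show ?thesis by metis
qed

text \<open>The fibres of the bidegree may be infinite, so the new coefficients are infinite sums; the
  reference point ensures that they converge.\<close>

lemma expands_regroup: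
  fixes c :: "'k \<Rightarrow> complex" and d e :: "'k \<Rightarrow> nat"
  assumes ref: "(\<lambda>k. c k * xr ^ d k * yr ^ e k) summable_on UNIV" "xr \<noteq> 0" "yr \<noteq> 0"
    and sum: "((\<lambda>k. c k * x ^ d k * y ^ e k) has_sum v) UNIV"
  shows "expands (\<lambda>n m. infsum c {k. d k = n \<and> e k = m}) x y v"
proof -
  define fib where "fib = (\<lambda>q. {k. d k = fst q \<and> e k = snd q})"
  have bij: "bij_betw (\<lambda>k. ((d k, e k), k)) UNIV (Sigma UNIV fib)"
    by (rule bij_betw_byWitness[where f' = snd]) (auto simp: fib_def)
  have "((\<lambda>(q, k). c k * x ^ d k * y ^ e k) has_sum v) (Sigma UNIV fib)"
    using has_sum_reindex_bij_betw[OF bij, of "\<lambda>(q, k). c k * x ^ d k * y ^ e k" v] sum by simp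
  moreover have "((\<lambda>k. case (q, k) of (q, k) \<Rightarrow> c k * x ^ d k * y ^ e k) has_sum
      infsum c (fib q) * x ^ fst q * y ^ snd q) (fib q)" for q
  proof -
    have "(\<lambda>k. c k * xr ^ d k * yr ^ e k) summable_on fib q"
      using ref(1) by (rule summable_on_subset) simp
    then have "(\<lambda>k. c k * (xr ^ fst q * yr ^ snd q)) summable_on fib q"
      by (rule summable_on_cong[THEN iffD1, rotated]) (auto simp: fib_def mult.assoc)
    then have "c summable_on fib q" using ref(2,3) by (simp add: summable_on_cmult_left')
    then have "(c has_sum infsum c (fib q)) (fib q)" by simp
    then have "((\<lambda>k. c k * (x ^ fst q * y ^ snd q)) has_sum infsum c (fib q) * (x ^ fst q * y ^ snd q)) (fib q)"
      by (rule has_sum_cmult_left)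
    then show ?thesis
      unfolding mult.assoc by (rule has_sum_cong[THEN iffD1, rotated]) (auto simp: fib_def)
  qed
  ultimately have "((\<lambda>q. infsum c (fib q) * x ^ fst q * y ^ snd q) has_sum v) UNIV"
    by (rule has_sum_SigmaD)
  then show ?thesis unfolding expands_def fib_def by (simp add: case_prod_unfold)
qed

lemma expands_add: "expands a x y v \<Longrightarrow> expands b x y w \<Longrightarrow> expands (\<lambda>i j. a i j + b i j) x y (v + w)"
  unfolding expands_def by (drule (1) has_sum_add) (simp add: case_prod_unfold algebra_simps)

lemma expands_swap: "expands (\<lambda>i j. a j i) x y v \<longleftrightarrow> expands a y x v"
proof -
  have "expands a y x v \<longleftrightarrow> ((\<lambda>(i, j). a i j * y ^ i * x ^ j) has_sum v) (UNIV \<times> UNIV)"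
    by (simp add: expands_def)
  also have "\<dots> \<longleftrightarrow> ((\<lambda>(i, j). a j i * y ^ j * x ^ i) has_sum v) (UNIV \<times> UNIV)"
    by (subst has_sum_swap) (simp add: case_prod_unfold)
  finally show ?thesis by (simp add: expands_def mult_ac)
qed

lemma product_abs_summable:
  fixes f :: "nat \<times> nat \<Rightarrow> complex" and g :: "nat \<times> nat \<Rightarrow> complex"
  assumes "f abs_summable_on UNIV" "g abs_summable_on UNIV"
  shows "(\<lambda>(p, q). f p * g q) abs_summable_on UNIV"
proof (rule abs_summable_exhaustion[OF finite_subset_box2])
  fix n :: nat
  define B where "B = {..<n} \<times> {..<n}"
  have "(\<Sum>k\<in>B \<times> B. norm (case k of (p, q) \<Rightarrow> f p * g q)) = (\<Sum>p\<in>B. norm (f p)) * (\<Sum>q\<in>B. norm (g q))"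
    by (simp add: sum_product case_prod_unfold norm_mult sum.cartesian_product)
  also have "\<dots> \<le> infsum (\<lambda>p. norm (f p)) UNIV * infsum (\<lambda>q. norm (g q)) UNIV"
    using assms by (intro mult_mono finite_sum_le_infsum sum_nonneg infsum_nonneg) (auto simp: B_def)
  finally show "(\<Sum>k\<in>({..<n} \<times> {..<n}) \<times> ({..<n} \<times> {..<n}). norm (case k of (p, q) \<Rightarrow> f p * g q))
    \<le> infsum (\<lambda>p. norm (f p)) UNIV * infsum (\<lambda>q. norm (g q)) UNIV" unfolding B_def .
qed auto

lemma product_has_sum:
  fixes f :: "nat \<times> nat \<Rightarrow> complex" and g :: "nat \<times> nat \<Rightarrow> complex"
  assumes "f abs_summable_on UNIV" "g abs_summable_on UNIV" "(f has_sum v) UNIV" "(g has_sum w) UNIV"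
  shows "((\<lambda>(p, q). f p * g q) has_sum (v * w)) UNIV"
proof -
  have "((\<lambda>(p, q). f p * g q) has_sum (v * w)) (Sigma UNIV (\<lambda>_. UNIV))"
  proof (rule has_sum_SigmaI)
    show "((\<lambda>q. case (p, q) of (p, q) \<Rightarrow> f p * g q) has_sum f p * w) UNIV" for p
      using has_sum_cmult_right[OF assms(4)] by simp
    show "((\<lambda>p. f p * w) has_sum v * w) UNIV" by (rule has_sum_cmult_left[OF assms(3)])
    show "(\<lambda>(p, q). f p * g q) summable_on Sigma UNIV (\<lambda>_. UNIV)"
      using abs_summable_summable[OF product_abs_summable[OF assms(1,2)]] by simp
  qed
  then show ?thesis by simp
qed

lemma expands_mult:
  "\<exists>r>0. \<forall>x y v w. norm x < r \<longrightarrow> norm y < r \<longrightarrow> expands (nth2 F) x y v \<longrightarrow> expands (nth2 G) x y w \<longrightarrow>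
     expands (nth2 (F * G)) x y (v * w)"
proof -
  obtain r1 where r1: "r1 > 0" "\<And>x y. norm x < r1 \<Longrightarrow> norm y < r1 \<Longrightarrow>
      (\<lambda>(i, j). nth2 F i j * x ^ i * y ^ j) abs_summable_on UNIV"
    using expands_summable_near_0[of F] by blast
  obtain r2 where r2: "r2 > 0" "\<And>x y. norm x < r2 \<Longrightarrow> norm y < r2 \<Longrightarrow>
      (\<lambda>(i, j). nth2 G i j * x ^ i * y ^ j) abs_summable_on UNIV"
    using expands_summable_near_0[of G] by blast
  define r where "r = min r1 r2"
  define c where "c = (\<lambda>p. nth2 F (fst (fst p)) (snd (fst p)) * nth2 G (fst (snd p)) (snd (snd p)))"
  define d where "d = (\<lambda>p :: (nat \<times> nat) \<times> (nat \<times> nat). fst (fst p) + fst (snd p))"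
  define e where "e = (\<lambda>p :: (nat \<times> nat) \<times> (nat \<times> nat). snd (fst p) + snd (snd p))"
  have c_eq: "(\<lambda>p. c p * x ^ d p * y ^ e p)
      = (\<lambda>(p, q). (case p of (i, j) \<Rightarrow> nth2 F i j * x ^ i * y ^ j) * (case q of (i, j) \<Rightarrow> nth2 G i j * x ^ i * y ^ j))" for x y
    by (auto simp: c_def d_def e_def fun_eq_iff power_add mult_ac)
  \<comment> \<open>Here the fibres of the bidegree are finite, and their sums are the coefficients
    of the Cauchy product.\<close>
  have coeff: "infsum c {p. d p = n \<and> e p = m} = nth2 (F * G) n m" for n m
  proof -
    have fin: "finite {p. d p = n \<and> e p = m}"
      by (rule finite_subset[of _ "({..n} \<times> {..m}) \<times> ({..n} \<times> {..m})"]) (auto simp: d_def e_def)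
    have "infsum c {p. d p = n \<and> e p = m} = sum c {p. d p = n \<and> e p = m}"
      using fin by simp
    also have "\<dots> = (\<Sum>(a, b)\<in>{0..n} \<times> {0..m}. nth2 F a b * nth2 G (n - a) (m - b))"
      by (rule sum.reindex_bij_witness[of _ "\<lambda>(a, b). ((a, b), (n - a, m - b))" fst])
        (auto simp: d_def e_def c_def)
    also have "\<dots> = nth2 (F * G) n m" by (simp add: nth2_mult sum.cartesian_product)
    finally show ?thesis .
  qed
  have "expands (nth2 (F * G)) x y (v * w)"
    if xy: "norm x < r" "norm y < r" and v: "expands (nth2 F) x y v" and w: "expands (nth2 G) x y w" for x y v w
  proof -
    \<comment> \<open>Reference point for the regrouping: any point of the polydisc with nonzero
      coordinates would do.\<close>
    define xr :: complex where "xr = of_real (r / 2)"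
    have xr: "norm xr < r" "xr \<noteq> 0" using r1(1) r2(1) by (auto simp: xr_def r_def)
    have "expands (\<lambda>n m. infsum c {p. d p = n \<and> e p = m}) x y (v * w)"
    proof (rule expands_regroup[where xr = xr and yr = xr and c = c and d = d and e = e])
      show "(\<lambda>p. c p * xr ^ d p * xr ^ e p) summable_on UNIV"
        unfolding c_eq
        by (rule abs_summable_summable[OF product_abs_summable[OF r1(2) r2(2)]])
          (use xr in \<open>auto simp: r_def\<close>)
      show "((\<lambda>p. c p * x ^ d p * y ^ e p) has_sum v * w) UNIV"
        unfolding c_eq
        by (rule product_has_sum[OF r1(2) r2(2) v[unfolded expands_def] w[unfolded expands_def]])
          (use xy in \<open>auto simp: r_def\<close>)
    qed (use xr in auto)
    then show ?thesis unfolding coeff .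
  qed
  then show ?thesis using r1(1) r2(1) by (intro exI[of _ r]) (auto simp: r_def)
qed

section \<open>Uniqueness of expansions\<close>

text \<open>Through \<open>eval_fps\<close>, which provides continuity, compatibility with powers
  and the identity theorem in one variable.\<close>

definition val1 :: "cser \<Rightarrow> complex \<Rightarrow> complex" where
  "val1 f x = eval_fps (Rep_cser f) x"

lemma bounded_sums_has_sum:
  assumes "bounded_sums s (Rep_cser f) M" "norm x \<le> s"
  shows "((\<lambda>i. nth1 f i * x ^ i) has_sum val1 f x) UNIV"
proof -
  have "(\<lambda>i. nth1 f i * x ^ i) abs_summable_on UNIV"
  proof (rule abs_summable_exhaustion[where B = lessThan])
    show "\<exists>n. F \<subseteq> {..<n}" if "finite F" for F :: "nat set"
      using that unfolding finite_nat_set_iff_bounded by blast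
    fix n
    have "(\<Sum>i<n. norm (nth1 f i * x ^ i)) \<le> (\<Sum>i<n. norm (Rep_cser f $ i) * s ^ i)"
      unfolding norm_mult norm_power nth1.rep_eq
      using assms(2) by (intro sum_mono mult_left_mono power_mono) auto
    also have "\<dots> \<le> M" using assms(1) unfolding bounded_sums_def by blast
    finally show "(\<Sum>i<n. norm (nth1 f i * x ^ i)) \<le> M" .
  qed auto
  then have "(\<lambda>i. nth1 f i * x ^ i) summable_on UNIV" by (rule abs_summable_summable)
  then have "((\<lambda>i. nth1 f i * x ^ i) has_sum infsum (\<lambda>i. nth1 f i * x ^ i) UNIV) UNIV" by simp
  moreover from this have "infsum (\<lambda>i. nth1 f i * x ^ i) UNIV = val1 f x"
    using sums_unique[OF has_sum_imp_sums] by (simp add: val1_def eval_fps_def nth1.rep_eq)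
  ultimately show ?thesis by simp
qed

lemma nth1_has_sum:
  assumes "\<And>i. norm (nth1 f i) \<le> C * R ^ i" "C > 0" "R > 0" "R * norm x \<le> 1 / 2"
  shows "((\<lambda>i. nth1 f i * x ^ i) has_sum val1 f x) UNIV"
proof (rule bounded_sums_has_sum)
  show "bounded_sums (1 / (2 * R)) (Rep_cser f) (2 * C)"
    using assms by (intro bounded_sums_geometric[of _ C R]) (auto simp: nth1.rep_eq)
  show "norm x \<le> 1 / (2 * R)" using assms(3,4) by (simp add: field_simps)
qed

lemma fps_conv_radius_cser:
  assumes "\<And>i. norm (nth1 f i) \<le> C * R ^ i" "C > 0" "R > 0"
  shows "fps_conv_radius (Rep_cser f) \<ge> ereal (1 / (2 * R))"
proof -
  define z :: complex where "z = of_real (1 / (2 * R))"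
  have "summable (\<lambda>i. Rep_cser f $ i * z ^ i)"
    using has_sum_imp_sums[OF nth1_has_sum[OF assms, of z]] assms(3)
    by (auto simp: z_def sums_iff nth1.rep_eq norm_mult norm_divide)
  then have "conv_radius (fps_nth (Rep_cser f)) \<ge> norm z" by (rule conv_radius_geI)
  then show ?thesis using assms(3) by (simp add: z_def fps_conv_radius_def norm_mult norm_divide)
qed

lemma fps_conv_radius_cser_pos: "fps_conv_radius (Rep_cser f) > 0"
proof -
  obtain C R where "C > 0" "R \<ge> 1" "\<And>i. norm (nth1 f i) \<le> C * R ^ i" using cser_bound[of f] by blast
  then have "fps_conv_radius (Rep_cser f) \<ge> ereal (1 / (2 * R))" "ereal (1 / (2 * R)) > 0"
    using fps_conv_radius_cser[of f C R] by auto
  then show ?thesis by (meson less_le_trans)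
qed

lemma val1_eq_0_imp:
  assumes "r > 0" "\<And>x. norm x < r \<Longrightarrow> val1 f x = 0"
  shows "f = 0"
proof -
  have "\<forall>\<^sub>F x in nhds 0. eval_fps (Rep_cser f) x = eval_fps 0 x"
    unfolding eventually_nhds_metric using assms by (auto simp: val1_def intro!: exI[of _ r])
  then have "Rep_cser f = 0" using fps_conv_radius_cser_pos by (intro eval_fps_eqD) auto
  then show ?thesis by (metis Rep_cser_inject zero_cser.rep_eq)
qed

text \<open>The identity theorem, one variable at a time. For fixed x the sum is a power series in y
  that vanishes near 0, so the value at x of each column is 0; then each column vanishes as a series
  in x.\<close>

lemma expands_zero_imp:
  assumes "r > 0" "\<And>x y. norm x < r \<Longrightarrow> norm y < r \<Longrightarrow> expands (nth2 H) x y 0"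
  shows "H = 0"
proof -
  obtain C R where CR: "C > 0" "R \<ge> 1" "\<And>i j. norm (nth2 H i j) \<le> C * R ^ (i + j)"
    using cser2_bound[of H] by blast
  define \<rho> where "\<rho> = min r (1 / (2 * R))"
  have \<rho>: "\<rho> > 0" using assms(1) CR by (auto simp: \<rho>_def)
  have small: "R * norm x \<le> 1 / 2" if "norm x < \<rho>" for x :: complex
  proof -
    have "R * norm x \<le> R * (1 / (2 * R))" using that CR by (intro mult_left_mono) (auto simp: \<rho>_def)
    then show ?thesis using CR by simp
  qed
  have col: "((\<lambda>j. val1 (column H j) x * y ^ j) has_sum 0) UNIV" if x: "norm x < \<rho>" and y: "norm y < \<rho>" for x y
  proof -
    have "((\<lambda>(i, j). nth2 H i j * x ^ i * y ^ j) has_sum 0) (UNIV \<times> UNIV)"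
      using assms(2)[of x y] x y by (simp add: expands_def \<rho>_def)
    then have "((\<lambda>(j, i). nth2 H i j * x ^ i * y ^ j) has_sum 0) (UNIV \<times> UNIV)"
      by (subst (asm) has_sum_swap) (simp add: case_prod_unfold)
    moreover have "((\<lambda>i. case (j, i) of (j, i) \<Rightarrow> nth2 H i j * x ^ i * y ^ j) has_sum val1 (column H j) x * y ^ j) UNIV" for j
    proof -
      have "((\<lambda>i. nth1 (column H j) i * x ^ i) has_sum val1 (column H j) x) UNIV"
      proof (rule nth1_has_sum)
        show "norm (nth1 (column H j) i) \<le> (C * R ^ j) * R ^ i" for i
          using CR(3)[of i j] by (simp add: power_add mult_ac)
      qed (use CR small[OF x] in auto)
      from has_sum_cmult_left[OF this, of "y ^ j"] show ?thesis by simp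
    qed
    ultimately show ?thesis by (rule has_sum_SigmaD)
  qed
  have zero: "val1 (column H j) x = 0" if x: "norm x < \<rho>" for x j
  proof -
    define g where "g = Abs_fps (\<lambda>j. val1 (column H j) x)"
    have sums: "(\<lambda>j. fps_nth g j * y ^ j) sums 0" if "norm y < \<rho>" for y
      using has_sum_imp_sums[OF col[OF x that]] by (simp add: g_def)
    define z :: complex where "z = of_real (\<rho> / 2)"
    have z: "norm z < \<rho>" "norm z > 0" using \<rho> by (auto simp: z_def)
    have "conv_radius (fps_nth g) \<ge> norm z"
      using sums[OF z(1)] by (intro conv_radius_geI) (auto simp: sums_iff)
    then have "fps_conv_radius g > 0" using z(2) unfolding fps_conv_radius_def
      by (metis ereal_less(2) less_le_trans)
    moreover have "\<forall>\<^sub>F y in nhds 0. eval_fps g y = eval_fps 0 y"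
      unfolding eventually_nhds_metric
      using \<rho> sums by (auto simp: eval_fps_def sums_iff intro!: exI[of _ \<rho>])
    ultimately have "g = 0" by (intro eval_fps_eqD) auto
    then show ?thesis by (metis fps_nth_Abs_fps fps_zero_nth g_def)
  qed
  have "column H j = 0" for j using val1_eq_0_imp[OF \<rho> zero] .
  then have "nth2 H i j = 0" for i j by (metis nth1_column nth1_simps(1))
  then show ?thesis by (intro cser2_eqI) simp
qed

text \<open>H minus x times its quotient by x is H(0, y), read as a series in both variables. It
  does not depend on x, so vanishing on the axis is vanishing on a polydisc.\<close>

lemma axis_zero_imp:
  assumes "r > 0" "\<And>y. norm y < r \<Longrightarrow> expands (nth2 H) 0 y 0"
  shows "nth2 H 0 j = 0"
proof -
  define H' where "H' = H - emb var1 * contract2 1 1 H"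
  have H': "nth2 H' i j = (if i = 0 then nth2 H 0 j else 0)" for i j
    using nth2_emb_var1_power_mult[of 1 "contract2 1 1 H" i j] by (auto simp: H'_def)
  have "expands (nth2 H') x y 0" if "norm y < r" for x y
  proof -
    have "((\<lambda>(i, j). nth2 H i j * 0 ^ i * y ^ j) has_sum 0) UNIV"
      using assms(2)[OF that] by (simp add: expands_def)
    then show ?thesis unfolding expands_def
      by (rule has_sum_cong[THEN iffD1, rotated]) (auto simp: H')
  qed
  then have "H' = 0" using expands_zero_imp[OF assms(1)] by blast
  then show ?thesis using H'[of 0 j] by simp
qed

section \<open>Shearing the coordinates\<close>

lemma bounded_sums_power:
  assumes "bounded_sums s a M" "s > 0"
  shows "bounded_sums s (a ^ n) (M ^ n)"
proof (induction n)
  case 0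
  have "(\<Sum>k<n. norm ((1 :: complex fps) $ k) * s ^ k) = (\<Sum>k<n. if k = 0 then 1 else 0)" for n
    by (intro sum.cong) auto
  then have "(\<Sum>k<n. norm ((1 :: complex fps) $ k) * s ^ k) \<le> 1" for n by simp
  then show ?case by (simp add: bounded_sums_def)
next
  case (Suc n)
  then show ?case using bounded_sums_mult[OF assms(1) Suc assms(2)] by simp
qed

lemma Rep_cser_power: "Rep_cser (f ^ n) = Rep_cser f ^ n"
  by (induction n) (simp_all add: one_cser.rep_eq times_cser.rep_eq)

lemma sum_binomial_bound:
  fixes u A :: real
  assumes "u \<ge> 0" "A \<ge> 0"
  shows "(\<Sum>k<n. real (j choose k) * u ^ k * A ^ (j - k)) \<le> (u + A) ^ j"
proof -
  have "(\<Sum>k<n. real (j choose k) * u ^ k * A ^ (j - k)) \<le> (\<Sum>k\<in>{..<n} \<union> {..j}. real (j choose k) * u ^ k * A ^ (j - k))"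
    using assms by (intro sum_mono2) auto
  also have "\<dots> = (\<Sum>k\<le>j. real (j choose k) * u ^ k * A ^ (j - k))"
    by (rule sum.mono_neutral_right) auto
  also have "\<dots> = (u + A) ^ j" by (simp add: binomial_ring)
  finally show ?thesis .
qed

text \<open>The substitution y = u + l(x): each (u + l(x))^j is expanded by the binomial formula and
  each power of \<open>l\<close> as a series in x. The resulting fourfold sum converges absolutely
  on a polydisc and is regrouped by the exponents of x and u. The coefficients \<open>b\<close> do
  not depend on the point.\<close>

lemma expands_shear:
  assumes l0: "nth1 l 0 = 0"
  shows "\<exists>b. \<exists>r>0. \<forall>x u v. norm x < r \<longrightarrow> norm u < r \<longrightarrow> expands (nth2 F) x (u + val1 l x) v \<longrightarrow> expands b x u v"
proof -
  obtain C1 R1 where 1: "C1 > 0" "R1 \<ge> 1" "\<And>i j. norm (nth2 F i j) \<le> C1 * R1 ^ (i + j)"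
    using cser2_bound[of F] by blast
  obtain C2 R2 where 2: "C2 > 0" "R2 \<ge> 1" "\<And>i. norm (nth1 l i) \<le> C2 * R2 ^ i"
    using cser_bound[of l] by blast
  \<comment> \<open>The third entry makes the norm \<open>A\<close> of \<open>l\<close> on the disc
    of radius \<open>s\<close> at most 1 / (4 R1); such an \<open>s\<close> suits because l(0) = 0.
    Together with norm u < 1 / (4 R1) this keeps u + l(x) within 1 / (2 R1).\<close>
  define s where "s = min (1 / (2 * R1)) (min (1 / (2 * R2)) (1 / (8 * C2 * R2 * R1)))"
  have s: "s > 0" "s \<le> 1 / (2 * R1)" "s \<le> 1 / (2 * R2)" "s \<le> 1 / (8 * C2 * R2 * R1)"
    using 1 2 by (auto simp: s_def)
  define A where "A = s * (2 * (C2 * R2))"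
  have A: "A \<ge> 0" "R1 * A \<le> 1 / 4"
  proof -
    show "A \<ge> 0" using s 2 by (simp add: A_def)
    have "R1 * A = (2 * C2 * R2 * R1) * s" by (simp add: A_def)
    also have "\<dots> \<le> (2 * C2 * R2 * R1) * (1 / (8 * C2 * R2 * R1))"
      using s(4) 1 2 by (intro mult_left_mono) auto
    also have "\<dots> = 1 / 4" using 1 2 by (simp add: field_simps)
    finally show "R1 * A \<le> 1 / 4" .
  qed
  define L where "L = Rep_cser l"
  have L: "bounded_sums s L A"
  proof -
    have "L = fps_X * fps_shift 1 L"
      using l0 by (auto simp: L_def fps_eq_iff nth1.rep_eq)
    moreover have "bounded_sums s fps_X s"
      unfolding bounded_sums_def
    proof
      fix n
      have "(\<Sum>k<n. norm (fps_X $ k :: complex) * s ^ k) = (\<Sum>k<n. if k = 1 then s else 0)"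
        by (intro sum.cong) (auto simp: fps_X_def)
      also have "\<dots> \<le> s" using s(1) by simp
      finally show "(\<Sum>k<n. norm (fps_X $ k :: complex) * s ^ k) \<le> s" .
    qed
    moreover have "bounded_sums s (fps_shift 1 L) (2 * (C2 * R2))"
    proof (rule bounded_sums_geometric)
      show "norm (fps_shift 1 L $ j) \<le> (C2 * R2) * R2 ^ j" for j
        using 2(3)[of "Suc j"] by (simp add: L_def nth1.rep_eq mult_ac)
    qed (use 2 s in auto)
    ultimately show ?thesis unfolding A_def using bounded_sums_mult[OF _ _ s(1)] by metis
  qed
  define r where "r = min s (1 / (4 * R1))"
  have r: "r > 0" "r \<le> s" "r \<le> 1 / (4 * R1)" using s 1 by (auto simp: r_def)
  \<comment> \<open>Index ((i, j), (k, m)): the term x^i y^j of \<open>F\<close>, the power u^k in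
    the binomial formula, and x^m in the power j - k of \<open>l\<close>.\<close>
  define c where "c = (\<lambda>((i, j), (k, m)). nth2 F i j * of_nat (j choose k) * nth1 (l ^ (j - k)) m)"
  define d where "d = (\<lambda>((i, j :: nat), (k :: nat, m)). i + m :: nat)"
  define e where "e = (\<lambda>((i :: nat, j :: nat), (k, m :: nat)). k :: nat)"
  have abs: "(\<lambda>p. c p * x ^ d p * u ^ e p) abs_summable_on UNIV" if x: "norm x < r" and u: "norm u < r" for x u
  proof (rule abs_summable_exhaustion[OF finite_subset_box2])
    fix n :: nat
    define B where "B = {..<n} \<times> {..<n}"
    have "(\<Sum>p\<in>B \<times> B. norm (c p * x ^ d p * u ^ e p))
      = (\<Sum>(i, j)\<in>B. \<Sum>(k, m)\<in>B. norm (nth2 F i j) * norm x ^ i *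
          (real (j choose k) * norm u ^ k * (norm (nth1 (l ^ (j - k)) m) * norm x ^ m)))"
      by (simp add: sum.cartesian_product case_prod_unfold c_def d_def e_def norm_mult norm_power power_add mult_ac)
    also have "\<dots> \<le> (\<Sum>(i, j)\<in>B. C1 * (R1 * norm x) ^ i * (R1 * (norm u + A)) ^ j)"
    proof (rule sum_mono, clarify)
      fix i j
      have "(\<Sum>(k, m)\<in>B. norm (nth2 F i j) * norm x ^ i *
          (real (j choose k) * norm u ^ k * (norm (nth1 (l ^ (j - k)) m) * norm x ^ m)))
        = norm (nth2 F i j) * norm x ^ i *
          (\<Sum>k<n. real (j choose k) * norm u ^ k * (\<Sum>m<n. norm (nth1 (l ^ (j - k)) m) * norm x ^ m))"
        by (simp add: B_def sum_distrib_left mult_ac flip: sum.cartesian_product)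
      also have "\<dots> \<le> norm (nth2 F i j) * norm x ^ i *
          (\<Sum>k<n. real (j choose k) * norm u ^ k * A ^ (j - k))"
      proof (intro mult_left_mono sum_mono)
        fix k
        have "(\<Sum>m<n. norm (nth1 (l ^ (j - k)) m) * norm x ^ m) \<le> (\<Sum>m<n. norm ((L ^ (j - k)) $ m) * s ^ m)"
          using x r by (intro sum_mono mult_mono power_mono) (auto simp: nth1.rep_eq Rep_cser_power L_def)
        also have "\<dots> \<le> A ^ (j - k)" using bounded_sums_power[OF L s(1)] unfolding bounded_sums_def by blast
        finally show "(\<Sum>m<n. norm (nth1 (l ^ (j - k)) m) * norm x ^ m) \<le> A ^ (j - k)" .
      qed auto
      also have "\<dots> \<le> norm (nth2 F i j) * norm x ^ i * (norm u + A) ^ j"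
        using A by (intro mult_left_mono sum_binomial_bound) auto
      also have "\<dots> \<le> (C1 * R1 ^ (i + j)) * norm x ^ i * (norm u + A) ^ j"
        using 1 A by (intro mult_right_mono) auto
      also have "\<dots> = C1 * (R1 * norm x) ^ i * (R1 * (norm u + A)) ^ j"
        by (simp add: power_add power_mult_distrib mult_ac)
      finally show "(\<Sum>(k, m)\<in>B. norm (nth2 F i j) * norm x ^ i *
          (real (j choose k) * norm u ^ k * (norm (nth1 (l ^ (j - k)) m) * norm x ^ m)))
        \<le> C1 * (R1 * norm x) ^ i * (R1 * (norm u + A)) ^ j" .
    qed
    also have "\<dots> \<le> 4 * C1" unfolding B_def
    proof (rule double_geometric_bound)
      have "R1 * norm x \<le> R1 * (1 / (2 * R1))" using x r s 1 by (intro mult_left_mono) auto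
      then show "R1 * norm x \<le> 1 / 2" using 1 by simp
      have "R1 * norm u \<le> R1 * (1 / (4 * R1))" using u r s 1 by (intro mult_left_mono) auto
      then show "R1 * (norm u + A) \<le> 1 / 2" using 1 A by (simp add: distrib_left)
    qed (use 1 A in auto)
    finally show "(\<Sum>p\<in>({..<n} \<times> {..<n}) \<times> ({..<n} \<times> {..<n}). norm (c p * x ^ d p * u ^ e p)) \<le> 4 * C1"
      unfolding B_def .
  qed auto
  define b where "b = (\<lambda>n m. infsum c {p. d p = n \<and> e p = m})"
  have "expands b x u v" if x: "norm x < r" and u: "norm u < r" and v: "expands (nth2 F) x (u + val1 l x) v" for x u v
  proof -
    define xr :: complex where "xr = of_real (r / 2)"
    have xr: "norm xr < r" "xr \<noteq> 0" using r by (auto simp: xr_def)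
    have powl: "((\<lambda>m. nth1 (l ^ p) m * x ^ m) has_sum val1 l x ^ p) UNIV" for p
    proof -
      have "((\<lambda>m. nth1 (l ^ p) m * x ^ m) has_sum val1 (l ^ p) x) UNIV"
        by (rule bounded_sums_has_sum[where s = s and M = "A ^ p"])
          (use bounded_sums_power[OF L s(1)] x r in \<open>auto simp: Rep_cser_power L_def\<close>)
      also have "val1 (l ^ p) x = val1 l x ^ p"
      proof -
        have "ereal (norm x) < ereal (1 / (2 * R2))" using x r s by simp
        also have "\<dots> \<le> fps_conv_radius (Rep_cser l)"
          using fps_conv_radius_cser[OF 2(3)] 2 by simp
        finally show ?thesis unfolding val1_def Rep_cser_power by (rule eval_fps_power)
      qed
      finally show ?thesis .
    qed
    have "expands b x u v"
      unfolding b_def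
    proof (rule expands_regroup[where xr = xr and yr = xr and c = c and d = d and e = e])
      show "(\<lambda>p. c p * xr ^ d p * xr ^ e p) summable_on UNIV"
        by (rule abs_summable_summable[OF abs[OF xr(1) xr(1)]])
      define T where "T = (\<lambda>p. c p * x ^ d p * u ^ e p)"
      have Tsum: "T summable_on UNIV" unfolding T_def by (rule abs_summable_summable[OF abs[OF x u]])
      \<comment> \<open>Absolute convergence permits summation from the inside: over m to a power of
        l(x), over k to (u + l(x))^j, over (i, j) to the value.\<close>
      have "(T has_sum v) (Sigma UNIV (\<lambda>_. UNIV))"
      proof (rule has_sum_SigmaI)
        show "((\<lambda>q. case q of (i, j) \<Rightarrow> nth2 F i j * x ^ i * (u + val1 l x) ^ j) has_sum v) UNIV"
          using v by (simp add: expands_def)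
        show "T summable_on Sigma UNIV (\<lambda>_. UNIV)" using Tsum by simp
        fix q :: "nat \<times> nat"
        obtain i j where q: "q = (i, j)" by (cases q)
        have "((\<lambda>p. T (q, p)) has_sum nth2 F i j * x ^ i * (u + val1 l x) ^ j) (Sigma UNIV (\<lambda>_. UNIV))"
        proof (rule has_sum_SigmaI)
          show "((\<lambda>m. T (q, (k, m))) has_sum nth2 F i j * x ^ i * (of_nat (j choose k) * u ^ k * val1 l x ^ (j - k))) UNIV" for k
            using has_sum_cmult_right[OF powl[of "j - k"], of "nth2 F i j * x ^ i * (of_nat (j choose k) * u ^ k)"]
            by (simp add: T_def q c_def d_def e_def power_add mult_ac)
          have "((\<lambda>k. of_nat (j choose k) * u ^ k * val1 l x ^ (j - k)) has_sum (u + val1 l x) ^ j) UNIV"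
            by (rule has_sum_finite_neutralI[of "{..j}"]) (auto simp: binomial_ring)
          from has_sum_cmult_right[OF this, of "nth2 F i j * x ^ i"]
          show "((\<lambda>k. nth2 F i j * x ^ i * (of_nat (j choose k) * u ^ k * val1 l x ^ (j - k)))
              has_sum nth2 F i j * x ^ i * (u + val1 l x) ^ j) UNIV" by simp
          show "(\<lambda>p. T (q, p)) summable_on Sigma UNIV (\<lambda>_. UNIV)"
            using summable_on_SigmaD1[of "\<lambda>q p. T (q, p)" UNIV "\<lambda>_. UNIV" q] Tsum by simp
        qed
        then show "((\<lambda>p. T (q, p)) has_sum (case q of (i, j) \<Rightarrow> nth2 F i j * x ^ i * (u + val1 l x) ^ j)) UNIV"
          by (simp add: q)
      qed
      then show "((\<lambda>p. c p * x ^ d p * u ^ e p) has_sum v) UNIV" by (simp add: T_def)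
    qed (use xr in auto)
    then show ?thesis .
  qed
  then show ?thesis using r(1) by blast
qed

text \<open>A local homeomorphism at \<open>s\<close>, reduced to its effect on neighbourhood
  filters. Statements near \<open>s\<close> and statements near the origin are thereby exchanged,
  and compositions need no bookkeeping of domains.\<close>

definition chart :: "'a::topological_space \<Rightarrow> ('a \<Rightarrow> complex \<times> complex) \<Rightarrow> bool" where
  "chart s \<phi> \<longleftrightarrow> filtermap \<phi> (nhds s) = nhds (0, 0)"

lemma smooth_surface_germ_chart:
  assumes "smooth_surface_germ s \<phi>"
  shows "chart s \<phi>"
proof -
  obtain U V \<psi> where U: "open U" "s \<in> U" and V: "open V" and hom: "homeomorphism U V \<phi> \<psi>"
    and s: "\<phi> s = (0, 0)"
    using assms unfolding smooth_surface_germ_def by blast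
  have cont: "continuous_on U \<phi>" "continuous_on V \<psi>" "\<And>p. p \<in> U \<Longrightarrow> \<psi> (\<phi> p) = p"
    "\<And>q. q \<in> V \<Longrightarrow> \<phi> (\<psi> q) = q" "\<phi> ` U = V"
    using hom unfolding homeomorphism_def by auto
  have 0: "(0, 0) \<in> V" "\<psi> (0, 0) = s" using cont U s by (metis imageI)+
  have "filterlim \<phi> (nhds (0, 0)) (nhds s)"
    using cont(1) U s at_within_open[OF U(2,1)] tendsto_at_iff_tendsto_nhds[of \<phi> s]
    by (auto simp: continuous_on_def)
  moreover have "filterlim \<psi> (nhds s) (nhds (0, 0))"
    using cont(2) 0 at_within_open[OF 0(1) V] tendsto_at_iff_tendsto_nhds[of \<psi> "(0, 0)"]
    by (auto simp: continuous_on_def)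
  moreover have "\<forall>\<^sub>F q in nhds (0, 0). \<phi> (\<psi> q) = q"
    using V 0 cont(4) by (auto simp: eventually_nhds)
  ultimately have 1: "filtermap \<phi> (nhds s) \<le> nhds (0, 0)" and 2: "filtermap \<psi> (nhds (0, 0)) \<le> nhds s"
    and 3: "\<forall>\<^sub>F q in nhds (0, 0). \<phi> (\<psi> q) = q"
    by (auto simp: filterlim_def)
  \<comment> \<open>Continuity of \<phi> gives one inclusion of filters; the other comes from
    continuity of the inverse \<psi>.\<close>
  have "nhds (0, 0) = filtermap \<phi> (filtermap \<psi> (nhds (0, 0)))"
    unfolding filter_eq_iff eventually_filtermap
  proof
    fix P
    show "(\<forall>\<^sub>F q in nhds (0, 0). P q) \<longleftrightarrow> (\<forall>\<^sub>F q in nhds (0, 0). P (\<phi> (\<psi> q)))"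
      by (rule eventually_cong[OF 3]) simp
  qed
  also have "\<dots> \<le> filtermap \<phi> (nhds s)" by (rule filtermap_mono[OF 2])
  finally show ?thesis using 1 unfolding chart_def by (rule order.antisym[rotated])
qed

lemma chart_eventually:
  "chart s \<phi> \<Longrightarrow> (\<forall>\<^sub>F p in nhds s. P (\<phi> p)) \<longleftrightarrow> (\<forall>\<^sub>F q in nhds (0, 0). P q)"
  unfolding chart_def by (metis eventually_filtermap)

lemma chart_eventually2:
  assumes "chart s \<phi>"
  shows "(\<forall>\<^sub>F p in nhds s. P (fst (\<phi> p)) (snd (\<phi> p))) \<longleftrightarrow>
    (\<exists>r>0. \<forall>x y. norm x < r \<longrightarrow> norm y < r \<longrightarrow> P x y)"
  using chart_eventually[OF assms, of "\<lambda>q. P (fst q) (snd q)"] eventually_nhds_zero_prod[of P] by simp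

text \<open>If the image of \<open>s\<close> were another point, points near the origin would avoid
  it. Then no point near \<open>s\<close> could have the same image as \<open>s\<close>, not even
  \<open>s\<close>.\<close>

lemma chart_at:
  assumes "chart s \<phi>"
  shows "\<phi> s = (0, 0)"
proof (rule ccontr)
  assume "\<phi> s \<noteq> (0, 0)"
  then have "\<forall>\<^sub>F q in nhds (0, 0). q \<noteq> \<phi> s" using t1_space_nhds[of "(0, 0)" "\<phi> s"] by auto
  then have "\<forall>\<^sub>F p in nhds s. \<phi> p \<noteq> \<phi> s"
    using chart_eventually[OF assms, of "\<lambda>q. q \<noteq> \<phi> s"] by simp
  then show False by (auto dest: eventually_nhds_x_imp_x)
qed

section \<open>Functions near s and the convergent series representing them\<close>

definition represents ::
    "'a::topological_space \<Rightarrow> ('a \<Rightarrow> complex \<times> complex) \<Rightarrow> ('a \<Rightarrow> complex) \<Rightarrow> cser2 \<Rightarrow> bool" where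
  "represents s \<phi> f F \<longleftrightarrow> has_expansion s \<phi> f (nth2 F)"

lemma has_expansion_convergent:
  assumes "chart s \<phi>" "has_expansion s \<phi> f a"
  shows "\<exists>F. a = nth2 F"
proof -
  have "\<forall>\<^sub>F p in nhds s. \<exists>v. expands a (fst (\<phi> p)) (snd (\<phi> p)) v"
    using assms(2) unfolding has_expansion_iff by eventually_elim blast
  then obtain r where r: "r > 0" "\<And>x y. norm x < r \<Longrightarrow> norm y < r \<Longrightarrow> \<exists>v. expands a x y v"
    using chart_eventually2[OF assms(1), of "\<lambda>x y. \<exists>v. expands a x y v"] by auto
  have "\<exists>v. expands a (of_real (r / 2)) (of_real (r / 2)) v"
    by (rule r(2)) (use r(1) in \<open>auto simp: norm_divide\<close>)
  then show ?thesis using coefficient_bound[of a "r / 2"] r(1) by auto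
qed

lemma analytic_near_iff: "chart s \<phi> \<Longrightarrow> analytic_near s \<phi> f \<longleftrightarrow> (\<exists>F. represents s \<phi> f F)"
  unfolding analytic_near_def represents_def using has_expansion_convergent by metis

lemma represents_cong:
  assumes "\<forall>\<^sub>F p in nhds s. f p = g p" "represents s \<phi> f F"
  shows "represents s \<phi> g F"
  using assms(2,1) unfolding represents_def has_expansion_iff by eventually_elim simp

lemma represents_eventually_eq:
  assumes "represents s \<phi> f F" "represents s \<phi> g F"
  shows "\<forall>\<^sub>F p in nhds s. f p = g p"
  using assms unfolding represents_def has_expansion_iff
  by eventually_elim (rule expands_unique)

lemma represents_val2:
  assumes "chart s \<phi>"
  shows "represents s \<phi> (\<lambda>p. val2 F (fst (\<phi> p)) (snd (\<phi> p))) F"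
  unfolding represents_def has_expansion_iff
    chart_eventually2[OF assms, of "\<lambda>x y. expands (nth2 F) x y (val2 F x y)"]
  using expands_summable_near_0[of F] expands_val2 by blast

lemma expands_single:
  assumes "\<And>i j. (i, j) \<noteq> (m, n) \<Longrightarrow> a i j = 0" "v = a m n * x ^ m * y ^ n"
  shows "expands a x y v"
  unfolding expands_def
  by (rule has_sum_finite_neutralI[of "{(m, n)}"]) (use assms in \<open>auto split: prod.splits\<close>)

lemma represents_const: "represents s \<phi> (\<lambda>_. c) (cst c)"
  unfolding represents_def has_expansion_iff
  by (intro always_eventually allI expands_single[of 0 0]) (auto simp: nth2_cst)

lemma represents_x: "represents s \<phi> (\<lambda>p. fst (\<phi> p)) (emb var1)"
  unfolding represents_def has_expansion_iff
  by (intro always_eventually allI expands_single[of 1 0]) auto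

lemma represents_y: "represents s \<phi> (\<lambda>p. snd (\<phi> p)) varY"
  unfolding represents_def has_expansion_iff
  by (intro always_eventually allI expands_single[of 0 1]) auto

lemma represents_add:
  assumes "represents s \<phi> f F" "represents s \<phi> g G"
  shows "represents s \<phi> (\<lambda>p. f p + g p) (F + G)"
  using assms unfolding represents_def has_expansion_iff nth2_simps
  by eventually_elim (simp add: expands_add)

lemma represents_mult:
  assumes "chart s \<phi>" "represents s \<phi> f F" "represents s \<phi> g G"
  shows "represents s \<phi> (\<lambda>p. f p * g p) (F * G)"
proof -
  have "\<forall>\<^sub>F p in nhds s. \<forall>v w. expands (nth2 F) (fst (\<phi> p)) (snd (\<phi> p)) v \<longrightarrow>
      expands (nth2 G) (fst (\<phi> p)) (snd (\<phi> p)) w \<longrightarrow> expands (nth2 (F * G)) (fst (\<phi> p)) (snd (\<phi> p)) (v * w)"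
    using chart_eventually2[OF assms(1), of "\<lambda>x y. \<forall>v w. expands (nth2 F) x y v \<longrightarrow>
      expands (nth2 G) x y w \<longrightarrow> expands (nth2 (F * G)) x y (v * w)"] expands_mult[of F G] by blast
  then show ?thesis
    using assms(2,3) unfolding represents_def has_expansion_iff by eventually_elim simp
qed

lemma represents_uminus:
  assumes "chart s \<phi>" "represents s \<phi> f F"
  shows "represents s \<phi> (\<lambda>p. - f p) (- F)"
  using represents_mult[OF assms(1) represents_const[of _ _ "- 1"] assms(2)] by simp

lemma represents_emb: 
  assumes "chart s \<phi>"
  shows "represents s \<phi> (\<lambda>p. val1 l (fst (\<phi> p))) (emb l)"
proof -
  obtain C R where CR: "C > 0" "R \<ge> 1" "\<And>i. norm (nth1 l i) \<le> C * R ^ i"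
    using cser_bound[of l] by blast
  have "expands (nth2 (emb l)) x y (val1 l x)" if "norm x < 1 / (2 * R)" for x y
  proof -
    have "R * norm x \<le> R * (1 / (2 * R))" using that CR by (intro mult_left_mono) auto
    then have "((\<lambda>i. nth1 l i * x ^ i) has_sum val1 l x) UNIV"
      using CR by (intro nth1_has_sum[OF CR(3)]) auto
    moreover have "bij_betw (\<lambda>i :: nat. (i, 0 :: nat)) UNIV (UNIV \<times> {0})"
      by (rule bij_betw_byWitness[where f' = fst]) auto
    ultimately have "((\<lambda>(i, j). nth2 (emb l) i j * x ^ i * y ^ j) has_sum val1 l x) (UNIV \<times> {0})"
      using has_sum_reindex_bij_betw[of "\<lambda>i. (i, 0)" UNIV "UNIV \<times> {0}"
          "\<lambda>(i, j). nth2 (emb l) i j * x ^ i * y ^ j"] by simp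
    then show ?thesis unfolding expands_def
      by (rule has_sum_cong_neutral[THEN iffD1, rotated -1]) (auto split: if_splits)
  qed
  then show ?thesis
    unfolding represents_def has_expansion_iff
      chart_eventually2[OF assms, of "\<lambda>x y. expands (nth2 (emb l)) x y (val1 l x)"]
    using CR by (intro exI[of _ "1 / (2 * R)"]) auto
qed

lemma represents_unique:
  assumes "chart s \<phi>" "represents s \<phi> f F" "represents s \<phi> f G"
  shows "F = G"
proof -
  have "represents s \<phi> (\<lambda>p. f p + - f p) (F + - G)"
    using represents_add[OF assms(2) represents_uminus[OF assms(1,3)]] .
  then have "\<forall>\<^sub>F p in nhds s. expands (nth2 (F - G)) (fst (\<phi> p)) (snd (\<phi> p)) 0"
    by (simp add: represents_def has_expansion_iff)
  then obtain r where "r > 0" "\<And>x y. norm x < r \<Longrightarrow> norm y < r \<Longrightarrow> expands (nth2 (F - G)) x y 0"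
    using chart_eventually2[OF assms(1), of "\<lambda>x y. expands (nth2 (F - G)) x y 0"] by auto
  then have "F - G = 0" by (rule expands_zero_imp)
  then show ?thesis by simp
qed

lemma represents_at:
  assumes "chart s \<phi>" "represents s \<phi> f F"
  shows "f s = nth2 F 0 0"
proof -
  have "expands (nth2 F) 0 0 (f s)"
    using assms(2) chart_at[OF assms(1)] unfolding represents_def has_expansion_iff
    by (auto dest: eventually_nhds_x_imp_x)
  moreover have "expands (nth2 F) 0 0 (nth2 F 0 0)"
    unfolding expands_def
    by (rule has_sum_finite_neutralI[of "{(0, 0)}"]) (auto simp: power_0_left split: prod.splits if_splits)
  ultimately show ?thesis by (rule expands_unique)
qed

lemma represents_axis_zero:
  assumes "chart s \<phi>" "represents s \<phi> f F"
    and zero: "\<forall>\<^sub>F p in nhds s. fst (\<phi> p) = 0 \<longrightarrow> f p = 0"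
  shows "nth2 F 0 j = 0"
proof -
  have "\<forall>\<^sub>F p in nhds s. fst (\<phi> p) = 0 \<longrightarrow> expands (nth2 F) (fst (\<phi> p)) (snd (\<phi> p)) 0"
    using assms(2) zero unfolding represents_def has_expansion_iff by eventually_elim auto
  then obtain r where r: "r > 0" "\<And>x y. norm x < r \<Longrightarrow> norm y < r \<Longrightarrow> x = 0 \<longrightarrow> expands (nth2 F) x y 0"
    using chart_eventually2[OF assms(1), of "\<lambda>x y. x = 0 \<longrightarrow> expands (nth2 F) x y 0"] by blast
  show ?thesis by (rule axis_zero_imp[OF r(1)]) (use r(1) r(2)[of 0] in auto)
qed

section \<open>Straightening a smooth branch\<close>

lemma chart_compose:
  assumes "chart s \<phi>" "filterlim \<tau> (nhds (0, 0)) (nhds (0, 0))" "filterlim \<sigma> (nhds (0, 0)) (nhds (0, 0))"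
    and "\<And>q. \<tau> (\<sigma> q) = q"
  shows "chart s (\<lambda>p. \<tau> (\<phi> p))"
proof -
  have "nhds (0, 0) = filtermap \<tau> (filtermap \<sigma> (nhds (0, 0)))"
    by (simp add: filtermap_filtermap assms(4))
  also have "\<dots> \<le> filtermap \<tau> (nhds (0, 0))"
    using assms(3) by (intro filtermap_mono) (simp add: filterlim_def)
  finally have "filtermap \<tau> (nhds (0, 0)) = nhds (0, 0)"
    using assms(2) by (intro order.antisym) (simp_all add: filterlim_def)
  then show ?thesis using assms(1) unfolding chart_def
    by (simp flip: filtermap_filtermap[of \<tau> \<phi>])
qed

lemma tendsto_val1: "nth1 l 0 = 0 \<Longrightarrow> (val1 l \<longlongrightarrow> 0) (nhds 0)"
proof -
  assume l: "nth1 l 0 = 0"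
  have "continuous (at 0) (val1 l)"
    unfolding val1_def using fps_conv_radius_cser_pos[of l]
    by (intro continuous_eval_fps) (auto simp: zero_ereal_def)
  then have "(val1 l \<longlongrightarrow> val1 l 0) (nhds 0)"
    by (simp add: isCont_def tendsto_at_iff_tendsto_nhds)
  moreover have "val1 l 0 = 0" using l by (simp add: val1_def eval_fps_at_0 nth1.rep_eq)
  ultimately show ?thesis by simp
qed

lemma tendsto_fst_0: "(fst \<longlongrightarrow> (0::complex)) (nhds (0::complex, 0::complex))"
  and tendsto_snd_0: "(snd \<longlongrightarrow> (0::complex)) (nhds (0::complex, 0::complex))"
  using tendsto_fst[OF filterlim_ident[of "nhds (0::complex, 0::complex)"]]
    tendsto_snd[OF filterlim_ident[of "nhds (0::complex, 0::complex)"]] by simp_all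

lemma chart_swap:
  assumes "chart s \<phi>"
  shows "chart s (\<lambda>p. (snd (\<phi> p), fst (\<phi> p)))"
proof -
  have t: "((\<lambda>q. (snd q, fst q)) \<longlongrightarrow> (0, 0)) (nhds (0::complex, 0::complex))"
    by (intro tendsto_Pair tendsto_fst_0 tendsto_snd_0)
  show ?thesis by (rule chart_compose[OF assms t t]) simp
qed

lemma has_expansion_swap:
  "has_expansion s (\<lambda>p. (snd (\<phi> p), fst (\<phi> p))) f a \<longleftrightarrow> has_expansion s \<phi> f (\<lambda>i j. a j i)"
  by (simp only: has_expansion_iff fst_conv snd_conv expands_swap[of a])

lemma analytic_near_swap: "analytic_near s (\<lambda>p. (snd (\<phi> p), fst (\<phi> p))) = analytic_near s \<phi>"
proof (intro ext iffI)
  fix f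
  assume "analytic_near s (\<lambda>p. (snd (\<phi> p), fst (\<phi> p))) f"
  then show "analytic_near s \<phi> f" unfolding analytic_near_def has_expansion_swap by blast
next
  fix f
  assume "analytic_near s \<phi> f"
  then obtain a where "has_expansion s \<phi> f a" unfolding analytic_near_def by blast
  then have "has_expansion s (\<lambda>p. (snd (\<phi> p), fst (\<phi> p))) f (\<lambda>i j. a j i)"
    by (simp only: has_expansion_swap)
  then show "analytic_near s (\<lambda>p. (snd (\<phi> p), fst (\<phi> p))) f" unfolding analytic_near_def by blast
qed

text \<open>A shear followed by a swap: the curve y = l(x) becomes the vanishing locus of the first
  coordinate, which is the one ramified by \<open>expand2\<close>.\<close>

definition sheared :: "cser \<Rightarrow> ('a \<Rightarrow> complex \<times> complex) \<Rightarrow> 'a \<Rightarrow> complex \<times> complex" where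
  "sheared l \<phi> p = (snd (\<phi> p) - val1 l (fst (\<phi> p)), fst (\<phi> p))"

lemma chart_sheared:
  assumes "chart s \<phi>" "nth1 l 0 = 0"
  shows "chart s (sheared l \<phi>)"
proof -
  have "((\<lambda>q. (snd q - val1 l (fst q), fst q)) \<longlongrightarrow> (0 - 0, 0)) (nhds (0::complex, 0::complex))"
    (is "(?\<tau> \<longlongrightarrow> _) _")
    by (rule tendsto_Pair[OF tendsto_diff[OF tendsto_snd_0
        filterlim_compose[OF tendsto_val1[OF assms(2)] tendsto_fst_0]] tendsto_fst_0])
  then have 1: "(?\<tau> \<longlongrightarrow> (0, 0)) (nhds (0, 0))" by simp
  have "((\<lambda>q. (snd q, fst q + val1 l (snd q))) \<longlongrightarrow> (0, 0 + 0)) (nhds (0::complex, 0::complex))"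
    (is "(?\<sigma> \<longlongrightarrow> _) _")
    by (rule tendsto_Pair[OF tendsto_snd_0 tendsto_add[OF tendsto_fst_0
        filterlim_compose[OF tendsto_val1[OF assms(2)] tendsto_snd_0]]])
  then have 2: "(?\<sigma> \<longlongrightarrow> (0, 0)) (nhds (0, 0))" by simp
  have "chart s (\<lambda>p. ?\<tau> (\<phi> p))" by (rule chart_compose[OF assms(1) 1 2]) simp
  then show ?thesis unfolding sheared_def[abs_def] .
qed

text \<open>The shear by \<open>l\<close> is undone by the shear by \<open>- l\<close>, so both
  directions rest on \<open>expands_shear\<close>. The swap of coordinates only transposes the
  coefficients.\<close>

lemma analytic_near_sheared:
  assumes \<phi>: "chart s \<phi>" and l: "nth1 l 0 = 0"
  shows "analytic_near s (sheared l \<phi>) = analytic_near s \<phi>"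
proof (intro ext iffI)
  fix f
  assume "analytic_near s \<phi> f"
  then obtain F where F: "represents s \<phi> f F" using analytic_near_iff[OF \<phi>] by blast
  obtain b where b: "\<exists>r>0. \<forall>x u. norm x < r \<longrightarrow> norm u < r \<longrightarrow>
      (\<forall>v. expands (nth2 F) x (u + val1 l x) v \<longrightarrow> expands b x u v)"
    using expands_shear[OF l, of F] by blast
  then have "\<exists>r>0. \<forall>u x. norm u < r \<longrightarrow> norm x < r \<longrightarrow>
      (\<forall>v. expands (nth2 F) x (u + val1 l x) v \<longrightarrow> expands b x u v)" by blast
  then have "\<forall>\<^sub>F p in nhds s. \<forall>v. expands (nth2 F) (fst (\<phi> p)) (snd (\<phi> p)) v \<longrightarrow>
      expands b (fst (\<phi> p)) (snd (\<phi> p) - val1 l (fst (\<phi> p))) v"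
    using chart_eventually2[OF chart_sheared[OF \<phi> l], of "\<lambda>u x. \<forall>v. expands (nth2 F) x (u + val1 l x) v \<longrightarrow> expands b x u v"]
    by (simp add: sheared_def)
  then have "has_expansion s (sheared l \<phi>) f (\<lambda>i j. b j i)"
    using F unfolding represents_def has_expansion_iff
    by eventually_elim (simp add: sheared_def expands_swap[of b])
  then show "analytic_near s (sheared l \<phi>) f" unfolding analytic_near_def by blast
next
  fix f
  assume "analytic_near s (sheared l \<phi>) f"
  then obtain a where a: "has_expansion s (sheared l \<phi>) f a" unfolding analytic_near_def by blast
  define \<phi>' where "\<phi>' = (\<lambda>p. (snd (sheared l \<phi> p), fst (sheared l \<phi> p)))"
  have "has_expansion s \<phi>' f (\<lambda>i j. a j i)"
    unfolding \<phi>'_def has_expansion_swap using a by simp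
  moreover from this obtain F where "(\<lambda>i j. a j i) = nth2 F"
    using has_expansion_convergent[of s \<phi>'] chart_swap[OF chart_sheared[OF \<phi> l]] unfolding \<phi>'_def by blast
  ultimately have F: "\<forall>\<^sub>F p in nhds s. expands (nth2 F) (fst (\<phi> p)) (snd (\<phi> p) - val1 l (fst (\<phi> p))) (f p)"
    by (simp add: has_expansion_iff \<phi>'_def sheared_def)
  obtain b where "\<exists>r>0. \<forall>x u. norm x < r \<longrightarrow> norm u < r \<longrightarrow>
      (\<forall>v. expands (nth2 F) x (u + val1 (- l) x) v \<longrightarrow> expands b x u v)"
    using expands_shear[of "- l" F] l by auto
  then have b: "\<forall>\<^sub>F p in nhds s. \<forall>v. expands (nth2 F) (fst (\<phi> p)) (snd (\<phi> p) + val1 (- l) (fst (\<phi> p))) v \<longrightarrow>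
      expands b (fst (\<phi> p)) (snd (\<phi> p)) v"
    using chart_eventually2[OF \<phi>, of "\<lambda>x u. \<forall>v. expands (nth2 F) x (u + val1 (- l) x) v \<longrightarrow> expands b x u v"] by simp
  \<comment> \<open>That \<open>val1 (- l)\<close> is \<open>- val1 l\<close> near 0 is read off
    from the common series of the two functions.\<close>
  have "represents s \<phi> (\<lambda>p. - val1 l (fst (\<phi> p))) (- emb l)"
    by (rule represents_uminus[OF \<phi> represents_emb[OF \<phi>]])
  then have "represents s \<phi> (\<lambda>p. - val1 l (fst (\<phi> p))) (emb (- l))" by simp
  from represents_eventually_eq[OF this represents_emb[OF \<phi>]]
  have "\<forall>\<^sub>F p in nhds s. - val1 l (fst (\<phi> p)) = val1 (- l) (fst (\<phi> p))" .
  then have "has_expansion s \<phi> f b"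
    using F b unfolding has_expansion_iff
  proof eventually_elim
    case (elim p)
    from elim(1) have "snd (\<phi> p) - val1 l (fst (\<phi> p)) = snd (\<phi> p) + val1 (- l) (fst (\<phi> p))"
      by (simp flip: elim(1))
    with elim show ?case by simp
  qed
  then show "analytic_near s \<phi> f" unfolding analytic_near_def by blast
qed

text \<open>The equation is a unit times \<open>y - l(x)\<close>, and \<open>y - l(x)\<close> becomes the first coordinate.\<close>

lemma straighten_graph:
  assumes \<phi>: "chart s \<phi>" and f: "represents s \<phi> f F" and F: "nth2 F 0 0 = 0" "nth2 F 0 1 \<noteq> 0"
  shows "\<exists>\<phi>' u. chart s \<phi>' \<and> analytic_near s \<phi>' = analytic_near s \<phi> \<and> u dvd 1 \<and> represents s \<phi>' f (u * emb var1)"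
proof -
  obtain U r where U: "U dvd 1" and UF: "U * F = (\<Sum>j\<le>1. emb (r j) * varY ^ j)" and
    r: "r 1 = 1" "nth1 (r 0) 0 = 0"
    using weierstrass_preparation[of F 1] F by auto
  obtain V where V: "1 = U * V" using U by (elim dvdE)
  define l where "l = - r 0"
  have l: "nth1 l 0 = 0" using r by (simp add: l_def)
  define \<phi>' where "\<phi>' = sheared l \<phi>"
  have \<phi>': "chart s \<phi>'" unfolding \<phi>'_def by (rule chart_sheared[OF \<phi> l])
  have an: "analytic_near s \<phi>' = analytic_near s \<phi>" unfolding \<phi>'_def by (rule analytic_near_sheared[OF \<phi> l])
  define g where "g = (\<lambda>p. val2 U (fst (\<phi> p)) (snd (\<phi> p)))"
  define h where "h = (\<lambda>p. val2 V (fst (\<phi> p)) (snd (\<phi> p)))"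
  have g: "represents s \<phi> g U" and h: "represents s \<phi> h V"
    unfolding g_def h_def by (rule represents_val2[OF \<phi>])+
  have gh: "\<forall>\<^sub>F p in nhds s. g p * h p = 1"
    using represents_eventually_eq[OF represents_mult[OF \<phi> g h], of "\<lambda>_. 1"] represents_const[of s \<phi> 1] V by simp
  have "represents s \<phi> (\<lambda>p. snd (\<phi> p) + - val1 l (fst (\<phi> p))) (varY + - emb l)"
    by (intro represents_add represents_y represents_uminus[OF \<phi>] represents_emb[OF \<phi>])
  moreover have "varY + - emb l = U * F" using r by (simp add: UF l_def)
  ultimately have x': "represents s \<phi> (\<lambda>p. fst (\<phi>' p)) (U * F)" by (simp add: \<phi>'_def sheared_def)
  have "\<forall>\<^sub>F p in nhds s. g p * f p = fst (\<phi>' p)"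
    by (rule represents_eventually_eq[OF represents_mult[OF \<phi> g f] x'])
  with gh have fx: "\<forall>\<^sub>F p in nhds s. h p * fst (\<phi>' p) = f p"
  proof eventually_elim
    case (elim p)
    have "h p * fst (\<phi>' p) = (g p * h p) * f p" unfolding elim(2)[symmetric] by simp
    then show ?case using elim(1) by simp
  qed
  \<comment> \<open>The unit and its inverse are analytic in the new coordinates as well. Their
    product is still 1, so the new series \<open>V'\<close> is again a unit.\<close>
  obtain U' where U': "represents s \<phi>' g U'"
    using g an analytic_near_iff[OF \<phi>] analytic_near_iff[OF \<phi>'] by metis
  obtain V' where V': "represents s \<phi>' h V'"
    using h an analytic_near_iff[OF \<phi>] analytic_near_iff[OF \<phi>'] by metis
  have "represents s \<phi>' (\<lambda>_. 1) (U' * V')"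
    using represents_cong[OF gh represents_mult[OF \<phi>' U' V']] .
  then have "U' * V' = 1" using represents_unique[OF \<phi>'] represents_const[of s \<phi>' 1] by simp
  then have "V' dvd 1" by (metis dvd_triv_right)
  moreover have "represents s \<phi>' f (V' * emb var1)"
    by (rule represents_cong[OF fx represents_mult[OF \<phi>' V' represents_x]])
  ultimately show ?thesis using \<phi>' an by blast
qed

lemma straighten_smooth:
  assumes \<phi>: "chart s \<phi>" and f: "represents s \<phi> f F" and F: "nth2 F 0 0 = 0"
    and smooth: "nth2 F 0 1 \<noteq> 0 \<or> nth2 F 1 0 \<noteq> 0"
  shows "\<exists>\<phi>' u. chart s \<phi>' \<and> analytic_near s \<phi>' = analytic_near s \<phi> \<and> u dvd 1 \<and> represents s \<phi>' f (u * emb var1)"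
proof (cases "nth2 F 0 1 \<noteq> 0")
  case True
  then show ?thesis by (rule straighten_graph[OF \<phi> f F])
next
  case False
  define \<phi>s where "\<phi>s = (\<lambda>p. (snd (\<phi> p), fst (\<phi> p)))"
  have \<phi>s: "chart s \<phi>s" unfolding \<phi>s_def by (rule chart_swap[OF \<phi>])
  have "has_expansion s \<phi>s f (\<lambda>i j. nth2 F j i)"
    unfolding \<phi>s_def has_expansion_swap using f by (simp add: represents_def)
  moreover from this obtain G where G: "(\<lambda>i j. nth2 F j i) = nth2 G"
    using has_expansion_convergent[OF \<phi>s] by blast
  ultimately have fG: "represents s \<phi>s f G" by (simp add: represents_def)
  have "nth2 G i j = nth2 F j i" for i j using fun_cong[OF fun_cong[OF G, of i], of j] by simp
  then have "\<exists>\<phi>' u. chart s \<phi>' \<and> analytic_near s \<phi>' = analytic_near s \<phi>s \<and> u dvd 1 \<and> represents s \<phi>' f (u * emb var1)"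
    using False smooth F by (intro straighten_graph[OF \<phi>s fG]) auto
  then show ?thesis unfolding \<phi>s_def analytic_near_swap .
qed

text \<open>A record-based ring that is a copy, via \<open>T\<close>, of the ring of convergent
  series. Irreducibility, generated ideals and dimensions of quotients are translated here,
  independently of germs; \<open>germ_map\<close> is the instance.\<close>

locale series_ring = cring R for R (structure) +
  fixes T :: "cser2 \<Rightarrow> 'a"
  assumes carrier_range: "carrier R = range T"
    and T_inj: "inj T"
    and T_add: "T (F + G) = T F \<oplus> T G"
    and T_mult: "T (F * G) = T F \<otimes> T G"
    and T_one: "T 1 = \<one>"
begin

lemma T_carrier [simp]: "T F \<in> carrier R"
  by (simp add: carrier_range)

lemma T_eq_iff [simp]: "T F = T G \<longleftrightarrow> F = G"
  using T_inj by (auto dest: injD)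

lemma T_zero: "T 0 = \<zero>"
proof -
  have "T 0 \<oplus> T 0 = T 0" by (simp flip: T_add)
  then show ?thesis by (simp add: add.l_cancel_one)
qed

lemma T_uminus: "T (- F) = \<ominus> T F"
proof -
  have "T (- F) \<oplus> T F = \<zero>" by (simp add: T_zero flip: T_add)
  then show ?thesis by (intro minus_equality[symmetric]) auto
qed

lemma T_unit_iff: "T F \<in> Units R \<longleftrightarrow> F dvd 1"
proof
  assume "T F \<in> Units R"
  then obtain y where "y \<in> carrier R" "T F \<otimes> y = \<one>" using Units_r_inv_ex by blast
  then obtain G where "T F \<otimes> T G = \<one>" by (auto simp: carrier_range)
  then have "F * G = 1" by (simp flip: T_mult T_one)
  then show "F dvd 1" by (metis dvd_triv_left)
next
  assume "F dvd 1"
  then obtain G where "F * G = 1" by (metis dvd_def)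
  then have "T F \<otimes> T G = \<one>" by (simp flip: T_mult T_one)
  then show "T F \<in> Units R" unfolding Units_def by (auto intro!: bexI[of _ "T G"] simp: m_comm)
qed

text \<open>Irreducibility in the record-based sense speaks of proper factors. If g in F = g h is
  not a unit, it is not a proper factor, so F divides g; cancelling g shows that h is a
  unit.\<close>

lemma irreducible_transfer:
  assumes "ring_irreducible (T F)"
  shows "Factorial_Ring.irreducible F"
proof -
  have F0: "F \<noteq> 0" and unit: "T F \<notin> Units R"
    and irr: "\<And>b. b \<in> carrier R \<Longrightarrow> properfactor R b (T F) \<Longrightarrow> b \<in> Units R"
    using assms T_zero unfolding ring_irreducible_def Divisibility.irreducible_def by auto
  have "g dvd 1 \<or> h dvd 1" if F: "F = g * h" for g h
  proof (cases "g dvd 1")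
    case False
    then have "\<not> properfactor R (T g) (T F)" using irr[of "T g"] T_unit_iff by auto
    moreover have "T g divides T F" unfolding factor_def F T_mult by (intro bexI[of _ "T h"]) auto
    ultimately have "T F divides T g" unfolding properfactor_def by blast
    then obtain y where "y \<in> carrier R" "T g = T F \<otimes> y" unfolding factor_def by blast
    then obtain k where "T g = T F \<otimes> T k" by (auto simp: carrier_range)
    then have "g = F * k" by (simp flip: T_mult)
    then have "g * (h * k) = g * 1" unfolding F by (simp add: mult.assoc)
    then have "h * k = 1" using F0 F by auto
    then show ?thesis by (metis dvd_triv_left)
  qed simp
  then show ?thesis using F0 unit T_unit_iff unfolding Factorial_Ring.irreducible_def by auto
qed

lemma ideal_image: "ideal (T ` ideal2 F G) R"
proof (rule idealI)
  show "ring R" by (rule ring_axioms)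
  show "subgroup (T ` ideal2 F G) (add_monoid R)"
  proof
    show "T ` ideal2 F G \<subseteq> carrier (add_monoid R)" by auto
    show "x \<otimes>\<^bsub>add_monoid R\<^esub> y \<in> T ` ideal2 F G" if "x \<in> T ` ideal2 F G" "y \<in> T ` ideal2 F G" for x y
      using that ideal2_add by (auto simp flip: T_add)
    show "\<one>\<^bsub>add_monoid R\<^esub> \<in> T ` ideal2 F G" by (auto simp flip: T_zero)
    show "inv\<^bsub>add_monoid R\<^esub> x \<in> T ` ideal2 F G" if "x \<in> T ` ideal2 F G" for x
      using that ideal2_uminus by (auto simp flip: T_uminus a_inv_def)
  qed
  have l: "x \<otimes> a \<in> T ` ideal2 F G" if "a \<in> T ` ideal2 F G" "x \<in> carrier R" for a x
    using that ideal2_mult by (auto simp: carrier_range simp flip: T_mult)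
  then show "x \<otimes> a \<in> T ` ideal2 F G" if "a \<in> T ` ideal2 F G" "x \<in> carrier R" for a x using that .
  show "a \<otimes> x \<in> T ` ideal2 F G" if "a \<in> T ` ideal2 F G" "x \<in> carrier R" for a x
  proof -
    have "a \<in> carrier R" using that by auto
    then show ?thesis using l[OF that] m_comm[OF _ that(2)] by simp
  qed
qed

lemma genideal_image: "Idl {T F, T G} = T ` ideal2 F G"
proof
  have "F \<in> ideal2 F G" by (rule ideal2I[of _ _ 1 _ 0]) simp
  moreover have "G \<in> ideal2 F G" by (rule ideal2I[of _ _ 0 _ 1]) simp
  ultimately show "Idl {T F, T G} \<subseteq> T ` ideal2 F G"
    by (intro genideal_minimal ideal_image) auto
  have "T (F * a + G * b) \<in> Idl {T F, T G}" for a b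
  proof -
    interpret J: ideal "Idl {T F, T G}" R by (rule genideal_ideal) auto
    have "{T F, T G} \<subseteq> Idl {T F, T G}" by (rule genideal_self) auto
    then show ?thesis unfolding T_add T_mult by (intro J.a_closed J.I_r_closed) auto
  qed
  then show "T ` ideal2 F G \<subseteq> Idl {T F, T G}" by (auto simp: ideal2_def)
qed

lemma constants_subfield: "subfield (T ` range cst) R"
proof (rule subfieldI)
  have "subring (T ` range cst) R"
  proof (rule subringI)
    show "\<one> \<in> T ` range cst" using T_one cst_hom(2) by (metis image_eqI rangeI)
    show "\<ominus> h \<in> T ` range cst" if "h \<in> T ` range cst" for h
      using that by (auto simp flip: T_uminus cst_hom(5))
    show "h1 \<otimes> h2 \<in> T ` range cst" if "h1 \<in> T ` range cst" "h2 \<in> T ` range cst" for h1 h2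
      using that by (auto simp flip: T_mult cst_hom(4))
    show "h1 \<oplus> h2 \<in> T ` range cst" if "h1 \<in> T ` range cst" "h2 \<in> T ` range cst" for h1 h2
      using that by (auto simp flip: T_add cst_hom(3))
  qed auto
  then show "subcring (T ` range cst) R" by (rule subcringI')
  have inj: "cst c = 0 \<longleftrightarrow> c = 0" for c
    using nth2_cst[of c 0 0] by auto
  show "Units (R\<lparr>carrier := T ` range cst\<rparr>) = T ` range cst - {\<zero>}"
  proof (intro subset_antisym subsetI)
    fix x assume x: "x \<in> Units (R\<lparr>carrier := T ` range cst\<rparr>)"
    then have "x \<in> T ` range cst" "\<exists>y\<in>T ` range cst. y \<otimes> x = \<one>" by (simp_all add: Units_def) blast
    then obtain c y where c: "x = T (cst c)" "y \<in> T ` range cst" "y \<otimes> x = \<one>" by blast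
    have "T (cst c) \<noteq> \<zero>"
    proof
      assume 0: "T (cst c) = \<zero>"
      have "y \<in> carrier R" using c(2) by auto
      then have "\<one> = \<zero>" using c 0 by simp
      then show False by (simp flip: T_one T_zero)
    qed
    then show "x \<in> T ` range cst - {\<zero>}" using c by auto
  next
    fix x assume "x \<in> T ` range cst - {\<zero>}"
    then have x: "x \<in> T ` range cst" "x \<noteq> T 0" by (simp_all add: T_zero)
    then obtain c where "x = T (cst c)" by blast
    then have c: "x = T (cst c)" "c \<noteq> 0" using inj[of c] x(2) by auto
    have "T (cst (1 / c)) \<otimes> x = \<one>" "x \<otimes> T (cst (1 / c)) = \<one>"
      using c(2) unfolding c(1) T_mult[symmetric] cst_hom(4)[symmetric] by (simp_all add: T_one)
    then show "x \<in> Units (R\<lparr>carrier := T ` range cst\<rparr>)" using c by (auto simp: Units_def)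
  qed
qed

text \<open>The dimension in the definition of intersection numbers is built by adjoining one vector
  at a time, so the basis is consumed inductively: \<open>E k\<close> is the image of the span of
  its first k elements.\<close>

lemma quotient_dimension:
  assumes codim: "has_codim (ideal2 F G) n" and n: "n > 0"
  defines "I \<equiv> Idl {T F, T G}"
  defines "Q \<equiv> R Quot I"
  defines "K \<equiv> (\<lambda>c. I +> T (cst c)) ` UNIV"
  shows "ring.finite_dimension Q K (carrier Q) \<and> ring.dim Q K (carrier Q) = n"
proof -
  have I: "I = T ` ideal2 F G" unfolding I_def by (rule genideal_image)
  interpret I: ideal I R unfolding I by (rule ideal_image)
  interpret Q: ring Q unfolding Q_def by (rule I.quotient_is_ring)
  interpret h: ring_hom_ring R Q "(+>) I" unfolding Q_def by (rule I.rcos_ring_hom_ring)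
  define q where "q = (\<lambda>H. I +> T H)"
  have q_add: "q (A + B) = q A \<oplus>\<^bsub>Q\<^esub> q B" for A B
    unfolding q_def T_add by (rule ring_hom_add[OF h.homh T_carrier T_carrier])
  have "I +> T A \<otimes> T B = (I +> T A) \<otimes>\<^bsub>Q\<^esub> (I +> T B)" for A B
    using h.homh T_carrier[of A] T_carrier[of B] by (rule ring_hom_mult)
  then have q_mult: "q (A * B) = q A \<otimes>\<^bsub>Q\<^esub> q B" for A B
    unfolding q_def T_mult .
  have zero: "\<zero>\<^bsub>Q\<^esub> = I" by (simp only: Q_def FactRing_def ring_record_simps)
  have q0: "q A = \<zero>\<^bsub>Q\<^esub> \<longleftrightarrow> A \<in> ideal2 F G" for A
  proof -
    have "q A = I \<longleftrightarrow> T A \<in> I"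
    proof
      assume "q A = I"
      then show "T A \<in> I" using I.a_rcos_self[of "T A"] by (simp add: q_def)
    next
      assume "T A \<in> I"
      then show "q A = I" unfolding q_def by (rule I.a_rcos_const)
    qed
    then show ?thesis unfolding zero I by auto
  qed
  have carrier_Q: "carrier Q = range q"
    unfolding Q_def FactRing_def A_RCOSETS_def' partial_object.select_convs q_def carrier_range by blast
  have q_diff: "q A = q B" if "A - B \<in> ideal2 F G" for A B
  proof -
    have "q A = q (A - B) \<oplus>\<^bsub>Q\<^esub> q B" by (simp flip: q_add)
    also have "q (A - B) = \<zero>\<^bsub>Q\<^esub>" using that q0 by blast
    finally show ?thesis using carrier_Q by simp
  qed
  obtain e where e: "indep_mod (ideal2 F G) {..<n} e" "span_mod (ideal2 F G) {..<n} e"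
    using codim by (auto simp: has_codim_def)
  have K: "K = (+>) I ` T ` range cst" by (auto simp: K_def)
  \<comment> \<open>If 1 were in the ideal, every combination would be, against independence of a
    nonempty basis. The quotient is therefore not the zero ring, and the constants in it form a
    field.\<close>
  have "1 \<notin> ideal2 F G"
  proof
    assume "1 \<in> ideal2 F G"
    then have "(\<Sum>i<n. cst 1 * e i) \<in> ideal2 F G"
      using ideal2_mult[of 1 F G "\<Sum>i<n. cst 1 * e i"] by simp
    from indep_modD[where c = "\<lambda>_. 1", OF e(1) this, of 0] show False using n by simp
  qed
  then have "\<one>\<^bsub>Q\<^esub> \<noteq> \<zero>\<^bsub>Q\<^esub>" using q0[of 1] h.hom_one by (simp add: q_def T_one)
  then have field: "subfield K Q" unfolding K by (rule h.img_is_subfield(2)[OF constants_subfield])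
  define E where "E = (\<lambda>k. q ` {(\<Sum>i<k. cst (c i) * e i) | c. True})"
  have "Q.dimension k K (E k)" if "k \<le> n" for k
    using that
  proof (induction k)
    case 0
    have "E 0 = {\<zero>\<^bsub>Q\<^esub>}" using q0[of 0] by (auto simp: E_def)
    then show ?case by simp
  next
    case (Suc k)
    have "q (e k) \<notin> E k"
    proof
      assume "q (e k) \<in> E k"
      then obtain c where c: "q (e k) = q (\<Sum>i<k. cst (c i) * e i)" by (auto simp: E_def)
      have "q (e k - (\<Sum>i<k. cst (c i) * e i)) \<oplus>\<^bsub>Q\<^esub> q (\<Sum>i<k. cst (c i) * e i) = q (\<Sum>i<k. cst (c i) * e i)"
        using c by (simp flip: q_add)
      then have "q (e k - (\<Sum>i<k. cst (c i) * e i)) = \<zero>\<^bsub>Q\<^esub>"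
        using carrier_Q by (simp add: Q.add.r_cancel_one)
      then have mem: "e k - (\<Sum>i<k. cst (c i) * e i) \<in> ideal2 F G" using q0 by simp
      \<comment> \<open>The combination that equals \<open>e k\<close> minus the given element of
        the span; its coefficient 1 at \<open>k\<close> contradicts independence.\<close>
      define c' where "c' = (\<lambda>i. if i < k then - c i else if i = k then 1 else 0)"
      have "(\<Sum>i<n. cst (c' i) * e i) = (\<Sum>i<Suc k. cst (c' i) * e i)"
        using Suc.prems by (intro sum.mono_neutral_right) (auto simp: c'_def)
      also have "\<dots> = e k - (\<Sum>i<k. cst (c i) * e i)"
        by (simp add: c'_def sum_negf)
      finally have "(\<Sum>i<n. cst (c' i) * e i) \<in> ideal2 F G" using mem by simp
      from indep_modD[OF e(1) this, of k] show False using Suc.prems by (simp add: c'_def)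
    qed
    moreover have "E (Suc k) = Q.line_extension K (q (e k)) (E k)"
    proof (intro subset_antisym subsetI)
      fix x assume "x \<in> E (Suc k)"
      then obtain c where "x = q (cst (c k)) \<otimes>\<^bsub>Q\<^esub> q (e k) \<oplus>\<^bsub>Q\<^esub> q (\<Sum>i<k. cst (c i) * e i)"
        by (auto simp: E_def add.commute simp flip: q_mult q_add)
      then show "x \<in> Q.line_extension K (q (e k)) (E k)"
        unfolding Q.line_extension_mem_iff by (auto simp: K_def E_def q_def)
    next
      fix x assume "x \<in> Q.line_extension K (q (e k)) (E k)"
      then obtain d c where x: "x = q (cst d) \<otimes>\<^bsub>Q\<^esub> q (e k) \<oplus>\<^bsub>Q\<^esub> q (\<Sum>i<k. cst (c i) * e i)"
        unfolding Q.line_extension_mem_iff by (auto simp: K_def E_def q_def)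
      have "x = q (\<Sum>i<Suc k. cst ((c(k := d)) i) * e i)"
        unfolding x q_mult[symmetric] q_add[symmetric] by (simp add: add.commute)
      then show "x \<in> E (Suc k)" unfolding E_def by blast
    qed
    ultimately show ?case using Suc carrier_Q by (auto intro: Q.Suc_dim)
  qed
  moreover have "E n = carrier Q"
  proof
    show "carrier Q \<subseteq> E n"
    proof
      fix x assume "x \<in> carrier Q"
      then obtain H where H: "x = q H" by (auto simp: carrier_Q)
      obtain c where "H - (\<Sum>i<n. cst (c i) * e i) \<in> ideal2 F G" using e(2) by (auto simp: span_mod_def)
      from q_diff[OF this] H show "x \<in> E n" by (auto simp: E_def)
    qed
  qed (auto simp: E_def carrier_Q)
  ultimately have "Q.dimension n K (carrier Q)" by (metis order_refl)
  then show ?thesis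
    using Q.dimI[OF field] Q.finite_dimensionI by (simp add: over_def)
qed

end

section \<open>The local ring as a ring of convergent power series\<close>

lemma analytic_ring_cring:
  assumes \<phi>: "chart s \<phi>"
  shows "cring (analytic_ring s \<phi>)"
proof -
  have an: "analytic_near s \<phi> f \<longleftrightarrow> (\<exists>F. represents s \<phi> f F)" for f by (rule analytic_near_iff[OF \<phi>])
  have add: "analytic_near s \<phi> (\<lambda>p. f p + g p)" if "analytic_near s \<phi> f" "analytic_near s \<phi> g" for f g
    using that represents_add unfolding an by blast
  have mult: "analytic_near s \<phi> (\<lambda>p. f p * g p)" if "analytic_near s \<phi> f" "analytic_near s \<phi> g" for f g
    using that represents_mult[OF \<phi>] unfolding an by blast
  have uminus: "analytic_near s \<phi> (\<lambda>p. - f p)" if "analytic_near s \<phi> f" for f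
    using that represents_uminus[OF \<phi>] unfolding an by blast
  have const: "analytic_near s \<phi> (\<lambda>p. c)" for c
    using represents_const unfolding an by blast
  show ?thesis
  proof (rule cringI)
    show "abelian_group (analytic_ring s \<phi>)"
    proof (rule abelian_groupI)
      fix f assume "f \<in> carrier (analytic_ring s \<phi>)"
      then show "\<exists>y\<in>carrier (analytic_ring s \<phi>). y \<oplus>\<^bsub>analytic_ring s \<phi>\<^esub> f = \<zero>\<^bsub>analytic_ring s \<phi>\<^esub>"
        using uminus[of f] by (intro bexI[of _ "\<lambda>p. - f p"]) (auto simp: analytic_ring_def)
    qed (auto simp: analytic_ring_def add const algebra_simps)
    show "comm_monoid (analytic_ring s \<phi>)"
      by (rule comm_monoidI) (auto simp: analytic_ring_def mult const algebra_simps)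
  qed (auto simp: analytic_ring_def algebra_simps)
qed

lemma germ_of_eq:
  assumes \<phi>: "chart s \<phi>" and f: "analytic_near s \<phi> f"
  shows "germ_of s \<phi> f = {g. analytic_near s \<phi> g \<and> (\<forall>\<^sub>F p in nhds s. g p = f p)}"
proof (intro subset_antisym subsetI)
  have an: "analytic_near s \<phi> f \<longleftrightarrow> (\<exists>F. represents s \<phi> f F)" for f by (rule analytic_near_iff[OF \<phi>])
  fix g assume "g \<in> germ_of s \<phi> f"
  then obtain h where h: "h \<in> null_ideal s \<phi>" "g = (\<lambda>p. h p + f p)"
    by (auto simp: germ_of_def a_r_coset_def' analytic_ring_def)
  have "\<forall>\<^sub>F p in nhds s. h p = 0" using h(1) by (simp add: null_ideal_def)
  then have "\<forall>\<^sub>F p in nhds s. g p = f p" by eventually_elim (simp add: h(2))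
  moreover have "analytic_near s \<phi> g"
    using h f represents_add unfolding null_ideal_def an by blast
  ultimately show "g \<in> {g. analytic_near s \<phi> g \<and> (\<forall>\<^sub>F p in nhds s. g p = f p)}" by simp
next
  have an: "analytic_near s \<phi> f \<longleftrightarrow> (\<exists>F. represents s \<phi> f F)" for f by (rule analytic_near_iff[OF \<phi>])
  fix g assume "g \<in> {g. analytic_near s \<phi> g \<and> (\<forall>\<^sub>F p in nhds s. g p = f p)}"
  then have g: "analytic_near s \<phi> g" "\<forall>\<^sub>F p in nhds s. g p = f p" by auto
  have "analytic_near s \<phi> (\<lambda>p. g p + - f p)"
    using g(1) f represents_add represents_uminus[OF \<phi>] unfolding an by blast
  moreover have "\<forall>\<^sub>F p in nhds s. g p + - f p = 0" using g(2) by eventually_elim simp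
  ultimately have "(\<lambda>p. g p + - f p) \<in> null_ideal s \<phi>" by (simp add: null_ideal_def)
  then show "g \<in> germ_of s \<phi> f"
    unfolding germ_of_def a_r_coset_def' by (force simp: analytic_ring_def)
qed

lemma null_ideal_ideal:
  assumes \<phi>: "chart s \<phi>"
  shows "ideal (null_ideal s \<phi>) (analytic_ring s \<phi>)"
proof -
  interpret A: cring "analytic_ring s \<phi>" by (rule analytic_ring_cring[OF \<phi>])
  have an: "analytic_near s \<phi> f \<longleftrightarrow> (\<exists>F. represents s \<phi> f F)" for f by (rule analytic_near_iff[OF \<phi>])
  have inv: "inv\<^bsub>add_monoid (analytic_ring s \<phi>)\<^esub> f = (\<lambda>p. - f p)" if "analytic_near s \<phi> f" for f
  proof -
    have "analytic_near s \<phi> (\<lambda>p. - f p)" using that represents_uminus[OF \<phi>] unfolding an by blast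
    with that have "\<ominus>\<^bsub>analytic_ring s \<phi>\<^esub> f = (\<lambda>p. - f p)"
      by (intro A.minus_equality) (auto simp: analytic_ring_def)
    then show ?thesis by (simp add: a_inv_def)
  qed
  show ?thesis
  proof (rule idealI)
    show "ring (analytic_ring s \<phi>)" by (rule A.ring_axioms)
    show "subgroup (null_ideal s \<phi>) (add_monoid (analytic_ring s \<phi>))"
    proof
      show "null_ideal s \<phi> \<subseteq> carrier (add_monoid (analytic_ring s \<phi>))"
        by (auto simp: null_ideal_def analytic_ring_def)
      fix f g assume f: "f \<in> null_ideal s \<phi>" and g: "g \<in> null_ideal s \<phi>"
      have "\<forall>\<^sub>F p in nhds s. f p + g p = 0"
        using f g unfolding null_ideal_def mem_Collect_eq by (auto elim: eventually_elim2)
      moreover have "analytic_near s \<phi> (\<lambda>p. f p + g p)"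
        using f g represents_add unfolding null_ideal_def an by blast
      ultimately show "f \<otimes>\<^bsub>add_monoid (analytic_ring s \<phi>)\<^esub> g \<in> null_ideal s \<phi>"
        by (simp add: null_ideal_def analytic_ring_def)
    next
      show "\<one>\<^bsub>add_monoid (analytic_ring s \<phi>)\<^esub> \<in> null_ideal s \<phi>"
        using A.zero_closed by (simp add: null_ideal_def analytic_ring_def)
      fix f assume f: "f \<in> null_ideal s \<phi>"
      then have "analytic_near s \<phi> (\<lambda>p. - f p)"
        using represents_uminus[OF \<phi>] unfolding null_ideal_def an by blast
      then show "inv\<^bsub>add_monoid (analytic_ring s \<phi>)\<^esub> f \<in> null_ideal s \<phi>"
        using f inv[of f] by (simp add: null_ideal_def)
    qed
    fix f g assume f: "f \<in> null_ideal s \<phi>" and g: "g \<in> carrier (analytic_ring s \<phi>)"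
    have "\<forall>\<^sub>F p in nhds s. f p = 0" using f by (simp add: null_ideal_def)
    then have "\<forall>\<^sub>F p in nhds s. g p * f p = 0" "\<forall>\<^sub>F p in nhds s. f p * g p = 0"
      by (auto elim!: eventually_mono)
    moreover have "g \<otimes>\<^bsub>analytic_ring s \<phi>\<^esub> f \<in> carrier (analytic_ring s \<phi>)"
      "f \<otimes>\<^bsub>analytic_ring s \<phi>\<^esub> g \<in> carrier (analytic_ring s \<phi>)"
      using f g represents_mult[OF \<phi>] unfolding null_ideal_def analytic_ring_def
        partial_object.select_convs monoid.select_convs mem_Collect_eq an by blast+
    ultimately show "g \<otimes>\<^bsub>analytic_ring s \<phi>\<^esub> f \<in> null_ideal s \<phi>" "f \<otimes>\<^bsub>analytic_ring s \<phi>\<^esub> g \<in> null_ideal s \<phi>"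
      by (auto simp: null_ideal_def analytic_ring_def)
  qed
qed

definition germ_map :: "'a::topological_space \<Rightarrow> ('a \<Rightarrow> complex \<times> complex) \<Rightarrow> cser2 \<Rightarrow> ('a \<Rightarrow> complex) set" where
  "germ_map s \<phi> F = germ_of s \<phi> (\<lambda>p. val2 F (fst (\<phi> p)) (snd (\<phi> p)))"

lemma germ_of_eq_represents:
  assumes \<phi>: "chart s \<phi>" and f: "represents s \<phi> f F"
  shows "germ_of s \<phi> f = {g. represents s \<phi> g F}"
proof -
  have "analytic_near s \<phi> f" using f analytic_near_iff[OF \<phi>] by blast
  then have "germ_of s \<phi> f = {g. analytic_near s \<phi> g \<and> (\<forall>\<^sub>F p in nhds s. g p = f p)}"
    by (rule germ_of_eq[OF \<phi>])
  also have "\<dots> = {g. represents s \<phi> g F}"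
  proof (intro Collect_cong iffI conjI)
    fix g assume g: "analytic_near s \<phi> g \<and> (\<forall>\<^sub>F p in nhds s. g p = f p)"
    then have "\<forall>\<^sub>F p in nhds s. f p = g p" by (auto elim: eventually_mono)
    then show "represents s \<phi> g F" by (rule represents_cong[OF _ f])
  next
    fix g assume "represents s \<phi> g F"
    then show "analytic_near s \<phi> g" "\<forall>\<^sub>F p in nhds s. g p = f p"
      using analytic_near_iff[OF \<phi>] represents_eventually_eq[OF _ f] by blast+
  qed
  finally show ?thesis .
qed

lemma germ_map_eq: "chart s \<phi> \<Longrightarrow> germ_map s \<phi> F = {f. represents s \<phi> f F}"
  unfolding germ_map_def by (rule germ_of_eq_represents[OF _ represents_val2])

lemma germ_of_eq_germ_map: "chart s \<phi> \<Longrightarrow> represents s \<phi> f F \<Longrightarrow> germ_of s \<phi> f = germ_map s \<phi> F"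
  by (simp add: germ_map_eq germ_of_eq_represents)

lemma series_ring_local_ring:
  assumes \<phi>: "chart s \<phi>"
  shows "series_ring (local_ring s \<phi>) (germ_map s \<phi>)"
proof -
  interpret A: cring "analytic_ring s \<phi>" by (rule analytic_ring_cring[OF \<phi>])
  interpret N: ideal "null_ideal s \<phi>" "analytic_ring s \<phi>" by (rule null_ideal_ideal[OF \<phi>])
  interpret L: cring "local_ring s \<phi>"
    unfolding local_ring_def by (rule N.quotient_is_cring[OF A.is_cring])
  interpret h: ring_hom_ring "analytic_ring s \<phi>" "local_ring s \<phi>" "(+>\<^bsub>analytic_ring s \<phi>\<^esub>) (null_ideal s \<phi>)"
    unfolding local_ring_def by (rule N.rcos_ring_hom_ring)
  define v where "v = (\<lambda>F p. val2 F (fst (\<phi> p)) (snd (\<phi> p)))"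
  have v: "represents s \<phi> (v F) F" for F unfolding v_def by (rule represents_val2[OF \<phi>])
  then have vc: "v F \<in> carrier (analytic_ring s \<phi>)" for F
    using analytic_near_iff[OF \<phi>] by (auto simp: analytic_ring_def)
  have T: "germ_map s \<phi> F = null_ideal s \<phi> +>\<^bsub>analytic_ring s \<phi>\<^esub> v F" for F
    by (simp add: germ_map_def germ_of_def v_def)
  have T': "null_ideal s \<phi> +>\<^bsub>analytic_ring s \<phi>\<^esub> f = germ_map s \<phi> F" if "represents s \<phi> f F" for f F
    using germ_of_eq_germ_map[OF \<phi> that] by (simp add: germ_of_def)
  show ?thesis
  proof
    show "carrier (local_ring s \<phi>) = range (germ_map s \<phi>)"
    proof (intro subset_antisym subsetI)
      fix x assume "x \<in> carrier (local_ring s \<phi>)"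
      then obtain f where "analytic_near s \<phi> f" "x = null_ideal s \<phi> +>\<^bsub>analytic_ring s \<phi>\<^esub> f"
        by (auto simp: local_ring_def FactRing_def A_RCOSETS_def' analytic_ring_def)
      then show "x \<in> range (germ_map s \<phi>)" using T' analytic_near_iff[OF \<phi>] by blast
    next
      fix x assume "x \<in> range (germ_map s \<phi>)"
      then show "x \<in> carrier (local_ring s \<phi>)" using T h.hom_closed[OF vc] by auto
    qed
    show "inj (germ_map s \<phi>)"
    proof (rule injI)
      fix F G assume "germ_map s \<phi> F = germ_map s \<phi> G"
      then have "represents s \<phi> (v F) G" using v[of F] by (auto simp: germ_map_eq[OF \<phi>])
      then show "F = G" by (rule represents_unique[OF \<phi> v])
    qed
    show "germ_map s \<phi> (F + G) = germ_map s \<phi> F \<oplus>\<^bsub>local_ring s \<phi>\<^esub> germ_map s \<phi> G" for F G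
      using T'[OF represents_add[OF v[of F] v[of G]]] h.hom_add[OF vc[of F] vc[of G]]
      by (simp add: T analytic_ring_def)
    show "germ_map s \<phi> (F * G) = germ_map s \<phi> F \<otimes>\<^bsub>local_ring s \<phi>\<^esub> germ_map s \<phi> G" for F G
      using T'[OF represents_mult[OF \<phi> v[of F] v[of G]]] h.hom_mult[OF vc[of F] vc[of G]]
      by (simp add: T analytic_ring_def)
    show "germ_map s \<phi> 1 = \<one>\<^bsub>local_ring s \<phi>\<^esub>"
      using T'[OF represents_const[of s \<phi> 1]] h.hom_one by (simp add: analytic_ring_def)
  qed
qed

lemma max_ideal_eq:
  assumes \<phi>: "chart s \<phi>"
  shows "max_ideal s \<phi> = germ_map s \<phi> ` {F. nth2 F 0 0 = 0}"
proof (intro subset_antisym subsetI)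
  fix x assume "x \<in> max_ideal s \<phi>"
  then obtain f F where f: "x = germ_of s \<phi> f" "represents s \<phi> f F" "f s = 0"
    using analytic_near_iff[OF \<phi>] unfolding max_ideal_def by blast
  then show "x \<in> germ_map s \<phi> ` {F. nth2 F 0 0 = 0}"
    using germ_of_eq_germ_map[OF \<phi> f(2)] represents_at[OF \<phi> f(2)] by auto
next
  fix x assume "x \<in> germ_map s \<phi> ` {F. nth2 F 0 0 = 0}"
  then obtain F where F: "x = germ_map s \<phi> F" "nth2 F 0 0 = 0" by auto
  define v where "v = (\<lambda>p. val2 F (fst (\<phi> p)) (snd (\<phi> p)))"
  have v: "represents s \<phi> v F" unfolding v_def by (rule represents_val2[OF \<phi>])
  then have "analytic_near s \<phi> v" "v s = 0" "x = germ_of s \<phi> v"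
    using analytic_near_iff[OF \<phi>] represents_at[OF \<phi> v] F by (auto simp: germ_map_def v_def)
  then show "x \<in> max_ideal s \<phi>" unfolding max_ideal_def by blast
qed

text \<open>Division by y writes the series as y q + r(x), and r = x r' since r(0) = 0. Without
  linear terms, q and r' vanish at the origin, so both products lie in the square of the maximal
  ideal.\<close>

lemma not_in_square_max_ideal:
  assumes \<phi>: "chart s \<phi>" and F: "nth2 F 0 0 = 0"
    and sq: "germ_map s \<phi> F \<notin> ideal_prod (local_ring s \<phi>) (max_ideal s \<phi>) (max_ideal s \<phi>)"
  shows "nth2 F 0 1 \<noteq> 0 \<or> nth2 F 1 0 \<noteq> 0"
proof (rule ccontr)
  assume "\<not> ?thesis"
  then have lin: "nth2 F 0 1 = 0" "nth2 F 1 0 = 0" by auto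
  interpret series_ring "local_ring s \<phi>" "germ_map s \<phi>" by (rule series_ring_local_ring[OF \<phi>])
  obtain q where q: "F = q * (varY - emb 0) + emb (ev 0 F)" using ev_decomp[of 0] by auto
  define r where "r = ev 0 F"
  have qr: "F = varY ^ 1 * q + emb r" using q by (simp add: r_def mult.commute)
  have r0: "nth1 r 0 = 0" using F nth1_ev_0[of 0 F] by (simp add: r_def)
  have r: "r = var1 ^ 1 * shift1 1 r" by (rule var1_power_dvd) (simp add: r0)
  have coeffs: "nth2 F i j = nth2 (varY ^ 1 * q) i j + nth2 (emb r) i j" for i j
    by (subst qr) (rule nth2_simps)
  have "nth2 q 0 0 = 0" using lin(1) unfolding coeffs[of 0 1] nth2_varY_power_mult by simp
  moreover have "nth1 r 1 = 0" using lin(2) unfolding coeffs[of 1 0] nth2_varY_power_mult by simp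
  ultimately have max: "germ_map s \<phi> varY \<in> max_ideal s \<phi>" "germ_map s \<phi> q \<in> max_ideal s \<phi>"
    "germ_map s \<phi> (emb var1) \<in> max_ideal s \<phi>" "germ_map s \<phi> (emb (shift1 1 r)) \<in> max_ideal s \<phi>"
    unfolding max_ideal_eq[OF \<phi>] by auto
  have "F = varY * q + emb var1 * emb (shift1 1 r)" using qr r by (simp flip: emb_mult)
  then have "germ_map s \<phi> F = germ_map s \<phi> varY \<otimes>\<^bsub>local_ring s \<phi>\<^esub> germ_map s \<phi> q
      \<oplus>\<^bsub>local_ring s \<phi>\<^esub> germ_map s \<phi> (emb var1) \<otimes>\<^bsub>local_ring s \<phi>\<^esub> germ_map s \<phi> (emb (shift1 1 r))"
    by (simp add: T_add T_mult)
  then show False using sq max by (auto intro: ideal_prod.intros)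
qed

section \<open>The ultrametric property\<close>

text \<open>The coordinates enter the definitions only through the class of analytic functions.\<close>

lemma coordinate_change:
  assumes "analytic_near s \<phi>' = analytic_near s \<phi>"
  shows "local_ring s \<phi>' = local_ring s \<phi>" "germ_of s \<phi>' = germ_of s \<phi>" "max_ideal s \<phi>' = max_ideal s \<phi>"
    "defining_function s \<phi>' = defining_function s \<phi>" "branch s \<phi>' = branch s \<phi>"
    "equation_of s \<phi>' = equation_of s \<phi>" "u_dist s \<phi>' = u_dist s \<phi>"
proof -
  have ring: "analytic_ring s \<phi>' = analytic_ring s \<phi>" "null_ideal s \<phi>' = null_ideal s \<phi>"
    by (simp_all add: analytic_ring_def null_ideal_def assms)
  show 1: "local_ring s \<phi>' = local_ring s \<phi>" by (simp add: local_ring_def ring)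
  show 2: "germ_of s \<phi>' = germ_of s \<phi>" by (simp add: germ_of_def[abs_def] ring)
  show 3: "max_ideal s \<phi>' = max_ideal s \<phi>" by (simp add: max_ideal_def assms 2)
  show 4: "defining_function s \<phi>' = defining_function s \<phi>"
    by (simp add: defining_function_def[abs_def] 1 3)
  show "branch s \<phi>' = branch s \<phi>" by (simp add: branch_def[abs_def] 4)
  show 5: "equation_of s \<phi>' = equation_of s \<phi>" by (simp add: equation_of_def[abs_def] 4)
  show "u_dist s \<phi>' = u_dist s \<phi>"
    unfolding u_dist_def[abs_def] branch_intersection_def intersection_number_def 1 2 5 ..
qed

text \<open>The equation of a branch is a Hilbert choice, so all that is known about it comes from
  \<open>defining_function\<close>.\<close>

lemma branch_equation:
  assumes \<phi>: "chart s \<phi>" and A: "branch s \<phi> A"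
  obtains P where "equation_of s \<phi> A = germ_map s \<phi> P" "Factorial_Ring.irreducible P" "nth2 P 0 0 = 0"
    "A = zero_locus s (germ_map s \<phi> P)"
proof -
  interpret series_ring "local_ring s \<phi>" "germ_map s \<phi>" by (rule series_ring_local_ring[OF \<phi>])
  have "defining_function s \<phi> A (equation_of s \<phi> A)"
    using A unfolding branch_def equation_of_def by (rule someI_ex)
  then have *: "equation_of s \<phi> A \<in> max_ideal s \<phi>" "ring_irreducible\<^bsub>local_ring s \<phi>\<^esub> (equation_of s \<phi> A)"
    "A = zero_locus s (equation_of s \<phi> A)"
    unfolding defining_function_def by blast+
  obtain P where "equation_of s \<phi> A = germ_map s \<phi> P" "nth2 P 0 0 = 0"
    using *(1) unfolding max_ideal_eq[OF \<phi>] by blast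
  with * that irreducible_transfer[of P] show ?thesis by metis
qed

lemma zero_locus_unit_mult_subset:
  assumes \<phi>: "chart s \<phi>" and w: "w dvd 1"
  shows "zero_locus s (germ_map s \<phi> F) \<subseteq> zero_locus s (germ_map s \<phi> (w * F))"
proof
  fix X assume "X \<in> zero_locus s (germ_map s \<phi> F)"
  then obtain f where f: "represents s \<phi> f F" "\<forall>\<^sub>F p in nhds s. p \<in> X \<longleftrightarrow> f p = 0"
    unfolding zero_locus_def germ_map_eq[OF \<phi>] by blast
  obtain v where v: "1 = w * v" using w by (elim dvdE)
  define g h where "g = (\<lambda>p. val2 w (fst (\<phi> p)) (snd (\<phi> p)))" and "h = (\<lambda>p. val2 v (fst (\<phi> p)) (snd (\<phi> p)))"
  have g: "represents s \<phi> g w" and h: "represents s \<phi> h v"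
    unfolding g_def h_def by (rule represents_val2[OF \<phi>])+
  have "\<forall>\<^sub>F p in nhds s. g p * h p = 1"
    using represents_eventually_eq[OF represents_mult[OF \<phi> g h], of "\<lambda>_. 1"] represents_const[of s \<phi> 1] v by simp
  with f(2) have "\<forall>\<^sub>F p in nhds s. p \<in> X \<longleftrightarrow> g p * f p = 0"
    by eventually_elim auto
  then show "X \<in> zero_locus s (germ_map s \<phi> (w * F))"
    using represents_mult[OF \<phi> g f(1)] unfolding zero_locus_def germ_map_eq[OF \<phi>]
    by (intro CollectI bexI[of _ "\<lambda>p. g p * f p"])
qed

lemma zero_locus_unit_mult:
  assumes \<phi>: "chart s \<phi>" and w: "w dvd 1"
  shows "zero_locus s (germ_map s \<phi> (w * F)) = zero_locus s (germ_map s \<phi> F)"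
proof
  show "zero_locus s (germ_map s \<phi> F) \<subseteq> zero_locus s (germ_map s \<phi> (w * F))"
    by (rule zero_locus_unit_mult_subset[OF \<phi> w])
  obtain v where v: "1 = w * v" using w by (elim dvdE)
  then have "v dvd 1" by (metis dvd_triv_right)
  moreover have "v * (w * F) = F" using arg_cong[OF v, of "\<lambda>x. x * F"] by (simp add: mult_ac)
  ultimately show "zero_locus s (germ_map s \<phi> (w * F)) \<subseteq> zero_locus s (germ_map s \<phi> F)"
    using zero_locus_unit_mult_subset[OF \<phi>, of v "w * F"] by metis
qed

lemma intersection_number_eq:
  assumes \<phi>: "chart s \<phi>" and "has_codim (ideal2 F G) n" "n > 0"
  shows "intersection_number s \<phi> (germ_map s \<phi> F) (germ_map s \<phi> G) = enat n"
proof -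
  interpret series_ring "local_ring s \<phi>" "germ_map s \<phi>" by (rule series_ring_local_ring[OF \<phi>])
  have "germ_of s \<phi> (\<lambda>_. c) = germ_map s \<phi> (cst c)" for c
    by (rule germ_of_eq_germ_map[OF \<phi> represents_const])
  then show ?thesis
    using quotient_dimension[OF assms(2,3)] unfolding intersection_number_def Let_def by simp
qed

text \<open>Vanishing on the axis means divisibility by x, with \<open>contract2 1 1\<close> as the
  quotient; irreducibility makes this quotient a unit.\<close>

lemma irreducible_axis_zero:
  assumes "Factorial_Ring.irreducible P" "\<And>j. nth2 P 0 j = 0"
  shows "\<exists>w. w dvd 1 \<and> P = w * emb var1"
proof -
  have "P = emb var1 ^ 1 * contract2 1 1 P"
  proof (rule cser2_eqI)
    fix i j
    show "nth2 P i j = nth2 (emb var1 ^ 1 * contract2 1 1 P) i j"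
      unfolding nth2_emb_var1_power_mult using assms(2) by auto
  qed
  then have P: "P = emb var1 * contract2 1 1 P" by simp
  then have "emb var1 dvd 1 \<or> contract2 1 1 P dvd 1"
    using assms(1) unfolding Factorial_Ring.irreducible_def by blast
  moreover have "\<not> emb var1 dvd 1" by (simp add: cser2_unit_iff)
  ultimately show ?thesis using P by (metis mult.commute)
qed

text \<open>All functions in the chosen germ have the same expansion. Its order is positive, so the
  zero set of the power is that of the linear form, and every tangent line equals the zero set of
  the initial form.\<close>

lemma tangent_line_unique:
  assumes \<phi>: "chart s \<phi>" and A: "branch s \<phi> A"
    and "is_tangent_line s \<phi> A T" "is_tangent_line s \<phi> A T'"
  shows "T = T'"
proof -
  obtain P where P: "equation_of s \<phi> A = germ_map s \<phi> P" "Factorial_Ring.irreducible P" "nth2 P 0 0 = 0"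
    using branch_equation[OF \<phi> A] by metis
  have exp: "a = nth2 P" if f: "f \<in> equation_of s \<phi> A" and a: "has_expansion s \<phi> f a" for f a
  proof -
    obtain F where F: "a = nth2 F" using has_expansion_convergent[OF \<phi> a] by blast
    have "represents s \<phi> f F" using a F by (simp add: represents_def)
    moreover have "represents s \<phi> f P" using f P(1) germ_map_eq[OF \<phi>] by blast
    ultimately show ?thesis using represents_unique[OF \<phi>] F by blast
  qed
  define d where "d = expansion_order (nth2 P)"
  have d: "d \<noteq> 0"
  proof
    assume "d = 0"
    have "P \<noteq> 0" using P(2) by (simp add: Factorial_Ring.irreducible_def)
    then obtain i j where "nth2 P i j \<noteq> 0" using cser2_eqI[of P 0] by auto
    then have "\<exists>k i j. i + j = k \<and> nth2 P i j \<noteq> 0" by blast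
    then have "\<exists>i j. i + j = d \<and> nth2 P i j \<noteq> 0"
      unfolding d_def expansion_order_def by (rule LeastI_ex)
    then show False using \<open>d = 0\<close> P(3) by auto
  qed
  have line: "\<exists>\<alpha> \<beta>. (\<forall>u v. initial_form (nth2 P) u v = (\<alpha> * u + \<beta> * v) ^ d) \<and> T = {(u, v). \<alpha> * u + \<beta> * v = 0}"
    if "is_tangent_line s \<phi> A T" for T
    using that exp unfolding is_tangent_line_def d_def by metis
  have zero: "T = {(u, v). initial_form (nth2 P) u v = 0}" if "is_tangent_line s \<phi> A T" for T
    using line[OF that] d by auto
  show ?thesis using zero[OF assms(3)] zero[OF assms(4)] by simp
qed

lemma enat_to_real_enat [simp]: "enat_to_real (enat n) = real n"
  by (simp add: enat_to_real_def)

lemma enat_to_real_nonneg: "enat_to_real n \<ge> 0"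
  by (cases n) (simp_all add: enat_to_real_def)

lemma branch_intersection_commute: "branch_intersection s \<phi> A B = branch_intersection s \<phi> B A"
  by (simp add: branch_intersection_def intersection_number_def insert_commute)

lemma u_dist_nonneg: "u_dist s \<phi> L A B \<ge> 0"
  by (simp add: u_dist_def enat_to_real_nonneg)

lemma u_dist_commute: "u_dist s \<phi> L A B = u_dist s \<phi> L B A"
  by (simp add: u_dist_def branch_intersection_commute[of s \<phi> A B] mult.commute)

lemma u_dist_self [simp]: "u_dist s \<phi> L A A = 0"
  by (simp add: u_dist_def)

lemma ultrametric_onI:
  assumes pos: "\<And>A B. A \<in> M \<Longrightarrow> B \<in> M \<Longrightarrow> A \<noteq> B \<Longrightarrow> u_dist s \<phi> L A B > 0"
    and tri: "\<And>A B C. A \<in> M \<Longrightarrow> B \<in> M \<Longrightarrow> C \<in> M \<Longrightarrow> A \<noteq> B \<Longrightarrow> A \<noteq> C \<Longrightarrow> B \<noteq> C \<Longrightarrow>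
      u_dist s \<phi> L A B \<le> max (u_dist s \<phi> L A C) (u_dist s \<phi> L B C)"
  shows "ultrametric_on M (u_dist s \<phi> L)"
proof -
  have tri': "u_dist s \<phi> L A B \<le> max (u_dist s \<phi> L A C) (u_dist s \<phi> L B C)"
    if "A \<in> M" "B \<in> M" "C \<in> M" for A B C
  proof -
    consider "A = B" | "A = C" | "B = C" | "A \<noteq> B" "A \<noteq> C" "B \<noteq> C" by blast
    then show ?thesis
    proof cases
      case 1
      then show ?thesis by (simp add: le_max_iff_disj u_dist_nonneg)
    next
      case 2
      then show ?thesis using u_dist_commute[of s \<phi> L A B] by simp
    next
      case 3
      then show ?thesis by simp
    next
      case 4
      then show ?thesis by (rule tri[OF that])
    qed
  qed
  moreover have "Metric_space M (u_dist s \<phi> L)"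
  proof
    show "0 \<le> u_dist s \<phi> L A B" for A B by (rule u_dist_nonneg)
    show "u_dist s \<phi> L A B = u_dist s \<phi> L B A" for A B by (rule u_dist_commute)
    show "u_dist s \<phi> L A B = 0 \<longleftrightarrow> A = B" if "A \<in> M" "B \<in> M" for A B
      using pos[OF that] by (cases "A = B") auto
    show "u_dist s \<phi> L A C \<le> u_dist s \<phi> L A B + u_dist s \<phi> L B C"
      if "A \<in> M" "B \<in> M" "C \<in> M" for A B C
    proof -
      have "u_dist s \<phi> L A C \<le> max (u_dist s \<phi> L A B) (u_dist s \<phi> L C B)" using that by (intro tri')
      then show ?thesis
        using u_dist_nonneg[of s \<phi> L A B] u_dist_nonneg[of s \<phi> L B C] u_dist_commute[of s \<phi> L B C] by linarith
    qed
  qed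
  ultimately show ?thesis unfolding ultrametric_on_def by blast
qed

text \<open>The chosen equation of L is known only up to a unit \<open>w\<close>, which changes
  neither the ideals nor the zero locus.\<close>

theorem ultrametric_straight:
  assumes \<phi>: "chart s \<phi>" and branches: "\<And>A. A \<in> M \<Longrightarrow> branch s \<phi> A" and L_notin: "L \<notin> M"
    and w: "w dvd 1" and L_eq: "equation_of s \<phi> L = germ_map s \<phi> (w * emb var1)"
    and L_locus: "L = zero_locus s (germ_map s \<phi> (w * emb var1))"
  shows "ultrametric_on M (u_dist s \<phi> L)"
proof -
  have "\<exists>P. equation_of s \<phi> A = germ_map s \<phi> P \<and> Factorial_Ring.irreducible P \<and>
      zero_locus s (germ_map s \<phi> P) = A" if A: "A \<in> M" for A
  proof -
    obtain P where P: "equation_of s \<phi> A = germ_map s \<phi> P" "Factorial_Ring.irreducible P"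
      "A = zero_locus s (germ_map s \<phi> P)"
      using branch_equation[OF \<phi> branches[OF A]] .
    show ?thesis by (intro exI[of _ P] conjI P P(3)[symmetric])
  qed
  then have "\<forall>A\<in>M. \<exists>P. equation_of s \<phi> A = germ_map s \<phi> P \<and> Factorial_Ring.irreducible P \<and>
      zero_locus s (germ_map s \<phi> P) = A" by (rule ballI)
  from bchoice[OF this] obtain P where
    all: "\<forall>A\<in>M. equation_of s \<phi> A = germ_map s \<phi> (P A) \<and> Factorial_Ring.irreducible (P A) \<and>
      zero_locus s (germ_map s \<phi> (P A)) = A" ..
  have P: "equation_of s \<phi> A = germ_map s \<phi> (P A)" "Factorial_Ring.irreducible (P A)"
    "zero_locus s (germ_map s \<phi> (P A)) = A" if "A \<in> M" for A
    using bspec[OF all that] by simp_all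
  \<comment> \<open>An equation vanishing on the axis is associated to x, so its branch would have
    the zero locus of x, which is L.\<close>
  have axis: "\<exists>j. nth2 (P A) 0 j \<noteq> 0" if A: "A \<in> M" for A
  proof (rule ccontr)
    assume "\<not> (\<exists>j. nth2 (P A) 0 j \<noteq> 0)"
    then have "nth2 (P A) 0 j = 0" for j by simp
    from irreducible_axis_zero[OF P(2)[OF A] this]
    obtain v where v: "v dvd 1" "P A = v * emb var1" by blast
    have "A = zero_locus s (germ_map s \<phi> (emb var1))"
      using P(3)[OF A] v zero_locus_unit_mult[OF \<phi> v(1)] by simp
    also have "\<dots> = L" using L_locus zero_locus_unit_mult[OF \<phi> w] by simp
    finally show False using A L_notin by simp
  qed
  \<comment> \<open>Associated equations define the same germ of sets, so different branches have
    non-associated equations; no Nullstellensatz enters.\<close>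
  have distinct: "P A \<noteq> v * P B" if "A \<in> M" "B \<in> M" "A \<noteq> B" "v dvd 1" for A B v
    using P(3)[OF that(1)] P(3)[OF that(2)] that(3) zero_locus_unit_mult[OF \<phi> that(4)] by metis
  have AB: "branch_intersection s \<phi> A B = enat n"
    if "A \<in> M" "B \<in> M" "has_codim (ideal2 (P A) (P B)) n" "n > 0" for A B n
    using intersection_number_eq[OF \<phi> that(3,4)] that(1,2) P(1) by (simp add: branch_intersection_def)
  have LA: "branch_intersection s \<phi> L A = enat n"
    if "A \<in> M" "has_codim (ideal2 (emb var1) (P A)) n" "n > 0" for A n
    using intersection_number_eq[OF \<phi> _ that(3), of "w * emb var1" "P A"] that(1,2) P(1) L_eq
    by (simp add: branch_intersection_def ideal2_unit_mult[OF w])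
  show ?thesis
  proof (rule ultrametric_onI)
    fix A B assume M: "A \<in> M" "B \<in> M" and ne: "A \<noteq> B"
    obtain f x where 1: "has_codim (ideal2 (emb var1) (P A)) f" "has_codim (ideal2 (P A) (P B)) x" "f > 0" "x > 0"
      using codim_positive[OF P(2)[OF M(1)] P(2)[OF M(2)] axis[OF M(1)] axis[OF M(2)] distinct[OF M ne]] by blast
    obtain g where 2: "has_codim (ideal2 (emb var1) (P B)) g" "g > 0"
      using codim_positive[OF P(2)[OF M(2)] P(2)[OF M(1)] axis[OF M(2)] axis[OF M(1)] distinct[OF M(2,1) ne[symmetric]]]
      by blast
    show "u_dist s \<phi> L A B > 0"
      using ne 1 2 by (simp add: u_dist_def LA[OF M(1) 1(1,3)] LA[OF M(2) 2] AB[OF M 1(2,4)])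
  next
    fix A B C assume M: "A \<in> M" "B \<in> M" "C \<in> M" and ne: "A \<noteq> B" "A \<noteq> C" "B \<noteq> C"
    obtain f g h x y z where
      1: "has_codim (ideal2 (emb var1) (P A)) f" "has_codim (ideal2 (emb var1) (P B)) g"
        "has_codim (ideal2 (emb var1) (P C)) h" "has_codim (ideal2 (P A) (P B)) x"
        "has_codim (ideal2 (P A) (P C)) y" "has_codim (ideal2 (P B) (P C)) z" and
      pos: "f > 0" "g > 0" "h > 0" "x > 0" "y > 0" "z > 0" and
      le: "real f * real g / real x \<le> max (real f * real h / real y) (real g * real h / real z)"
      using codim_strong_triangle[OF P(2)[OF M(1)] P(2)[OF M(2)] P(2)[OF M(3)]
          axis[OF M(1)] axis[OF M(2)] axis[OF M(3)]
          distinct[OF M(1,2) ne(1)] distinct[OF M(1,3) ne(2)] distinct[OF M(2,3) ne(3)]] by blast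
    show "u_dist s \<phi> L A B \<le> max (u_dist s \<phi> L A C) (u_dist s \<phi> L B C)"
      using ne le unfolding u_dist_def
      by (simp add: LA[OF M(1) 1(1) pos(1)] LA[OF M(2) 1(2) pos(2)] LA[OF M(3) 1(3) pos(3)]
          AB[OF M(1,2) 1(4) pos(4)] AB[OF M(1,3) 1(5) pos(5)] AB[OF M(2,3) 1(6) pos(6)])
  qed
qed

theorem theoremA:
  fixes s :: "'a::topological_space"
    and \<phi> :: "'a \<Rightarrow> complex \<times> complex"
    and L :: "'a set set"
    and \<F> :: "'a set set set"
  assumes "smooth_surface_germ s \<phi>"
    and "smooth_branch s \<phi> L"
    and "finite \<F>"
    and "\<And>A. A \<in> \<F> \<Longrightarrow> branch s \<phi> A"
    and "\<And>A. A \<in> \<F> \<Longrightarrow> transversal s \<phi> A L"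
  shows "ultrametric_on \<F> (u_dist s \<phi> L)"
proof -
  have \<phi>: "chart s \<phi>" by (rule smooth_surface_germ_chart[OF assms(1)])
  have L: "branch s \<phi> L" using assms(2) unfolding smooth_branch_def branch_def by blast
  \<comment> \<open>A branch transversal to L has a tangent line different from some tangent line of
    L; L has only one tangent line.\<close>
  have L_notin: "L \<notin> \<F>"
  proof
    assume "L \<in> \<F>"
    from assms(5)[OF this] show False using tangent_line_unique[OF \<phi> L] unfolding transversal_def by blast
  qed
  obtain E where E: "E \<in> max_ideal s \<phi>" "L = zero_locus s E"
    and sq: "E \<notin> ideal_prod (local_ring s \<phi>) (max_ideal s \<phi>) (max_ideal s \<phi>)"
    using assms(2) unfolding smooth_branch_def defining_function_def by blast
  obtain F where F: "E = germ_map s \<phi> F" "nth2 F 0 0 = 0" using E(1) unfolding max_ideal_eq[OF \<phi>] by blast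
  have lin: "nth2 F 0 1 \<noteq> 0 \<or> nth2 F 1 0 \<noteq> 0"
    using not_in_square_max_ideal[OF \<phi> F(2)] sq F(1) by blast
  define f where "f = (\<lambda>p. val2 F (fst (\<phi> p)) (snd (\<phi> p)))"
  have f: "represents s \<phi> f F" unfolding f_def by (rule represents_val2[OF \<phi>])
  obtain \<psi> u where \<psi>: "chart s \<psi>" and an: "analytic_near s \<psi> = analytic_near s \<phi>" and u: "u dvd 1"
    and fu: "represents s \<psi> f (u * emb var1)"
    using straighten_smooth[OF \<phi> f F(2) lin] by blast
  note change = coordinate_change[OF an]
  have E\<psi>: "E = germ_map s \<psi> (u * emb var1)"
    using germ_of_eq_germ_map[OF \<psi> fu] germ_of_eq_germ_map[OF \<phi> f] F(1) change(2) by simp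
  have L\<psi>: "branch s \<psi> L" using L change(5) by simp
  obtain P where P: "equation_of s \<psi> L = germ_map s \<psi> P" "Factorial_Ring.irreducible P"
    "L = zero_locus s (germ_map s \<psi> P)"
    using branch_equation[OF \<psi> L\<psi>] by metis
  \<comment> \<open>The chosen equation of L need not be the smooth one \<open>E\<close>. Both have
    the same zero locus, which in the new coordinates is the axis, so \<open>P\<close> vanishes
    there and is associated to x.\<close>
  have "nth2 P 0 j = 0" for j
  proof -
    have "{p. f p = 0} \<in> zero_locus s E"
      using fu unfolding zero_locus_def E\<psi> germ_map_eq[OF \<psi>] by (auto intro!: exI[of _ f])
    then have "{p. f p = 0} \<in> zero_locus s (germ_map s \<psi> P)" using E(2) P(3) by simp
    then obtain g where g: "represents s \<psi> g P" "\<forall>\<^sub>F p in nhds s. f p = 0 \<longleftrightarrow> g p = 0"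
      unfolding zero_locus_def germ_map_eq[OF \<psi>] by auto
    define v where "v = (\<lambda>p. val2 u (fst (\<psi> p)) (snd (\<psi> p)))"
    have "represents s \<psi> v u" unfolding v_def by (rule represents_val2[OF \<psi>])
    then have "\<forall>\<^sub>F p in nhds s. f p = v p * fst (\<psi> p)"
      by (intro represents_eventually_eq[OF fu represents_mult[OF \<psi> _ represents_x]])
    with g(2) have "\<forall>\<^sub>F p in nhds s. fst (\<psi> p) = 0 \<longrightarrow> g p = 0" by eventually_elim auto
    then show ?thesis by (rule represents_axis_zero[OF \<psi> g(1)])
  qed
  from irreducible_axis_zero[OF P(2) this]
  obtain w where w: "w dvd 1" "P = w * emb var1" by blast
  have "ultrametric_on \<F> (u_dist s \<psi> L)"
  proof (rule ultrametric_straight[OF \<psi> _ L_notin w(1)])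
    show "branch s \<psi> A" if "A \<in> \<F>" for A using assms(4)[OF that] change(5) by simp
    show "equation_of s \<psi> L = germ_map s \<psi> (w * emb var1)" using P(1) w(2) by simp
    show "L = zero_locus s (germ_map s \<psi> (w * emb var1))" using P(3) w(2) by simp
  qed
  then show ?thesis using change(7) by simp
qed

end
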